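(* Let $(S,0)$ be an irreducible germ of quasi-ordinary hypersurface of dimension $d$ defined by a normalized quasi-ordinary polynomial, and let $\underline v=(v_1,\dots,v_r)$ be a sequence of non-zero vectors in $\sigma\cap N$ with $v_1\in\stackrel{\circ}{\sigma}$, defining monomial valuations $\underline\nu=(\nu_1,\dots,\nu_r)$ of $\mathcal O_S$. Then $$P^{\underline\nu}_{(S,0)}=\Phi^{\underline v}(P_{\Gamma_\pi})=\prod_{j=1}^d\frac{1}{1-\underline t^{\langle\underline v,e_j\rangle}}\ \prod_{i=1}^g\frac{1-\underline t^{\langle\underline v,n_i\gamma_i\rangle}}{1-\underline t^{\langle\underline v,\gamma_i\rangle}}\in\mathbf C(\underline t).$$
   Context: **Quasi-ordinary hypersurfaces.** A germ of algebroid hypersurface $(S,0)\subset(\mathbf C^{d+1},0)$ is quasi-ordinary if there is a finite morphism $\pi:(S,0)\to(\mathbf C^d,0)$ whose discriminant locus is contained in a normal crossing divisor. In suitable coordinates $S$ is $f=0$ with $f\in\mathbf C[[x_1,\dots,x_d]][y]$ a Weierstrass polynomial of degree $n$ (irreducible, since $S$ is) whose discriminant in $y$ is a monomial times a unit (a quasi-ordinary polynomial). Its roots lie in $\mathbf C[[x_1^{1/n},\dots,x_d^{1/n}]]$; the difference of two distinct roots is a monomial times a unit, and the exponents so obtained are the characteristic exponents $\lambda_1<\dots<\lambda_g$ in $\mathbf Q^d$ ($<$: $\le$ coordinate-wise and $\ne$). Write $\lambda_j=(\lambda_j^1,\dots,\lambda_j^d)$. $f$ is normalized if $(\lambda_1^1,\dots,\lambda_g^1)\ge_{\rm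 lex}\cdots\ge_{\rm lex}(\lambda_1^d,\dots,\lambda_g^d)$ and, if $\lambda_1=(\lambda_1^1,0,\dots,0)$, then $\lambda_1^1>1$. Let $M_0=\mathbf Z^d$ with canonical basis $e_1,\dots,e_d$, $M_j=M_{j-1}+\mathbf Z\lambda_j$, $M=M_g$, $n_j=[M_j:M_{j-1}]>1$; $N$ is the dual lattice of $M$ and $\sigma\subset N_{\mathbf R}$ is the cone spanned by the dual basis of $e_1,\dots,e_d$. Put $\gamma_1=\lambda_1$, $\gamma_{j+1}-n_j\gamma_j=\lambda_{j+1}-\lambda_j$ for $1\le j\le g-1$, and $\Gamma_\pi=\mathbf Z^d_{\ge0}+\gamma_1\mathbf Z_{\ge0}+\cdots+\gamma_g\mathbf Z_{\ge0}$. Its generating series is $P_{\Gamma_\pi}=\sum_{\gamma\in\Gamma_\pi}X^\gamma\in\mathbf C[[\Gamma_\pi]]$. For a root $\zeta$ of $f$, $\mathcal O_S=\mathbf C[[x]][\zeta]\subset\mathbf C[[\sigma^\vee\cap M]]$ ($x_i=X^{e_i}$) is the inclusion in the integral closure. A non-zero $v\in\sigma\cap N$ defines a monomial valuation $\nu(\sum c_uX^u)=\min_{c_u\neq0}\langle v,u\rangle$ of $\mathbf C[[\sigma^\vee\cap M]]$ and of $\mathcal O_S$. Notation: $\langle\underline v,u\rangle=(\langle v_1,u\rangle,\dots,\langle v_r,u\rangle)$, $\underline t^{\underline a}=t_1^{a_1}\cdots t_r^{a_r}$, and $\Phi^{\underline v}:\mathbf C[[\Gamma_\pi]]\to\mathbf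 C[[\underline t]]$ is the monomial map $X^\gamma\mapsto\underline t^{\langle\underline v,\gamma\rangle}$. **Poincaré series.** Put $R=\mathcal O_S$, $\mathrm{gr}_{\nu_1}R=\bigoplus_aI(a)/I(a+1)$, $I(a)=\{\phi\in R:\nu_1(\phi)\ge a\}$. Each other $\nu_i$ induces a valuation on it: on a non-zero homogeneous $\bar h\in I(a)/I(a+1)$ its value is $\max\{\nu_i(h):h+I(a+1)=\bar h\}$, and on a sum of non-zero homogeneous terms it is the minimum of the values. The induced valuations have homogeneous valuation ideals; taking successively associated graded rings with respect to the valuations induced by $\nu_2,\dots,\nu_r$ (inducing the remaining valuations at each step in the same way) gives a $\mathbf Z^r_{\ge0}$-graded ring $\mathrm{gr}_{\underline\nu}R=\bigoplus_{\underline a}J(\underline a)$ with finite-dimensional components, and $P^{\underline\nu}_{(S,0)}=\sum_{\underline a\in\mathbf Z^r_{\ge0}}\dim_{\mathbf C}J(\underline a)\,\underline t^{\underline a}\in\mathbf Z[[\underline t]]$. *)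

theory Defs
  imports
    "HOL-Analysis.Analysis"
    "HOL-Computational_Algebra.Polynomial_Factorial"
    "Subresultants.Resultant_Prelim"
begin

no_notation Matrix.vec_index (infixl \<open>$\<close> 100)
no_notation Matrix.scalar_prod (infix \<open>\<bullet>\<close> 70)

section \<open>Formal power series in finitely many variables\<close>

text \<open>The variables are indexed by a finite type; \<open>nat ^ 'i\<close> is the monoid of exponents.\<close>

typedef ('a, 'i::finite) mfps = "UNIV :: (nat ^ 'i \<Rightarrow> 'a) set"
  morphisms mcoeff Mfps by simp

lemma mcoeff_Mfps [simp]: "mcoeff (Mfps F) = F"
  by (simp add: Mfps_inverse)

lemma mfps_eqI: "(\<And>u. mcoeff f u = mcoeff g u) \<Longrightarrow> f = g"
  by (metis ext mcoeff_inject)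

lemma mfps_eq_iff: "f = g \<longleftrightarrow> (\<forall>u. mcoeff f u = mcoeff g u)"
  using mfps_eqI by blast

definition splits :: "nat ^ 'i::finite \<Rightarrow> ((nat ^ 'i) \<times> (nat ^ 'i)) set"
  where "splits c = {(a, b). a + b = c}"

lemma finite_splits [simp]:
  fixes c :: "nat ^ 'i::finite"
  shows "finite (splits c)"
proof -
  have fin: "finite {a :: nat ^ 'i. \<forall>i. a $ i \<le> c $ i}" (is "finite ?A")
  proof (rule finite_imageD)
    have "vec_nth ` ?A \<subseteq> (\<Pi>\<^sub>E i\<in>UNIV. {..c $ i})"
      by (auto simp: PiE_def)
    then show "finite (vec_nth ` ?A)"
      by (rule finite_subset) (auto intro: finite_PiE)
    show "inj_on vec_nth ?A"
      by (auto simp: inj_on_def vec_nth_inject)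
  qed
  have "splits c \<subseteq> ?A \<times> ?A"
    by (auto simp: splits_def)
  then show ?thesis
    by (rule finite_subset) (rule finite_cartesian_product [OF fin fin])
qed

instantiation mfps :: (zero, finite) zero
begin
definition "0 = Mfps (\<lambda>_. 0)"
instance ..
end

instantiation mfps :: ("{zero,one}", finite) one
begin
definition "1 = Mfps (\<lambda>u. if u = 0 then 1 else 0)"
instance ..
end

instantiation mfps :: (comm_ring_1, finite) comm_ring_1
begin

definition "f + g = Mfps (\<lambda>u. mcoeff f u + mcoeff g u)"
definition "f - g = Mfps (\<lambda>u. mcoeff f u - mcoeff g u)"
definition "- f = Mfps (\<lambda>u. - mcoeff f u)"
definition "f * g = Mfps (\<lambda>u. \<Sum>(a, b)\<in>splits u. mcoeff f a * mcoeff g b)"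

lemma splits_assoc:
  fixes F :: "nat ^ 'i::finite \<Rightarrow> nat ^ 'i \<Rightarrow> nat ^ 'i \<Rightarrow> 'c::comm_monoid_add"
  shows "(\<Sum>(s, c)\<in>splits u. \<Sum>(a, b)\<in>splits s. F a b c) = (\<Sum>(a, s)\<in>splits u. \<Sum>(b, c)\<in>splits s. F a b c)"
proof -
  have "(\<Sum>(s, c)\<in>splits u. \<Sum>(a, b)\<in>splits s. F a b c) =
        (\<Sum>((s, c), (a, b))\<in>Sigma (splits u) (\<lambda>(s, c). splits s). F a b c)"
    by (subst sum.Sigma [symmetric]) (auto simp: case_prod_unfold)
  also have "\<dots> = (\<Sum>((a, s), (b, c))\<in>Sigma (splits u) (\<lambda>(a, s). splits s). F a b c)"
    by (rule sum.reindex_bij_witness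
         [where i = "\<lambda>((a, s), (b, c)). ((a + b, c), (a, b))"
            and j = "\<lambda>((s, c), (a, b)). ((a, b + c), (b, c))"])
       (auto simp: splits_def ac_simps)
  also have "\<dots> = (\<Sum>(a, s)\<in>splits u. \<Sum>(b, c)\<in>splits s. F a b c)"
    by (subst sum.Sigma [symmetric]) (auto simp: case_prod_unfold)
  finally show ?thesis .
qed

instance
proof
  fix f g h :: "('a, 'b) mfps"
  show "f + g + h = f + (g + h)" "f + g = g + f" "0 + f = f" "- f + f = 0" "f - g = f + - g"
    by (simp_all add: mfps_eq_iff plus_mfps_def zero_mfps_def minus_mfps_def uminus_mfps_def)
  show "f * g * h = f * (g * h)"
  proof (rule mfps_eqI)
    fix u
    have "mcoeff (f * g * h) u
        = (\<Sum>(s, c)\<in>splits u. \<Sum>(a, b)\<in>splits s. mcoeff f a * mcoeff g b * mcoeff h c)"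
      by (simp add: times_mfps_def sum_distrib_right case_prod_unfold)
    also have "\<dots> = (\<Sum>(a, s)\<in>splits u. \<Sum>(b, c)\<in>splits s. mcoeff f a * mcoeff g b * mcoeff h c)"
      by (rule splits_assoc)
    also have "\<dots> = mcoeff (f * (g * h)) u"
      by (simp add: times_mfps_def sum_distrib_left case_prod_unfold mult.assoc)
    finally show "mcoeff (f * g * h) u = mcoeff (f * (g * h)) u" .
  qed
  show "f * g = g * f"
  proof (rule mfps_eqI)
    fix u
    show "mcoeff (f * g) u = mcoeff (g * f) u"
      unfolding times_mfps_def mcoeff_Mfps
      by (rule sum.reindex_bij_witness [where i = prod.swap and j = prod.swap])
         (auto simp: splits_def ac_simps)
  qed
  show "1 * f = f"
  proof (rule mfps_eqI)
    fix u
    have "mcoeff (1 * f) u = (\<Sum>(a, b)\<in>splits u. (if a = 0 then 1 else 0) * mcoeff f b)"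
      by (simp add: times_mfps_def one_mfps_def)
    also have "\<dots> = (\<Sum>(a, b)\<in>{(0 :: nat ^ 'b, u)}. (if a = 0 then 1 else 0) * mcoeff f b)"
      by (rule sum.mono_neutral_right [OF finite_splits])
         (auto simp: splits_def split: if_splits)
    finally show "mcoeff (1 * f) u = mcoeff f u" by simp
  qed
  show "(f + g) * h = f * h + g * h"
    by (simp add: mfps_eq_iff plus_mfps_def times_mfps_def case_prod_unfold
        distrib_right sum.distrib)
  show "(0 :: ('a, 'b) mfps) \<noteq> 1"
    by (auto simp: mfps_eq_iff zero_mfps_def one_mfps_def)
qed

end

text \<open>No cancellation: successively minimising the coordinates over the two supports
  isolates a single product of coefficients.\<close>

lemma isolated_sum:
  fixes S T :: "(nat ^ 'i::finite) set"
  assumes "S \<noteq> {}" "T \<noteq> {}"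
  obtains a b where "a \<in> S" "b \<in> T"
    "\<And>a' b'. a' \<in> S \<Longrightarrow> b' \<in> T \<Longrightarrow> a' + b' = a + b \<Longrightarrow> a' = a \<and> b' = b"
proof -
  define P where "P I S' T' \<longleftrightarrow> S' \<subseteq> S \<and> T' \<subseteq> T \<and> S' \<noteq> {} \<and> T' \<noteq> {} \<and>
      (\<forall>a\<in>S'. \<forall>a'\<in>S'. \<forall>i\<in>I. a $ i = a' $ i) \<and> (\<forall>b\<in>T'. \<forall>b'\<in>T'. \<forall>i\<in>I. b $ i = b' $ i) \<and>
      (\<forall>a\<in>S'. \<forall>b\<in>T'. \<forall>a'\<in>S. \<forall>b'\<in>T. a' + b' = a + b \<longrightarrow> a' \<in> S' \<and> b' \<in> T')"
    for I :: "'i set" and S' T'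
  have closed: "a' \<in> S' \<and> b' \<in> T'"
    if "P I S' T'" "a \<in> S'" "b \<in> T'" "a' \<in> S" "b' \<in> T" "a' + b' = a + b" for I S' T' a b a' b'
  proof -
    have "\<forall>a\<in>S'. \<forall>b\<in>T'. \<forall>a'\<in>S. \<forall>b'\<in>T. a' + b' = a + b \<longrightarrow> a' \<in> S' \<and> b' \<in> T'"
      using that(1) unfolding P_def by (elim conjE)
    then show ?thesis using that(2-) by metis
  qed
  have Psub: "S' \<subseteq> S \<and> T' \<subseteq> T" if "P I S' T'" for I S' T'
    using that unfolding P_def by (elim conjE) (intro conjI)
  have Pne: "S' \<noteq> {} \<and> T' \<noteq> {}" if "P I S' T'" for I S' T'
    using that unfolding P_def by (elim conjE) (intro conjI)
  have PeqS: "\<forall>a\<in>S'. \<forall>a'\<in>S'. \<forall>i\<in>I. a $ i = a' $ i" if "P I S' T'" for I S' T'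
    using that unfolding P_def by (elim conjE)
  have PeqT: "\<forall>b\<in>T'. \<forall>b'\<in>T'. \<forall>i\<in>I. b $ i = b' $ i" if "P I S' T'" for I S' T'
    using that unfolding P_def by (elim conjE)
  have step: "\<exists>S'' T''. P (insert i I) S'' T''" if P: "P I S' T'" for i I S' T'
  proof -
    have "S' \<noteq> {}" "T' \<noteq> {}" using Pne [OF P] by blast+
    obtain a0 where a0: "a0 \<in> S'" "\<And>a. a \<in> S' \<Longrightarrow> a0 $ i \<le> a $ i"
      using ex_has_least_nat [of "\<lambda>a. a \<in> S'" _ "\<lambda>a. a $ i"] \<open>S' \<noteq> {}\<close> by blast
    obtain b0 where b0: "b0 \<in> T'" "\<And>b. b \<in> T' \<Longrightarrow> b0 $ i \<le> b $ i"
      using ex_has_least_nat [of "\<lambda>b. b \<in> T'" _ "\<lambda>b. b $ i"] \<open>T' \<noteq> {}\<close> by blast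
    let ?S = "{a\<in>S'. a $ i = a0 $ i}" and ?T = "{b\<in>T'. b $ i = b0 $ i}"
    have cl: "a' \<in> ?S \<and> b' \<in> ?T"
      if h: "a \<in> ?S" "b \<in> ?T" "a' \<in> S" "b' \<in> T" "a' + b' = a + b" for a b a' b'
    proof -
      have "a \<in> S'" "b \<in> T'" using h by simp_all
      then have m: "a' \<in> S'" "b' \<in> T'" using closed [OF P _ _ h(3-5)] by blast+
      have "a' $ i + b' $ i = a $ i + b $ i"
        using h(5) by (metis vector_add_component)
      then have "a' $ i + b' $ i = a0 $ i + b0 $ i" using h(1,2) by simp
      then show ?thesis using a0(2) [OF m(1)] b0(2) [OF m(2)] m by simp
    qed
    have "\<forall>a\<in>?S. \<forall>b\<in>?T. \<forall>a'\<in>S. \<forall>b'\<in>T. a' + b' = a + b \<longrightarrow> a' \<in> ?S \<and> b' \<in> ?T"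
      by (intro ballI impI) (rule cl)
    moreover have "?S \<noteq> {}" "?T \<noteq> {}" using a0(1) b0(1) by blast+
    moreover have "?S \<subseteq> S" "?T \<subseteq> T" using Psub [OF P] by blast+
    moreover have "\<forall>a\<in>?S. \<forall>a'\<in>?S. \<forall>k\<in>insert i I. a $ k = a' $ k"
    proof (intro ballI)
      fix a a' k assume h: "a \<in> ?S" "a' \<in> ?S" "k \<in> insert i I"
      from h(3) show "a $ k = a' $ k"
      proof
        assume "k = i"
        then show ?thesis using h(1,2) by simp
      next
        assume "k \<in> I"
        moreover have "a \<in> S'" "a' \<in> S'" using h(1,2) by simp_all
        ultimately show ?thesis using PeqS [OF P] by blast
      qed
    qed
    moreover have "\<forall>b\<in>?T. \<forall>b'\<in>?T. \<forall>k\<in>insert i I. b $ k = b' $ k"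
    proof (intro ballI)
      fix b b' k assume h: "b \<in> ?T" "b' \<in> ?T" "k \<in> insert i I"
      from h(3) show "b $ k = b' $ k"
      proof
        assume "k = i"
        then show ?thesis using h(1,2) by simp
      next
        assume "k \<in> I"
        moreover have "b \<in> T'" "b' \<in> T'" using h(1,2) by simp_all
        ultimately show ?thesis using PeqT [OF P] by blast
      qed
    qed
    ultimately have "P (insert i I) ?S ?T" unfolding P_def by (intro conjI)
    then show ?thesis by (intro exI)
  qed
  have fin: "\<exists>S' T'. P I S' T'" if "finite I" for I
    using that
  proof (induction I rule: finite_induct)
    case empty
    have "P {} S T" using assms by (simp add: P_def)
    then show ?case by blast
  next
    case (insert i I)
    then obtain S' T' where "P I S' T'" by (elim exE)
    then show ?case by (rule step)
  qed
  have "\<exists>S' T'. P UNIV S' T'" by (rule fin) simp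
  then obtain S' T' where P: "P UNIV S' T'" by (elim exE)
  note sub = Psub [OF P] and ne = Pne [OF P] and eqS = PeqS [OF P] and eqT = PeqT [OF P]
  obtain a b where ab: "a \<in> S'" "b \<in> T'" using ne by blast
  show thesis
  proof (rule that [of a b])
    show "a \<in> S" "b \<in> T" using ab sub by blast+
    fix a' b' assume "a' \<in> S" "b' \<in> T" "a' + b' = a + b"
    then have "a' \<in> S'" "b' \<in> T'" using closed [OF P ab] by blast+
    then have "\<forall>i. a' $ i = a $ i" "\<forall>i. b' $ i = b $ i" using ab eqS eqT by blast+
    then show "a' = a \<and> b' = b" by (simp add: Finite_Cartesian_Product.vec_eq_iff)
  qed
qed

instance mfps :: (idom, finite) idom
proof
  fix f g :: "('a, 'b) mfps"
  assume "f \<noteq> 0" "g \<noteq> 0"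
  then have ne: "{a. mcoeff f a \<noteq> 0} \<noteq> {}" "{b. mcoeff g b \<noteq> 0} \<noteq> {}"
    by (auto simp: mfps_eq_iff zero_mfps_def)
  obtain a b where *: "a \<in> {a. mcoeff f a \<noteq> 0}" "b \<in> {b. mcoeff g b \<noteq> 0}"
    "\<And>a' b'. a' \<in> {a. mcoeff f a \<noteq> 0} \<Longrightarrow> b' \<in> {b. mcoeff g b \<noteq> 0} \<Longrightarrow>
      a' + b' = a + b \<Longrightarrow> a' = a \<and> b' = b"
    by (rule isolated_sum [OF ne]) (rule that)
  have ab: "mcoeff f a \<noteq> 0" "mcoeff g b \<noteq> 0"
    "\<And>a' b'. mcoeff f a' \<noteq> 0 \<Longrightarrow> mcoeff g b' \<noteq> 0 \<Longrightarrow> a' + b' = a + b \<Longrightarrow> a' = a \<and> b' = b"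
    using * by simp_all
  have "mcoeff (f * g) (a + b) = (\<Sum>(a', b')\<in>splits (a + b). mcoeff f a' * mcoeff g b')"
    by (simp add: times_mfps_def)
  also have "\<dots> = (\<Sum>(a', b')\<in>{(a, b)}. mcoeff f a' * mcoeff g b')"
  proof (rule sum.mono_neutral_right)
    show "\<forall>p\<in>splits (a + b) - {(a, b)}. (case p of (a', b') \<Rightarrow> mcoeff f a' * mcoeff g b') = 0"
    proof
      fix p assume p: "p \<in> splits (a + b) - {(a, b)}"
      obtain a' b' where [simp]: "p = (a', b')" by (cases p)
      have "a' + b' = a + b" "\<not> (a' = a \<and> b' = b)" using p by (simp_all add: splits_def)
      then have "mcoeff f a' = 0 \<or> mcoeff g b' = 0" using ab(3) by metis
      then show "(case p of (a', b') \<Rightarrow> mcoeff f a' * mcoeff g b') = 0" by auto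
    qed
    show "{(a, b)} \<subseteq> splits (a + b)" by (simp add: splits_def)
  qed (rule finite_splits)
  also have "\<dots> \<noteq> 0" using ab by simp
  finally show "f * g \<noteq> 0" by (auto simp: zero_mfps_def)
qed

definition mconst :: "'a::zero \<Rightarrow> ('a, 'i::finite) mfps"
  where "mconst c = Mfps (\<lambda>u. if u = 0 then c else 0)"

definition mmonom :: "nat ^ 'i::finite \<Rightarrow> ('a::{zero,one}, 'i) mfps"
  where "mmonom m = Mfps (\<lambda>u. if u = m then 1 else 0)"

definition map_mfps :: "('a \<Rightarrow> 'b) \<Rightarrow> ('a, 'i::finite) mfps \<Rightarrow> ('b, 'i) mfps"
  where "map_mfps h f = Mfps (\<lambda>u. h (mcoeff f u))"

definition monomial_times_unit :: "nat ^ 'i::finite \<Rightarrow> ('a::comm_ring_1, 'i) mfps \<Rightarrow> bool"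
  where "monomial_times_unit m h \<longleftrightarrow> (\<exists>u. u dvd 1 \<and> h = mmonom m * u)"


section \<open>Quasi-ordinary polynomials and their roots\<close>

text \<open>The sign is that of the usual relation between resultant and discriminant of a monic
  polynomial.\<close>

definition discriminant :: "'a::idom poly \<Rightarrow> 'a" where
  "discriminant f = (- 1) ^ (degree f * (degree f - 1) div 2) * resultant f (pderiv f)"

definition weierstrass_poly :: "('a::comm_ring_1, 'd::finite) mfps poly \<Rightarrow> bool" where
  "weierstrass_poly f \<longleftrightarrow> lead_coeff f = 1 \<and> (\<forall>k < degree f. mcoeff (coeff f k) 0 = 0)"

definition quasi_ordinary :: "('a::idom, 'd::finite) mfps poly \<Rightarrow> bool" where
  "quasi_ordinary f \<longleftrightarrow> weierstrass_poly f \<and> (\<exists>m. monomial_times_unit m (discriminant f))"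

text \<open>
  An element of \<open>\<complex>[[x\<^sub>1\<^sup>1\<^sup>/\<^sup>n, \<dots>, x\<^sub>d\<^sup>1\<^sup>/\<^sup>n]]\<close> is written as a power series in the variables
  \<open>z\<^sub>i = x\<^sub>i\<^sup>1\<^sup>/\<^sup>n\<close>. Thus the exponent \<open>u\<close> of \<open>z\<close> stands for the exponent \<open>u / n\<close> of \<open>x\<close>
  (\<open>xexp n u\<close>), and \<open>\<complex>[[x]]\<close> is embedded by \<open>x\<^sub>i \<mapsto> z\<^sub>i\<^sup>n\<close> (\<open>ramify n\<close>).
  Exponents of \<open>x\<close>, elements of \<open>\<rat>\<^sup>d\<close>, are regarded as vectors in \<open>real ^ 'd\<close>.
\<close>

definition xexp :: "nat \<Rightarrow> nat ^ 'd::finite \<Rightarrow> real ^ 'd"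
  where "xexp n u = (\<chi> i. real (u $ i) / real n)"

definition ramify :: "nat \<Rightarrow> ('a::zero, 'd::finite) mfps \<Rightarrow> ('a, 'd) mfps" where
  "ramify n f = Mfps (\<lambda>u. if \<forall>i. n dvd u $ i then mcoeff f (\<chi> i. u $ i div n) else 0)"

text \<open>The value of a polynomial with coefficients in \<open>\<complex>[[x]]\<close> at an element of
  \<open>\<complex>[[x\<^sup>1\<^sup>/\<^sup>n]]\<close>.\<close>

definition eval_ramified ::
    "nat \<Rightarrow> ('a::comm_ring_1, 'd::finite) mfps poly \<Rightarrow> ('a, 'd) mfps \<Rightarrow> ('a, 'd) mfps"
  where "eval_ramified n p z = poly (map_poly (ramify n) p) z"

definition qo_roots :: "('a::comm_ring_1, 'd::finite) mfps poly \<Rightarrow> ('a, 'd) mfps set"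
  where "qo_roots f = {\<zeta>. eval_ramified (degree f) f \<zeta> = 0}"

text \<open>The ring \<open>\<O>\<^sub>S = \<complex>[[x]][\<zeta>]\<close>.\<close>

definition local_ring ::
    "('a::comm_ring_1, 'd::finite) mfps poly \<Rightarrow> ('a, 'd) mfps \<Rightarrow> ('a, 'd) mfps set"
  where "local_ring f \<zeta> = range (\<lambda>p. eval_ramified (degree f) p \<zeta>)"

definition char_exponent_set :: "('a::comm_ring_1, 'd::finite) mfps poly \<Rightarrow> (real ^ 'd) set" where
  "char_exponent_set f =
     {xexp (degree f) m | m. \<exists>\<zeta>\<in>qo_roots f. \<exists>\<zeta>'\<in>qo_roots f. \<zeta> \<noteq> \<zeta>' \<and> monomial_times_unit m (\<zeta> - \<zeta>')}"

text \<open>The list \<open>\<lambda>\<^sub>1 < \<dots> < \<lambda>\<^sub>g\<close>; on \<open>real ^ 'd\<close>, \<open><\<close> is coordinate-wise \<open>\<le>\<close> together with \<open>\<noteq>\<close>.\<close>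

definition char_exponents :: "('a::comm_ring_1, 'd::finite) mfps poly \<Rightarrow> (real ^ 'd) list" where
  "char_exponents f = (THE ls. sorted_wrt (<) ls \<and> set ls = char_exponent_set f)"

text \<open>The coordinates \<open>1, \<dots>, d\<close> are the elements of \<open>'d\<close> in increasing order; in particular
  \<open>Min UNIV\<close> is the first coordinate.\<close>

definition normalized_exponents :: "(real ^ 'd::{finite,linorder}) list \<Rightarrow> bool" where
  "normalized_exponents ls \<longleftrightarrow>
     (\<forall>i k. i \<le> k \<longrightarrow> ord_class.lexordp_eq (map (\<lambda>l. l $ k) ls) (map (\<lambda>l. l $ i) ls)) \<and>
     (ls \<noteq> [] \<and> (\<forall>i. i \<noteq> Min UNIV \<longrightarrow> hd ls $ i = 0) \<longrightarrow> hd ls $ Min UNIV > 1)"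


section \<open>Lattices and the semigroup\<close>

text \<open>In this section \<open>ls = [\<lambda>\<^sub>1, \<dots>, \<lambda>\<^sub>g]\<close>, hence \<open>\<lambda>\<^sub>j = ls ! (j - 1)\<close>.\<close>

primrec char_lattice :: "(real ^ 'd::finite) list \<Rightarrow> nat \<Rightarrow> (real ^ 'd) set" where
  "char_lattice ls 0 = {u. \<forall>i. u $ i \<in> \<int>}"
| "char_lattice ls (Suc j) = {u + of_int c *\<^sub>R (ls ! j) | u c. u \<in> char_lattice ls j}"

text \<open>\<open>n\<^sub>j = [M\<^sub>j : M\<^sub>j\<^sub>-\<^sub>1]\<close>, the number of cosets.\<close>

definition lattice_index :: "(real ^ 'd::finite) list \<Rightarrow> nat \<Rightarrow> nat" where
  "lattice_index ls j =
     card (char_lattice ls j // {(u, w). u \<in> char_lattice ls j \<and> w \<in> char_lattice ls j \<and> u - w \<in> char_lattice ls (j - 1)})"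

text \<open>\<open>gam ls j = \<gamma>\<^sub>j\<close> for \<open>j \<ge> 1\<close>; the value at \<open>0\<close> is a dummy.\<close>

fun gam :: "(real ^ 'd::finite) list \<Rightarrow> nat \<Rightarrow> real ^ 'd" where
  "gam ls 0 = 0"
| "gam ls (Suc 0) = ls ! 0"
| "gam ls (Suc (Suc j)) =
     real (lattice_index ls (Suc j)) *\<^sub>R gam ls (Suc j) + (ls ! Suc j - ls ! j)"

definition semigroup_\<Gamma> :: "(real ^ 'd::finite) list \<Rightarrow> (real ^ 'd) set" where
  "semigroup_\<Gamma> ls =
     {(\<Sum>i\<in>UNIV. real (k i) *\<^sub>R axis i 1) + (\<Sum>j = 1..length ls. real (l j) *\<^sub>R gam ls j)
       | (k :: 'd \<Rightarrow> nat) (l :: nat \<Rightarrow> nat). True}"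

text \<open>\<open>N\<^sub>\<real>\<close> is identified with \<open>real ^ 'd\<close> through the dual basis of \<open>e\<^sub>1, \<dots>, e\<^sub>d\<close>, so that the
  pairing with \<open>M\<^sub>\<real>\<close> is the inner product.\<close>

definition dual_lattice :: "(real ^ 'd::finite) set \<Rightarrow> (real ^ 'd) set" where
  "dual_lattice M = {v. \<forall>u\<in>M. v \<bullet> u \<in> \<int>}"

definition cone_\<sigma> :: "(real ^ 'd::finite) set" where
  "cone_\<sigma> = convex_cone hull (range (\<lambda>i. axis i 1))"


section \<open>Monomial valuations and the Poincare series\<close>

text \<open>The valuation is infinite at \<open>0\<close>.\<close>

definition monomial_val ::
    "nat \<Rightarrow> real ^ 'd::finite \<Rightarrow> ('a::zero, 'd) mfps \<Rightarrow> ereal" where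
  "monomial_val n v h = (INF u\<in>{u. mcoeff h u \<noteq> 0}. ereal (v \<bullet> xexp n u))"

text \<open>
  The homogeneous components of the iterated associated graded ring. By the canonical
  isomorphism \<open>(A/B)/(C/B) = A/C\<close>, every component \<open>J(a\<^sub>1, \<dots>, a\<^sub>k)\<close> is a quotient \<open>A/B\<close> of two
  subspaces \<open>B \<subseteq> A\<close> of \<open>R\<close>; it is given by the pair \<open>(A, B)\<close>, starting with \<open>(R, {0})\<close>.
  A valuation induced on the homogeneous elements of \<open>A/B\<close> is given as a function \<open>w\<close> on
  \<open>A\<close>, constant on the classes modulo \<open>B\<close> and infinite on \<open>B\<close>.

  In one step, the first valuation \<open>w\<close> and degree \<open>a\<close> replace \<open>A/B\<close> by
  \<open>{w \<ge> a} / {w \<ge> a + 1}\<close>. As valuation ideals are homogeneous, their components are determined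
  by the values on homogeneous elements. Each remaining valuation \<open>w'\<close> induces on the class
  of \<open>h\<close> the largest value of \<open>w'\<close> on the elements of that class (which is infinite for the
  zero class, because this class contains \<open>0\<close>).
\<close>

fun gr_component ::
    "'b::ab_group_add set \<Rightarrow> 'b set \<Rightarrow> ('b \<Rightarrow> ereal) list \<Rightarrow> nat list \<Rightarrow> 'b set \<times> 'b set" where
  "gr_component A B (w # ws) (a # as) =
     (let A' = {h\<in>A. w h \<ge> ereal (real a)};
          B' = {h\<in>A. w h \<ge> ereal (real a + 1)}
      in gr_component A' B' (map (\<lambda>w' h. SUP h'\<in>{h'\<in>A'. h' - h \<in> B'}. w' h') ws) as)"
| "gr_component A B _ _ = (A, B)"

text \<open>The classes of the elements of \<open>X\<close> are pairwise distinct and form a basis of \<open>A/B\<close>.\<close>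

definition quotient_basis ::
    "('k::field \<Rightarrow> 'b::ab_group_add \<Rightarrow> 'b) \<Rightarrow> 'b set \<Rightarrow> 'b set \<Rightarrow> 'b set \<Rightarrow> bool" where
  "quotient_basis smul A B X \<longleftrightarrow>
     X \<subseteq> A \<and> \<not> Modules.module.dependent smul X \<and> Modules.module.span smul X \<inter> B = {0} \<and>
     A = {x + b | x b. x \<in> Modules.module.span smul X \<and> b \<in> B}"

text \<open>As for \<open>dim\<close>, the value is \<open>0\<close> in the infinite-dimensional case.\<close>

definition quotient_dim ::
    "('k::field \<Rightarrow> 'b::ab_group_add \<Rightarrow> 'b) \<Rightarrow> 'b set \<Rightarrow> 'b set \<Rightarrow> nat" where
  "quotient_dim smul A B = card (SOME X. quotient_basis smul A B X)"

text \<open>The valuations are taken in the order of the index type \<open>'r\<close>.\<close>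

definition poincare_series ::
    "(complex, 'd::finite) mfps poly \<Rightarrow> (complex, 'd) mfps \<Rightarrow>
     ('r::{finite,linorder} \<Rightarrow> real ^ 'd) \<Rightarrow> (int, 'r) mfps" where
  "poincare_series f \<zeta> v = Mfps (\<lambda>a.
     let is = sorted_list_of_set (UNIV :: 'r set);
         (A, B) = gr_component (local_ring f \<zeta>) {0}
                    (map (\<lambda>i. monomial_val (degree f) (v i)) is) (map (\<lambda>i. a $ i) is)
     in int (quotient_dim (\<lambda>c h. mconst c * h) A B))"

text \<open>Elements of \<open>\<complex>[[\<Gamma>]]\<close> are given by their coefficients, extended by \<open>0\<close> outside \<open>\<Gamma>\<close>.\<close>

definition generating_series :: "(real ^ 'd::finite) set \<Rightarrow> real ^ 'd \<Rightarrow> complex" where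
  "generating_series \<Gamma> = (\<lambda>\<gamma>. if \<gamma> \<in> \<Gamma> then 1 else 0)"

definition pairing :: "('r::finite \<Rightarrow> real ^ 'd::finite) \<Rightarrow> real ^ 'd \<Rightarrow> real ^ 'r" where
  "pairing v u = (\<chi> i. v i \<bullet> u)"

definition Phi :: "('r::finite \<Rightarrow> real ^ 'd::finite) \<Rightarrow> (real ^ 'd \<Rightarrow> complex) \<Rightarrow> (complex, 'r) mfps"
  where
  "Phi v F = Mfps (\<lambda>a. \<Sum>\<gamma> | F \<gamma> \<noteq> 0 \<and> pairing v \<gamma> = (\<chi> i. real (a $ i)). F \<gamma>)"

text \<open>The monomial \<open>t\<^sup>w\<close> in the fraction field of \<open>\<complex>[[t]]\<close>, for a vector \<open>w\<close> whose coordinates are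
  non-negative integers.\<close>

definition tpow :: "real ^ 'r::finite \<Rightarrow> (complex, 'r) mfps fract" where
  "tpow w = to_fract (mmonom (\<chi> i. nat \<lfloor>w $ i\<rfloor>))"

end

theory Submission
  imports Defs
begin

text \<open>
  Since one root \<open>\<zeta>\<close> lies in \<open>\<complex>[[x\<^sup>1\<^sup>/\<^sup>n]]\<close>, the group of characters of \<open>(1/n)\<int>\<^sup>d / \<int>\<^sup>d\<close> acts on this ring
  with invariants \<open>\<complex>[[x]]\<close>, and \<open>f\<close> is the product of \<open>y - \<tau>\<close> over the conjugates \<open>\<tau>\<close> of \<open>\<zeta>\<close>. The difference
  of two roots divides the discriminant, hence is a monomial times a unit. The exponent of
  \<open>\<psi>\<zeta> - \<zeta>\<close> is the first \<open>\<lambda>\<^sub>i\<close> on which the character \<open>\<psi>\<close> is nontrivial.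

  Let \<open>\<zeta>\<^sub>j\<close> be \<open>\<zeta>\<close> truncated before \<open>\<lambda>\<^sub>j\<^sub>+\<^sub>1\<close> and \<open>f\<^sub>j\<close> its minimal polynomial. Counting characters by their
  triviality on the lattices \<open>M\<^sub>i\<close> shows that \<open>f\<^sub>j(\<zeta>)\<close> is \<open>X\<close> to the power \<open>\<gamma>\<^sub>j\<^sub>+\<^sub>1\<close> times a unit. The products of powers
  of the \<open>f\<^sub>j\<close> with exponents below \<open>n\<^sub>j\<^sub>+\<^sub>1\<close> are monic of degrees \<open>0, \<dots>, n - 1\<close>, so their values at \<open>\<zeta>\<close> span \<open>\<O>\<^sub>S\<close> over
  \<open>\<complex>[[x]]\<close>. Their leading exponents \<open>\<beta>\<^sub>k\<close> are pairwise incongruent modulo \<open>\<int>\<^sup>d\<close>, and \<open>\<Gamma>\<close> is the disjoint union of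
  the sets \<open>\<beta>\<^sub>k + \<nat>\<^sup>d\<close>. Therefore \<open>\<O>\<^sub>S\<close> is identified with the space of all functions on \<open>\<Gamma>\<close>, in such a way
  that every monomial valuation is the minimum of \<open>\<langle>v, \<gamma>\<rangle>\<close> over the support. So \<open>J(a)\<close> has a basis indexed
  by the \<open>\<gamma> \<in> \<Gamma>\<close> with \<open>\<langle>v, \<gamma>\<rangle> = a\<close>, and the product formula is the decomposition of \<open>\<Gamma>\<close> again.
\<close>

text \<open>The values \<open>ev (basis k)\<close> are not monomials: each is \<open>X\<close> to
  the power \<beta>_k times a unit, and tails of different terms may cancel. The identification of
  the ring with functions on \<Gamma> is therefore linear but not multiplicative, and an exponent of
  an element need not lie in the support of its function. What survives are the coordinatewise
  minimal points of the support: there a single product of coefficients contributes, because the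
  \<beta>_k are incongruent modulo the integer vectors. Non-negative weight vectors see only such
  points, so all monomial valuations can be computed on functions. On functions the induced
  valuations are easy: the best representative of a class is obtained by deleting the support
  outside the current degree.

  The exponents \<gamma>_j arise from sums over the conjugates of a truncation. The number of
  conjugates depends on \<open>j\<close>, so each is counted with the order of its stabilizer; then
  all sums run over the same group, and consecutive ones differ only on the characters trivial on
  one more lattice. Dividing by the order of that subgroup gives the recursion for \<gamma>.\<close>

section \<open>Power series and leading exponents\<close>

text \<open>The usual names of the next two facts are hidden by those for Jordan-Normal-Form vectors.\<close>

lemma fvec_le: "u \<le> w \<longleftrightarrow> (\<forall>i. u $ i \<le> w $ i)" for u w :: "'a::ord ^ 'i::finite"
  by (rule Finite_Cartesian_Product.less_eq_vec_def)

lemma fvec_eq: "u = w \<longleftrightarrow> (\<forall>i. u $ i = w $ i)" for u w :: "'a ^ 'i::finite"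
  by (rule Finite_Cartesian_Product.vec_eq_iff)

section \<open>Coefficients of products and monomials\<close>

lemma mcoeff_simps [simp]:
  "mcoeff 0 u = 0" "mcoeff (f + g) u = mcoeff f u + mcoeff g u"
  "mcoeff (f - g) u = mcoeff f u - mcoeff g u" "mcoeff (- f) u = - mcoeff f u"
  by (simp_all add: zero_mfps_def plus_mfps_def minus_mfps_def uminus_mfps_def)

lemma mcoeff_one: "mcoeff 1 u = (if u = 0 then 1 else 0)"
  by (simp add: one_mfps_def)

lemma mcoeff_mult: "mcoeff (f * g) u = (\<Sum>(a, b)\<in>splits u. mcoeff f a * mcoeff g b)"
  by (simp add: times_mfps_def)

lemma mcoeff_sum: "mcoeff (sum F A) u = (\<Sum>x\<in>A. mcoeff (F x) u)"
  by (induction A rule: infinite_finite_induct) auto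

lemma vec_nat_le_diff:
  fixes m u :: "nat ^ 'i::finite"
  assumes "m \<le> u"
  shows "m + (u - m) = u"
  using assms by (auto simp: fvec_eq fvec_le)

lemma vec_nat_le_add [simp]:
  fixes m u :: "nat ^ 'i::finite"
  shows "m \<le> m + u" "0 \<le> u"
  by (auto simp: fvec_le)

lemma vec_add_mono:
  fixes a b c d :: "'a::ordered_ab_semigroup_add ^ 'i::finite"
  shows "a \<le> c \<Longrightarrow> b \<le> d \<Longrightarrow> a + b \<le> c + d"
  by (auto simp: fvec_le add_mono)

lemma vec_nat_add_eq_imp_eq:
  fixes a b c d :: "nat ^ 'i::finite"
  assumes "a \<le> c" "b \<le> d" "c + d = a + b"
  shows "c = a \<and> d = b"
proof -
  have "c $ i = a $ i \<and> d $ i = b $ i" for i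
    using assms(1,2) arg_cong [OF assms(3), of "\<lambda>v. v $ i"] unfolding fvec_le
    by (auto dest!: spec [of _ i])
  then show ?thesis by (simp add: fvec_eq)
qed

lemma mcoeff_mult_single:
  assumes "a + b = u" "\<And>c d. c + d = u \<Longrightarrow> (c, d) \<noteq> (a, b) \<Longrightarrow> mcoeff f c * mcoeff g d = 0"
  shows "mcoeff (f * g) u = mcoeff f a * mcoeff g b"
proof -
  have "mcoeff (f * g) u = (\<Sum>(a, b)\<in>{(a, b)}. mcoeff f a * mcoeff g b)"
    unfolding mcoeff_mult
    by (rule sum.mono_neutral_right) (use assms in \<open>force simp: splits_def finite_splits [unfolded splits_def]\<close>)+
  then show ?thesis by simp
qed

lemma mcoeff_mult_neq_0:
  assumes "mcoeff (f * g) u \<noteq> 0"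
  obtains a b where "a + b = u" "mcoeff f a \<noteq> 0" "mcoeff g b \<noteq> 0"
proof -
  have "\<exists>a b. a + b = u \<and> mcoeff f a * mcoeff g b \<noteq> 0"
  proof (rule ccontr)
    assume "\<not> ?thesis"
    then have "mcoeff (f * g) u = 0"
      unfolding mcoeff_mult by (intro sum.neutral) (auto simp: splits_def)
    with assms show False by simp
  qed
  then show thesis using that by (metis mult_zero_left mult_zero_right)
qed

lemma mcoeff_mmonom_mult:
  "mcoeff (mmonom m * h) u = (if m \<le> u then mcoeff h (u - m) else 0)"
proof (cases "m \<le> u")
  case True
  have "mcoeff (mmonom m * h) u = mcoeff (mmonom m) m * mcoeff h (u - m)"
  proof (rule mcoeff_mult_single)
    fix c d assume "c + d = u" "(c, d) \<noteq> (m, u - m)"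
    then have "c \<noteq> m" by auto
    then show "mcoeff (mmonom m) c * mcoeff h d = 0" by (simp add: mmonom_def)
  qed (rule vec_nat_le_diff [OF True])
  with True show ?thesis by (simp add: mmonom_def)
next
  case False
  have "mcoeff (mmonom m * h) u = 0"
  proof (rule ccontr)
    assume "\<not> ?thesis"
    then show False
      by (rule mcoeff_mult_neq_0) (use False in \<open>auto simp: mmonom_def split: if_splits\<close>)
  qed
  with False show ?thesis by simp
qed

lemma mmonom_mult: "mmonom a * mmonom b = (mmonom (a + b) :: ('a::comm_ring_1, 'i::finite) mfps)"
proof (rule mfps_eqI)
  fix u show "mcoeff (mmonom a * mmonom b) u = mcoeff (mmonom (a + b) :: ('a, 'i) mfps) u"
    unfolding mcoeff_mmonom_mult by (auto simp: mmonom_def vec_nat_le_diff)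
qed

lemma mmonom_0 [simp]: "mmonom 0 = (1 :: ('a::comm_ring_1, 'i::finite) mfps)"
  by (simp add: mfps_eq_iff mmonom_def mcoeff_one)

lemma mmonom_neq_0 [simp]: "mmonom m \<noteq> (0 :: ('a::comm_ring_1, 'i::finite) mfps)"
  by (auto simp: mfps_eq_iff mmonom_def)

lemma mmonom_eq_iff: "mmonom a = (mmonom b :: ('a::comm_ring_1, 'i::finite) mfps) \<longleftrightarrow> a = b"
  by (auto simp: mfps_eq_iff mmonom_def split: if_splits)

lemma mcoeff_mconst_mult:
  fixes h :: "('a::comm_ring_1, 'i::finite) mfps"
  shows "mcoeff (mconst c * h) u = c * mcoeff h u"
proof -
  have "mcoeff (mconst c * h) u = mcoeff (mconst c :: ('a, 'i) mfps) 0 * mcoeff h u"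
  proof (rule mcoeff_mult_single)
    fix a d assume "a + d = u" "(a, d) \<noteq> (0, u)"
    then have "a \<noteq> 0" by auto
    then show "mcoeff (mconst c) a * mcoeff h d = 0" by (simp add: mconst_def)
  qed simp
  then show ?thesis by (simp add: mconst_def)
qed

text \<open>Over a field, \<open>lead_exp h m\<close> says that \<open>h\<close> is \<open>X\<^sup>m\<close> times a unit, without mentioning inverses.\<close>

definition lead_exp :: "('a::comm_ring_1, 'i::finite) mfps \<Rightarrow> nat ^ 'i \<Rightarrow> bool" where
  "lead_exp h m \<longleftrightarrow> mcoeff h m \<noteq> 0 \<and> (\<forall>u. mcoeff h u \<noteq> 0 \<longrightarrow> m \<le> u)"

lemma lead_exp_unique: "lead_exp h a \<Longrightarrow> lead_exp h b \<Longrightarrow> a = b"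
  by (auto simp: lead_exp_def intro: antisym)

text \<open>A pair of exponents that contributes to \<open>a + b\<close> dominates
  \<open>(a, b)\<close> coordinatewise and therefore equals it.\<close>

lemma mcoeff_mult_lead:
  assumes "\<And>u. mcoeff f u \<noteq> 0 \<Longrightarrow> a \<le> u" "\<And>u. mcoeff g u \<noteq> 0 \<Longrightarrow> b \<le> u"
  shows "mcoeff (f * g) (a + b) = mcoeff f a * mcoeff g b"
proof (rule mcoeff_mult_single)
  fix c d assume *: "c + d = a + b" "(c, d) \<noteq> (a, b)"
  show "mcoeff f c * mcoeff g d = 0"
  proof (rule ccontr)
    assume "\<not> ?thesis"
    then have "mcoeff f c \<noteq> 0" "mcoeff g d \<noteq> 0" by (metis mult_zero_left, metis mult_zero_right)
    then have "a \<le> c" "b \<le> d" using assms by blast+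
    with * show False using vec_nat_add_eq_imp_eq by blast
  qed
qed simp

lemma lead_exp_mult:
  fixes f g :: "('a::idom, 'i::finite) mfps"
  assumes "lead_exp f a" "lead_exp g b"
  shows "lead_exp (f * g) (a + b)"
proof -
  have "mcoeff (f * g) (a + b) = mcoeff f a * mcoeff g b"
    by (rule mcoeff_mult_lead) (use assms in \<open>auto simp: lead_exp_def\<close>)
  moreover have "a + b \<le> u" if "mcoeff (f * g) u \<noteq> 0" for u
    using that by (rule mcoeff_mult_neq_0) (use assms in \<open>auto simp: lead_exp_def intro: vec_add_mono\<close>)
  ultimately show ?thesis using assms by (simp add: lead_exp_def)
qed

lemma lead_exp_one: "lead_exp (1 :: ('a::comm_ring_1, 'i::finite) mfps) 0"
  by (simp add: lead_exp_def mcoeff_one)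

lemma lead_exp_prod:
  fixes F :: "'x \<Rightarrow> ('a::idom, 'i::finite) mfps"
  assumes "\<And>x. x \<in> A \<Longrightarrow> lead_exp (F x) (e x)"
  shows "lead_exp (prod F A) (sum e A)"
  using assms by (induction A rule: infinite_finite_induct) (auto intro: lead_exp_one lead_exp_mult)

lemma lead_exp_mmonom: "lead_exp (mmonom m :: ('a::comm_ring_1, 'i::finite) mfps) m"
  by (simp add: lead_exp_def mmonom_def)

lemma lead_exp_unit:
  fixes w :: "('a::idom, 'i::finite) mfps"
  assumes "w dvd 1"
  shows "lead_exp w 0"
proof -
  obtain w' where "1 = w * w'" using assms by (auto simp: dvd_def)
  then have "mcoeff (w * w') 0 = 1" by (metis mcoeff_one)
  moreover have "mcoeff (w * w') (0 + 0) = mcoeff w 0 * mcoeff w' 0"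
    by (rule mcoeff_mult_lead) auto
  ultimately show ?thesis by (auto simp: lead_exp_def)
qed

lemma monomial_times_unit_lead_exp:
  fixes h :: "('a::idom, 'i::finite) mfps"
  assumes "monomial_times_unit m h"
  shows "lead_exp h m"
proof -
  obtain w where "w dvd 1" "h = mmonom m * w"
    using assms by (auto simp: monomial_times_unit_def)
  then show ?thesis
    using lead_exp_mult [OF lead_exp_mmonom lead_exp_unit, of w m] by simp
qed

text \<open>Each variable is prime: setting it to zero is multiplicative with values in a domain,
  and its kernel consists of the multiples of the variable. The induction on the total degree of
  \<open>m\<close> strips a variable occurring in \<open>m\<close> from \<open>g\<close> or from
  \<open>h\<close> until the monomial is 1.\<close>

lemma dvd_monomial_times_unit:
  fixes g h w :: "('a::idom, 'i::finite) mfps"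
  assumes "g * h = mmonom m * w" "w dvd 1"
  shows "\<exists>p. monomial_times_unit p g"
  using assms
proof (induction "\<Sum>i\<in>UNIV. m $ i" arbitrary: m g h rule: less_induct)
  case less
  show ?case
  proof (cases "m = 0")
    case True
    with less.prems have "g dvd w" by (metis dvd_triv_left mmonom_0 mult_1)
    then have "g dvd 1" using less.prems(2) dvd_trans by blast
    then have "monomial_times_unit 0 g" by (auto simp: monomial_times_unit_def)
    then show ?thesis ..
  next
    case False
    then obtain i where i: "m $ i \<noteq> 0" by (auto simp: fvec_eq)
    define e :: "nat ^ 'i" where "e = axis i 1"
    have e_le: "e \<le> u \<longleftrightarrow> u $ i \<noteq> 0" for u :: "nat ^ 'i"
      by (auto simp: e_def fvec_le axis_def Suc_le_eq)
    define m' where "m' = m - e"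
    have m: "m = e + m'" using e_le i by (simp add: m'_def vec_nat_le_diff)
    have "m' \<le> m" by (simp add: m fvec_le)
    moreover have "m' $ i < m $ i" by (simp add: m e_def axis_def)
    ultimately have less_sum: "(\<Sum>i\<in>UNIV. m' $ i) < (\<Sum>i\<in>UNIV. m $ i)"
      by (intro sum_strict_mono_ex1) (auto simp: fvec_le)
    \<comment> \<open>Substitution of zero for the variable with index \<open>i\<close>.\<close>
    define r where "r h = Mfps (\<lambda>u. if u $ i = 0 then mcoeff h u else 0)"
      for h :: "('a, 'i) mfps"
    have r_mult: "r (f * h) = r f * r h" for f h
    proof (rule mfps_eqI)
      fix u :: "nat ^ 'i"
      show "mcoeff (r (f * h)) u = mcoeff (r f * r h) u"
      proof (cases "u $ i = 0")
        case True
        then show ?thesis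
          unfolding mcoeff_mult by (auto simp: r_def mcoeff_mult splits_def intro!: sum.cong)
      next
        case False
        have "mcoeff (r f * r h) u = 0"
        proof (rule ccontr)
          assume "\<not> ?thesis"
          then show False
            by (rule mcoeff_mult_neq_0) (use False in \<open>auto simp: r_def split: if_splits\<close>)
        qed
        with False show ?thesis by (simp add: r_def)
      qed
    qed
    have r_0: "r f = 0 \<Longrightarrow> \<exists>f'. f = mmonom e * f'" for f
    proof -
      assume rf: "r f = 0"
      have "f = mmonom e * Mfps (\<lambda>u. mcoeff f (e + u))"
      proof (rule mfps_eqI)
        fix u
        have "mcoeff (r f) u = 0" using rf by simp
        then show "mcoeff f u = mcoeff (mmonom e * Mfps (\<lambda>u. mcoeff f (e + u))) u"
          by (auto simp: mcoeff_mmonom_mult r_def e_le vec_nat_le_diff split: if_splits)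
      qed
      then show ?thesis ..
    qed
    have "r (mmonom e) = 0"
      by (auto simp: mfps_eq_iff r_def mmonom_def e_def)
    moreover have "mmonom m = mmonom e * (mmonom m' :: ('a, 'i) mfps)"
      by (simp add: mmonom_mult m)
    ultimately have "r g * r h = 0"
      using less.prems(1) r_mult by (metis mult_zero_left)
    then consider "r g = 0" | "r h = 0" by auto
    then show ?thesis
    proof cases
      case 1
      then obtain g' where g': "g = mmonom e * g'" using r_0 by blast
      have "mmonom e * (g' * h) = mmonom e * (mmonom m' * w)"
        using less.prems(1) by (simp add: g' m mmonom_mult [symmetric] mult.assoc)
      then have "g' * h = mmonom m' * w" by simp
      then obtain p where "monomial_times_unit p g'"
        using less.hyps [OF less_sum] less.prems(2) by blast
      then have "monomial_times_unit (e + p) g"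
        by (auto simp: monomial_times_unit_def g' mmonom_mult [symmetric] mult.assoc)
      then show ?thesis ..
    next
      case 2
      then obtain h' where h': "h = mmonom e * h'" using r_0 by blast
      have "mmonom e * (g * h') = mmonom e * (mmonom m' * w)"
        using less.prems(1) by (simp add: h' m mmonom_mult [symmetric] mult.assoc mult.left_commute)
      then have "g * h' = mmonom m' * w" by simp
      then show ?thesis using less.hyps [OF less_sum] less.prems(2) by blast
    qed
  qed
qed

section \<open>The embedding of C[[x]] into the ramified series\<close>

lemma mcoeff_ramify_scale:
  assumes "n > 0"
  shows "mcoeff (ramify n f) (n *s u) = mcoeff f u"
proof -
  have "(\<chi> i. (n *s u) $ i div n) = u"
    using assms by (simp add: fvec_eq vector_scalar_mult_def)
  then show ?thesis by (simp add: ramify_def vector_scalar_mult_def)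
qed

lemma mcoeff_ramify_not_scale:
  assumes "u \<notin> range ((*s) n)"
  shows "mcoeff (ramify n f) u = 0"
proof -
  have "\<not> (\<forall>i. n dvd u $ i)"
  proof
    assume "\<forall>i. n dvd u $ i"
    then have "u = n *s (\<chi> i. u $ i div n)"
      by (simp add: fvec_eq vector_scalar_mult_def)
    with assms show False by blast
  qed
  then show ?thesis unfolding ramify_def mcoeff_Mfps by (rule if_not_P)
qed

lemma nat_scale_eq_iff:
  fixes u w :: "nat ^ 'i::finite"
  assumes "n > 0"
  shows "n *s u = n *s w \<longleftrightarrow> u = w"
  using assms by (simp add: fvec_eq vector_scalar_mult_def)

lemma ramify_eqI:
  assumes "n > 0" "\<And>u. mcoeff h (n *s u) = mcoeff f u" "\<And>u. u \<notin> range ((*s) n) \<Longrightarrow> mcoeff h u = 0"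
  shows "h = ramify n f"
proof (rule mfps_eqI)
  fix u show "mcoeff h u = mcoeff (ramify n f) u"
    using assms by (cases "u \<in> range ((*s) n)")
      (auto simp: mcoeff_ramify_scale mcoeff_ramify_not_scale)
qed

text \<open>Scaling by \<open>n\<close> maps the decompositions of \<open>u\<close> bijectively onto
  those decompositions of \<open>n *s u\<close> whose parts are both multiples of \<open>n\<close>;
  all others carry a zero coefficient.\<close>

lemma ramify_mult:
  assumes n: "n > 0"
  shows "ramify n (f * g) = ramify n f * ramify n (g :: ('a::comm_ring_1, 'i::finite) mfps)"
proof (rule sym, rule ramify_eqI [OF n])
  fix u :: "nat ^ 'i"
  let ?h = "\<lambda>(a, b). (n *s a, n *s b)"
  have inj: "inj_on ?h (splits u)"
    using n by (auto simp: inj_on_def nat_scale_eq_iff)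
  have "mcoeff (ramify n f * ramify n g) (n *s u) =
      (\<Sum>(a, b)\<in>?h ` splits u. mcoeff (ramify n f) a * mcoeff (ramify n g) b)"
    unfolding mcoeff_mult
  proof (rule sum.mono_neutral_right)
    show "?h ` splits u \<subseteq> splits (n *s u)"
      by (auto simp: splits_def vec.scale_right_distrib vector_add_ldistrib)
    show "\<forall>p\<in>splits (n *s u) - ?h ` splits u.
        (case p of (a, b) \<Rightarrow> mcoeff (ramify n f) a * mcoeff (ramify n g) b) = 0"
    proof
      fix p assume p: "p \<in> splits (n *s u) - ?h ` splits u"
      obtain a b where [simp]: "p = (a, b)" by (cases p)
      show "(case p of (a, b) \<Rightarrow> mcoeff (ramify n f) a * mcoeff (ramify n g) b) = 0"
      proof (rule ccontr)
        assume "\<not> ?thesis"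
        then have "mcoeff (ramify n f) a \<noteq> 0" "mcoeff (ramify n g) b \<noteq> 0"
          by (metis mult_zero_left case_prod_conv \<open>p = (a, b)\<close>, metis mult_zero_right case_prod_conv \<open>p = (a, b)\<close>)
        then have "a \<in> range ((*s) n)" "b \<in> range ((*s) n)"
          using mcoeff_ramify_not_scale [of a n f] mcoeff_ramify_not_scale [of b n g] by blast+
        then obtain a' b' where ab: "a = n *s a'" "b = n *s b'" by blast
        have "n *s (a' + b') = n *s u"
          using p ab by (auto simp: splits_def vector_add_ldistrib)
        then have "a' + b' = u" using nat_scale_eq_iff [OF n] by blast
        then have "(a', b') \<in> splits u" by (simp add: splits_def)
        then show False using p ab by force
      qed
    qed
  qed simp
  also have "\<dots> = mcoeff (f * g) u"
    unfolding mcoeff_mult sum.reindex [OF inj]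
    by (rule sum.cong) (auto simp: mcoeff_ramify_scale [OF n])
  finally show "mcoeff (ramify n f * ramify n g) (n *s u) = mcoeff (f * g) u" .
next
  fix u :: "nat ^ 'i" assume u: "u \<notin> range ((*s) n)"
  show "mcoeff (ramify n f * ramify n g) u = 0"
  proof (rule ccontr)
    assume "\<not> ?thesis"
    then obtain a b where ab: "a + b = u" "mcoeff (ramify n f) a \<noteq> 0" "mcoeff (ramify n g) b \<noteq> 0"
      by (rule mcoeff_mult_neq_0)
    then have "a \<in> range ((*s) n)" "b \<in> range ((*s) n)"
      using mcoeff_ramify_not_scale [of a n f] mcoeff_ramify_not_scale [of b n g] by blast+
    then obtain a' b' where "a = n *s a'" "b = n *s b'" by blast
    then have "u = n *s (a' + b')" using ab(1) by (auto simp: vector_add_ldistrib)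
    with u show False by blast
  qed
qed

lemma inj_comm_ring_hom_ramify:
  assumes n: "n > 0"
  shows "inj_comm_ring_hom (ramify n :: ('a::comm_ring_1, 'i::finite) mfps \<Rightarrow> _)"
proof
  fix f g :: "('a, 'i) mfps"
  show "ramify n (f + g) = ramify n f + ramify n g"
    by (simp add: mfps_eq_iff ramify_def)
  show "ramify n (f * g) = ramify n f * ramify n g" by (rule ramify_mult [OF n])
  show "ramify n (1 :: ('a, 'i) mfps) = 1"
  proof (rule sym, rule ramify_eqI [OF n])
    fix u :: "nat ^ 'i"
    show "mcoeff (1 :: ('a, 'i) mfps) (n *s u) = mcoeff 1 u"
      using n nat_scale_eq_iff [OF n, of u 0] by (auto simp: mcoeff_one)
    show "mcoeff (1 :: ('a, 'i) mfps) u = 0" if "u \<notin> range ((*s) n)"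
      using that by (auto simp: mcoeff_one) (metis rangeI vector_scalar_mult_def zero_index mult_0_right vec_lambda_unique)
  qed
  show "ramify n (0 :: ('a, 'i) mfps) = 0" by (simp add: mfps_eq_iff ramify_def)
  assume "ramify n f = 0"
  then show "f = 0"
    using mcoeff_ramify_scale [OF n, of f] by (simp add: mfps_eq_iff)
qed

lemma ramify_mmonom:
  assumes n: "n > 0"
  shows "ramify n (mmonom m :: ('a::comm_ring_1, 'i::finite) mfps) = mmonom (n *s m)"
  by (rule sym, rule ramify_eqI [OF n]) (auto simp: mmonom_def nat_scale_eq_iff [OF n])

text \<open>For a monoid homomorphism \<open>\<psi>\<close> this rescales each variable by the value
  of \<open>\<psi>\<close> at its exponent vector, which is why it is a ring homomorphism.\<close>

definition twist :: "(nat ^ 'i::finite \<Rightarrow> 'a) \<Rightarrow> ('a::comm_ring_1, 'i) mfps \<Rightarrow> ('a, 'i) mfps" where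
  "twist \<psi> h = Mfps (\<lambda>u. \<psi> u * mcoeff h u)"

lemma mcoeff_twist [simp]: "mcoeff (twist \<psi> h) u = \<psi> u * mcoeff h u"
  by (simp add: twist_def)

lemma comm_ring_hom_twist:
  fixes \<psi> :: "nat ^ 'i::finite \<Rightarrow> 'a::comm_ring_1"
  assumes "\<psi> 0 = 1" "\<And>a b. \<psi> (a + b) = \<psi> a * \<psi> b"
  shows "comm_ring_hom (twist \<psi>)"
proof
  fix f g :: "('a, 'i) mfps"
  show "twist \<psi> (f * g) = twist \<psi> f * twist \<psi> g"
    by (auto simp: mfps_eq_iff mcoeff_mult splits_def sum_distrib_left assms(2) intro!: sum.cong)
qed (use assms(1) in \<open>simp_all add: mfps_eq_iff mcoeff_one algebra_simps\<close>)

section \<open>Characters of lattices\<close>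

definition add_subgroup :: "'a::ab_group_add set \<Rightarrow> bool" where
  "add_subgroup H \<longleftrightarrow> 0 \<in> H \<and> (\<forall>a\<in>H. \<forall>b\<in>H. a - b \<in> H)"

lemma add_subgroup_0: "add_subgroup H \<Longrightarrow> 0 \<in> H"
  and add_subgroup_diff: "add_subgroup H \<Longrightarrow> a \<in> H \<Longrightarrow> b \<in> H \<Longrightarrow> a - b \<in> H"
  by (auto simp: add_subgroup_def)

lemma add_subgroup_minus: "add_subgroup H \<Longrightarrow> a \<in> H \<Longrightarrow> - a \<in> H"
  using add_subgroup_diff [of H 0 a] add_subgroup_0 [of H] by simp

lemma add_subgroup_add: "add_subgroup H \<Longrightarrow> a \<in> H \<Longrightarrow> b \<in> H \<Longrightarrow> a + b \<in> H"
  using add_subgroup_diff [of H a "- b"] add_subgroup_minus [of H b] by simp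

lemma add_subgroup_add_cancel: "add_subgroup H \<Longrightarrow> b \<in> H \<Longrightarrow> a + b \<in> H \<longleftrightarrow> a \<in> H"
  using add_subgroup_add [of H a b] add_subgroup_diff [of H "a + b" b] by auto

lemma add_subgroup_of_nat:
  fixes a :: "'a::real_vector"
  assumes "add_subgroup H" "a \<in> H"
  shows "real n *\<^sub>R a \<in> H"
  by (induction n) (use assms in \<open>auto simp: add_subgroup_0 scaleR_add_left add_subgroup_add\<close>)

lemma add_subgroup_of_int:
  fixes a :: "'a::real_vector"
  assumes "add_subgroup H" "a \<in> H"
  shows "real_of_int c *\<^sub>R a \<in> H"
  using add_subgroup_of_nat [OF assms] add_subgroup_minus [OF assms(1)]
  by (cases c rule: int_cases2) (metis of_int_of_nat_eq, metis of_int_minus of_int_of_nat_eq scaleR_minus_left)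

lemma add_subgroup_sum:
  assumes "add_subgroup H" "\<And>x. x \<in> A \<Longrightarrow> f x \<in> H"
  shows "sum f A \<in> H"
  using assms(2) by (induction A rule: infinite_finite_induct)
    (auto simp: assms(1) add_subgroup_0 add_subgroup_add)

text \<open>Has the shape of the successor clause of \<open>char_lattice\<close>, so that each step
  of the lattice chain is an instance.\<close>

definition adjoin :: "'a::real_vector set \<Rightarrow> 'a \<Rightarrow> 'a set" where
  "adjoin H a = {h + of_int c *\<^sub>R a | h c. h \<in> H}"

lemma adjoinI: "h \<in> H \<Longrightarrow> x = h + of_int c *\<^sub>R a \<Longrightarrow> x \<in> adjoin H a"
  by (auto simp: adjoin_def)

lemma add_subgroup_adjoin:
  assumes H: "add_subgroup H"
  shows "add_subgroup (adjoin H a)"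
  unfolding add_subgroup_def
proof (intro conjI ballI)
  show "0 \<in> adjoin H a" by (rule adjoinI [of 0 _ _ 0]) (use H in \<open>auto simp: add_subgroup_0\<close>)
  fix x y assume "x \<in> adjoin H a" "y \<in> adjoin H a"
  then obtain h c h' c' where "x = h + of_int c *\<^sub>R a" "y = h' + of_int c' *\<^sub>R a" "h \<in> H" "h' \<in> H"
    by (auto simp: adjoin_def)
  then show "x - y \<in> adjoin H a"
    using H by (intro adjoinI [of "h - h'" _ _ "c - c'"])
      (auto simp: add_subgroup_diff scaleR_diff_left)
qed

lemma subset_adjoin: "H \<subseteq> adjoin H a"
  by (auto intro: adjoinI [of _ _ _ 0])

lemma in_adjoin: "add_subgroup H \<Longrightarrow> a \<in> adjoin H a"
  by (rule adjoinI [of 0 _ _ 1]) (auto simp: add_subgroup_0)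

lemma adjoin_subset:
  assumes "add_subgroup K" "H \<subseteq> K" "a \<in> K"
  shows "adjoin H a \<subseteq> K"
  using assms by (auto simp: adjoin_def intro!: add_subgroup_add add_subgroup_of_int)

text \<open>The order of the class of \<open>a\<close> modulo \<open>H\<close>. The form with
  divisibility covers negative multiples, so that differences of multiples can be tested
  directly.\<close>

definition order_mod :: "'a::real_vector set \<Rightarrow> 'a \<Rightarrow> nat \<Rightarrow> bool" where
  "order_mod H a k \<longleftrightarrow> k > 0 \<and> (\<forall>c. of_int c *\<^sub>R a \<in> H \<longleftrightarrow> int k dvd c)"

text \<open>The least positive \<open>k\<close> whose multiple lies in \<open>H\<close> works;
  division with remainder shows that it divides all other coefficients.\<close>

lemma order_mod_exists:
  assumes H: "add_subgroup H" and N: "N > 0" "real N *\<^sub>R a \<in> H"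
  shows "\<exists>k. order_mod H a k"
proof -
  define k where "k = (LEAST k. k > 0 \<and> real k *\<^sub>R a \<in> H)"
  have k: "k > 0" "real k *\<^sub>R a \<in> H"
    using LeastI [of "\<lambda>k. k > 0 \<and> real k *\<^sub>R a \<in> H" N] N by (auto simp: k_def)
  have least: "m \<ge> k" if "m > 0" "real m *\<^sub>R a \<in> H" for m
    using Least_le [of "\<lambda>k. k > 0 \<and> real k *\<^sub>R a \<in> H" m] that by (auto simp: k_def)
  have "int k dvd c" if c: "of_int c *\<^sub>R a \<in> H" for c
  proof -
    have "of_int (c mod int k) *\<^sub>R a = of_int c *\<^sub>R a - of_int (c div int k) *\<^sub>R (real k *\<^sub>R a)"
    proof -
      have "real_of_int (c mod int k) = of_int c - of_int (c div int k) * of_int (int k)"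
        unfolding of_int_mult [symmetric] of_int_diff [symmetric] by (simp add: minus_div_mult_eq_mod)
      then show ?thesis by (simp only: scaleR_diff_left scaleR_scaleR of_int_of_nat_eq)
    qed
    also have "\<dots> \<in> H" by (intro add_subgroup_diff add_subgroup_of_int H c k)
    finally have "real (nat (c mod int k)) *\<^sub>R a \<in> H" using k by simp
    moreover have "nat (c mod int k) < k" using k by (simp add: nat_less_iff)
    ultimately have "nat (c mod int k) = 0" using least by (metis gr0I not_le)
    moreover have "c mod int k \<ge> 0" using k by simp
    ultimately show ?thesis by (simp add: dvd_eq_mod_eq_0)
  qed
  moreover have "of_int c *\<^sub>R a \<in> H" if "int k dvd c" for c
  proof -
    obtain q where "c = int k * q" using \<open>int k dvd c\<close> by (rule dvdE)
    then have "of_int c *\<^sub>R a = of_int q *\<^sub>R (real k *\<^sub>R a)" by (simp add: mult.commute)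
    then show ?thesis using add_subgroup_of_int [OF H k(2)] by metis
  qed
  ultimately show ?thesis using k by (auto simp: order_mod_def)
qed

text \<open>The multiples of \<open>a\<close> by 0, ..., k - 1 represent the cosets. This converts
  \<open>lattice_index\<close>, which counts cosets, into an order.\<close>

lemma order_mod_card_quotient:
  assumes H: "add_subgroup H" and k: "order_mod H a k"
  shows "card (adjoin H a // {(u, w). u \<in> adjoin H a \<and> w \<in> adjoin H a \<and> u - w \<in> H}) = k"
proof -
  let ?A = "adjoin H a"
  define r where "r = {(u, w). u \<in> ?A \<and> w \<in> ?A \<and> u - w \<in> H}"
  have mult_a: "of_int c *\<^sub>R a \<in> ?A" for c
    using add_subgroup_of_int [OF add_subgroup_adjoin [OF H] in_adjoin [OF H]] .
  have "equiv ?A r"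
  proof (rule equivI)
    show "r \<subseteq> ?A \<times> ?A" by (auto simp: r_def)
    show "refl_on ?A r" by (auto simp: refl_on_def r_def add_subgroup_0 [OF H])
    show "sym r"
      unfolding sym_def r_def using add_subgroup_minus [OF H] by fastforce
    show "trans r"
      unfolding trans_def r_def
    proof clarsimp
      fix x y z assume "x - y \<in> H" "y - z \<in> H"
      then show "x - z \<in> H" using add_subgroup_add [OF H, of "x - y" "y - z"] by simp
    qed
  qed
  note eq = eq_equiv_class_iff [OF this]
  have "bij_betw (\<lambda>c. r `` {of_int (int c) *\<^sub>R a}) {..<k} (?A // r)"
    unfolding bij_betw_def
  proof
    show "inj_on (\<lambda>c. r `` {of_int (int c) *\<^sub>R a}) {..<k}"
    proof (rule inj_onI)
      fix c c' assume c: "c \<in> {..<k}" "c' \<in> {..<k}"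
        "r `` {of_int (int c) *\<^sub>R a} = r `` {of_int (int c') *\<^sub>R a}"
      then have "of_int (int c) *\<^sub>R a - of_int (int c') *\<^sub>R a \<in> H"
        unfolding eq [OF mult_a mult_a] by (simp add: r_def)
      then have "of_int (int c - int c') *\<^sub>R a \<in> H" by (simp add: scaleR_diff_left)
      then have "int k dvd int c - int c'" using k by (simp only: order_mod_def)
      then show "c = c'" using c(1,2)
        by (metis lessThan_iff mod_eq_dvd_iff mod_less of_nat_eq_iff zmod_int)
    qed
    show "(\<lambda>c. r `` {of_int (int c) *\<^sub>R a}) ` {..<k} = ?A // r"
    proof
      show "(\<lambda>c. r `` {of_int (int c) *\<^sub>R a}) ` {..<k} \<subseteq> ?A // r"
        by (intro image_subsetI quotientI mult_a)
      show "?A // r \<subseteq> (\<lambda>c. r `` {of_int (int c) *\<^sub>R a}) ` {..<k}"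
      proof
        fix X assume "X \<in> ?A // r"
        then obtain x where x: "x \<in> ?A" "X = r `` {x}" by (auto elim: quotientE)
        then obtain h c where hc: "x = h + of_int c *\<^sub>R a" "h \<in> H" by (auto simp: adjoin_def)
        define m where "m = nat (c mod int k)"
        have "k > 0" using k by (simp add: order_mod_def)
        then have m: "m < k" "int m = c mod int k"
          by (auto simp: m_def nat_less_iff)
        have "x - of_int (int m) *\<^sub>R a = h + of_int (c - int m) *\<^sub>R a"
          by (simp add: hc scaleR_diff_left)
        moreover have "of_int (c - int m) *\<^sub>R a \<in> H"
          using k m by (simp only: order_mod_def minus_mod_eq_mult_div dvd_triv_left)
        ultimately have "x - of_int (int m) *\<^sub>R a \<in> H" using add_subgroup_add [OF H hc(2)] by metis
        then have "X = r `` {of_int (int m) *\<^sub>R a}"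
          unfolding x(2) eq [OF x(1) mult_a] using x(1) mult_a [of "int m"] by (simp add: r_def)
        then show "X \<in> (\<lambda>c. r `` {of_int (int c) *\<^sub>R a}) ` {..<k}" using m by blast
      qed
    qed
  qed
  then have "card {..<k} = card (?A // r)" by (rule bij_betw_same_card)
  then show ?thesis by (simp add: r_def)
qed

section \<open>Complex characters and their extension\<close>

definition character_on :: "'a::ab_group_add set \<Rightarrow> ('a \<Rightarrow> complex) \<Rightarrow> bool" where
  "character_on H \<psi> \<longleftrightarrow> (\<forall>a\<in>H. \<forall>b\<in>H. \<psi> (a + b) = \<psi> a * \<psi> b) \<and> (\<forall>a\<in>H. \<psi> a \<noteq> 0)"

lemma character_on_add: "character_on H \<psi> \<Longrightarrow> a \<in> H \<Longrightarrow> b \<in> H \<Longrightarrow> \<psi> (a + b) = \<psi> a * \<psi> b"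
  and character_on_nz: "character_on H \<psi> \<Longrightarrow> a \<in> H \<Longrightarrow> \<psi> a \<noteq> 0"
  by (auto simp: character_on_def)

lemma character_on_0:
  assumes "character_on H \<psi>" "add_subgroup H"
  shows "\<psi> 0 = 1"
  using character_on_add [OF assms(1), of 0 0] character_on_nz [OF assms(1), of 0] add_subgroup_0 [OF assms(2)]
  by simp

lemma character_on_diff:
  assumes "character_on H \<psi>" "add_subgroup H" "a \<in> H" "b \<in> H"
  shows "\<psi> (a - b) = \<psi> a / \<psi> b"
  using character_on_add [OF assms(1), of "a - b" b] character_on_nz [OF assms(1,4)] assms
  by (simp add: add_subgroup_diff field_simps)

lemma character_on_of_nat:
  fixes a :: "'a::real_vector"
  assumes "character_on H \<psi>" "add_subgroup H" "a \<in> H"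
  shows "\<psi> (real n *\<^sub>R a) = \<psi> a ^ n"
proof (induction n)
  case 0
  then show ?case using character_on_0 [OF assms(1,2)] by simp
next
  case (Suc n)
  then show ?case
    using character_on_add [OF assms(1,3) add_subgroup_of_nat [OF assms(2,3)], of n]
    by (simp add: scaleR_add_left)
qed

lemma character_on_of_int:
  fixes a :: "'a::real_vector"
  assumes "character_on H \<psi>" "add_subgroup H" "a \<in> H"
  shows "\<psi> (of_int c *\<^sub>R a) = \<psi> a powi c"
proof (cases c rule: int_cases2)
  case (nonneg n)
  then show ?thesis using character_on_of_nat [OF assms] by simp
next
  case (nonpos n)
  have "\<psi> (0 - real n *\<^sub>R a) = 1 / \<psi> a ^ n"
    using character_on_diff [OF assms(1,2) add_subgroup_0 [OF assms(2)] add_subgroup_of_nat [OF assms(2,3)]]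
      character_on_of_nat [OF assms] character_on_0 [OF assms(1,2)] by simp
  then show ?thesis using nonpos by (simp add: power_int_minus field_simps)
qed

text \<open>All relations between \<open>a\<close> and \<open>H\<close> come from the one element
  \<open>real k *\<^sub>R a\<close> of \<open>H\<close>; hence any \<open>k\<close>-th root of the
  value there may serve as the value at \<open>a\<close>.\<close>

lemma character_extend_adjoin:
  fixes a :: "'a::real_vector"
  assumes H: "add_subgroup H" and \<psi>: "character_on H \<psi>" and k: "order_mod H a k"
    and \<rho>: "\<rho> ^ k = \<psi> (real k *\<^sub>R a)"
  shows "\<exists>\<psi>'. character_on (adjoin H a) \<psi>' \<and> (\<forall>h\<in>H. \<psi>' h = \<psi> h) \<and> \<psi>' a = \<rho>"
proof -
  have k0: "k > 0" and kH: "\<And>c. of_int c *\<^sub>R a \<in> H \<longleftrightarrow> int k dvd c"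
    using k by (auto simp: order_mod_def)
  have ka: "real k *\<^sub>R a \<in> H" using kH [of "int k"] by simp
  have \<rho>0: "\<rho> \<noteq> 0" using \<rho> character_on_nz [OF \<psi> ka] k0 by (metis zero_power)
  \<comment> \<open>In two representations of one element the coefficients of \<open>a\<close>
    differ by a multiple of \<open>k\<close>, and the candidate values agree by the choice of
    \<open>\<rho>\<close>.\<close>
  have wd: "\<psi> h * \<rho> powi c = \<psi> h' * \<rho> powi c'"
    if "h \<in> H" "h' \<in> H" and eq: "h + of_int c *\<^sub>R a = h' + of_int c' *\<^sub>R a" for h h' c c'
  proof -
    have "h' - h = of_int (c - c') *\<^sub>R a" using eq by (simp add: algebra_simps)
    moreover have "h' - h \<in> H" using that H by (simp add: add_subgroup_diff)
    ultimately have "int k dvd c - c'" using kH by metis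
    then obtain q where q: "c - c' = int k * q" by (rule dvdE)
    then have "h' - h = of_int q *\<^sub>R (real k *\<^sub>R a)"
      using \<open>h' - h = of_int (c - c') *\<^sub>R a\<close> by (simp add: mult.commute)
    then have "\<psi> h' / \<psi> h = \<psi> (real k *\<^sub>R a) powi q"
      using character_on_of_int [OF \<psi> H ka] character_on_diff [OF \<psi> H that(2,1)] by metis
    also have "\<dots> = \<rho> powi (c - c')"
      by (simp add: q \<rho> [symmetric] power_int_mult)
    also have "\<dots> = \<rho> powi c / \<rho> powi c'" using \<rho>0 by (simp add: power_int_diff)
    finally show ?thesis
      using \<rho>0 character_on_nz [OF \<psi> that(1)] by (simp add: field_simps)
  qed
  define \<psi>' where "\<psi>' x = (SOME y. \<exists>h\<in>H. \<exists>c. x = h + of_int c *\<^sub>R a \<and> y = \<psi> h * \<rho> powi c)" for x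
  have \<psi>': "\<psi>' (h + of_int c *\<^sub>R a) = \<psi> h * \<rho> powi c" if "h \<in> H" for h c
    unfolding \<psi>'_def
  proof (rule some_equality)
    show "\<exists>ha\<in>H. \<exists>ca. h + of_int c *\<^sub>R a = ha + of_int ca *\<^sub>R a \<and> \<psi> h * \<rho> powi c = \<psi> ha * \<rho> powi ca"
      using that by blast
    fix y assume "\<exists>ha\<in>H. \<exists>ca. h + of_int c *\<^sub>R a = ha + of_int ca *\<^sub>R a \<and> y = \<psi> ha * \<rho> powi ca"
    then obtain ha ca where *: "ha \<in> H" "h + of_int c *\<^sub>R a = ha + of_int ca *\<^sub>R a" "y = \<psi> ha * \<rho> powi ca"
      by blast
    show "y = \<psi> h * \<rho> powi c" using wd [OF that *(1,2)] *(3) by simp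
  qed
  have "character_on (adjoin H a) \<psi>'"
    unfolding character_on_def
  proof (intro conjI ballI)
    fix x y assume "x \<in> adjoin H a" "y \<in> adjoin H a"
    then obtain h c h' c' where xy: "x = h + of_int c *\<^sub>R a" "y = h' + of_int c' *\<^sub>R a" "h \<in> H" "h' \<in> H"
      by (auto simp: adjoin_def)
    have "x + y = (h + h') + of_int (c + c') *\<^sub>R a" by (simp add: xy algebra_simps)
    then have "\<psi>' (x + y) = \<psi> (h + h') * \<rho> powi (c + c')"
      using \<psi>' [OF add_subgroup_add [OF H xy(3,4)]] by metis
    then show "\<psi>' (x + y) = \<psi>' x * \<psi>' y"
      using xy \<psi>' character_on_add [OF \<psi> xy(3,4)] \<rho>0 by (simp add: power_int_add)
  next
    fix x assume "x \<in> adjoin H a"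
    then obtain h c where x: "x = h + of_int c *\<^sub>R a" "h \<in> H" by (auto simp: adjoin_def)
    then show "\<psi>' x \<noteq> 0" using \<psi>' \<rho>0 character_on_nz [OF \<psi> x(2)] by simp
  qed
  moreover have "\<psi>' h = \<psi> h" if "h \<in> H" for h using \<psi>' [OF that, of 0] by simp
  moreover have "\<psi>' a = \<rho>"
    using \<psi>' [OF add_subgroup_0 [OF H], of 1] character_on_0 [OF \<psi> H] by simp
  ultimately show ?thesis by blast
qed

lemma complex_root_exists:
  assumes "k > 0"
  shows "\<exists>\<rho>. \<rho> ^ k = (z :: complex)"
proof (cases "z = 0")
  case False
  have "exp (Ln z / of_nat k) ^ k = z"
    using assms False by (simp add: exp_of_nat_mult [symmetric])
  then show ?thesis ..
qed (use assms in auto)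

definition frac_lattice :: "nat \<Rightarrow> (real ^ 'd::finite) set" where
  "frac_lattice n = {w. \<forall>i. real n * w $ i \<in> \<int>}"

definition int_lattice :: "(real ^ 'd::finite) set" where
  "int_lattice = {w. \<forall>i. w $ i \<in> \<int>}"

lemma add_subgroup_frac_lattice: "add_subgroup (frac_lattice n)"
  by (auto simp: add_subgroup_def frac_lattice_def right_diff_distrib)

lemma add_subgroup_int_lattice: "add_subgroup int_lattice"
  by (auto simp: add_subgroup_def int_lattice_def)

lemma int_lattice_subset_frac: "int_lattice \<subseteq> frac_lattice n"
  by (auto simp: int_lattice_def frac_lattice_def)

lemma frac_lattice_subset:
  assumes H: "add_subgroup H" and n: "n > 0" and ax: "\<And>i. axis i (1 / real n) \<in> H"
  shows "frac_lattice n \<subseteq> H"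
proof
  fix w :: "real ^ 'a" assume "w \<in> frac_lattice n"
  then have "\<exists>c. \<forall>i. real n * w $ i = of_int (c i)"
    by (intro choice) (auto simp: frac_lattice_def Ints_def)
  then obtain c where c: "\<And>i. real n * w $ i = of_int (c i)" by blast
  have "w = (\<Sum>i\<in>UNIV. of_int (c i) *\<^sub>R axis i (1 / real n))"
    using n by (simp add: fvec_eq sum_component axis_def if_distrib sum.delta c [symmetric] cong: if_cong)
  also have "\<dots> \<in> H" by (intro add_subgroup_sum add_subgroup_of_int H ax)
  finally show "w \<in> H" .
qed

text \<open>Nonzero complex numbers have roots of every order, so the generators of the fractional
  lattice can be adjoined one at a time. Each has finite order modulo the current subgroup because
  its \<open>n\<close>-fold multiple is an integer vector.\<close>

lemma character_extend_frac:
  fixes H :: "(real ^ 'd::finite) set"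
  assumes H: "add_subgroup H" "int_lattice \<subseteq> H" and \<psi>: "character_on H \<psi>" and n: "n > 0"
  shows "\<exists>\<psi>'. character_on (frac_lattice n) \<psi>' \<and> (\<forall>h\<in>H \<inter> frac_lattice n. \<psi>' h = \<psi> h)"
proof -
  have "\<exists>H' \<psi>'. add_subgroup H' \<and> H \<subseteq> H' \<and> (\<forall>i\<in>I. axis i (1 / real n) \<in> H') \<and>
      character_on H' \<psi>' \<and> (\<forall>h\<in>H. \<psi>' h = \<psi> h)" if "finite I" for I :: "'d set"
    using that
  proof (induction I rule: finite_induct)
    case empty
    then show ?case using H \<psi> by blast
  next
    case (insert i I)
    then obtain H' \<psi>' where *: "add_subgroup H'" "H \<subseteq> H'" "\<forall>i\<in>I. axis i (1 / real n) \<in> H'"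
      "character_on H' \<psi>'" "\<forall>h\<in>H. \<psi>' h = \<psi> h" by blast
    let ?a = "axis i (1 / real n) :: real ^ 'd"
    have "real n *\<^sub>R ?a = axis i 1" using n by (simp add: fvec_eq axis_def)
    also have "\<dots> \<in> int_lattice" by (auto simp: int_lattice_def axis_def)
    finally have "real n *\<^sub>R ?a \<in> H'" using * H(2) by blast
    then obtain k where k: "order_mod H' ?a k" using order_mod_exists [OF *(1) n] by blast
    obtain \<rho> where "\<rho> ^ k = \<psi>' (real k *\<^sub>R ?a)"
      using complex_root_exists k unfolding order_mod_def by metis
    then obtain \<psi>'' where "character_on (adjoin H' ?a) \<psi>''" "\<forall>h\<in>H'. \<psi>'' h = \<psi>' h"
      using character_extend_adjoin [OF *(1,4) k] by blast
    then show ?case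
      using * add_subgroup_adjoin [OF *(1)] subset_adjoin [of H' ?a] in_adjoin [OF *(1), of ?a]
      by (intro exI [of _ "adjoin H' ?a"] exI [of _ \<psi>'']) auto
  qed
  from this [of UNIV] obtain H' \<psi>' where *: "add_subgroup H'" "\<And>i. axis i (1 / real n) \<in> H'"
      "character_on H' \<psi>'" "\<forall>h\<in>H. \<psi>' h = \<psi> h" by auto
  have "frac_lattice n \<subseteq> H'" by (rule frac_lattice_subset [OF *(1) n *(2)])
  then have "character_on (frac_lattice n) \<psi>'"
    using *(3) unfolding character_on_def by blast
  then show ?thesis using *(4) by blast
qed

text \<open>The values outside the lattice are fixed, so that equal characters are equal functions.\<close>

definition char_group :: "nat \<Rightarrow> (real ^ 'd::finite) set \<Rightarrow> (real ^ 'd \<Rightarrow> complex) set" where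
  "char_group n H = {\<psi>. character_on (frac_lattice n) \<psi> \<and> (\<forall>w\<in>H. \<psi> w = 1) \<and>
     (\<forall>w. w \<notin> frac_lattice n \<longrightarrow> \<psi> w = 1)}"

lemma char_groupD:
  assumes "\<psi> \<in> char_group n H"
  shows "character_on (frac_lattice n) \<psi>" "w \<in> H \<Longrightarrow> \<psi> w = 1" "w \<notin> frac_lattice n \<Longrightarrow> \<psi> w = 1"
  using assms by (auto simp: char_group_def)

lemma char_group_mult:
  "\<psi> \<in> char_group n H \<Longrightarrow> \<psi>' \<in> char_group n H \<Longrightarrow> (\<lambda>w. \<psi> w * \<psi>' w) \<in> char_group n H"
  by (auto simp: char_group_def character_on_def)

lemma char_group_divide:
  "\<psi> \<in> char_group n H \<Longrightarrow> \<psi>' \<in> char_group n H \<Longrightarrow> (\<lambda>w. \<psi> w / \<psi>' w) \<in> char_group n H"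
  by (auto simp: char_group_def character_on_def)

lemma char_group_mono: "H \<subseteq> H' \<Longrightarrow> char_group n H' \<subseteq> char_group n H"
  by (auto simp: char_group_def)

lemma char_group_one: "(\<lambda>_. 1) \<in> char_group n H"
  by (auto simp: char_group_def character_on_def)

lemma char_group_nz: "\<psi> \<in> char_group n H \<Longrightarrow> \<psi> w \<noteq> 0"
  by (cases "w \<in> frac_lattice n") (auto simp: char_group_def character_on_def)

text \<open>A character is determined by its values on the generators
  \<open>axis i (1 / real n)\<close>, and these values are \<open>n\<close>-th roots of
  unity.\<close>

lemma finite_char_group:
  assumes n: "n > 0"
  shows "finite (char_group n (int_lattice :: (real ^ 'd::finite) set))" (is "finite ?G")
proof (rule finite_imageD)
  let ?F = "\<lambda>\<psi> i. \<psi> (axis i (1 / real n) :: real ^ 'd)"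
  let ?R = "{z :: complex. z ^ n = 1}"
  have ax: "(axis i (1 / real n) :: real ^ 'd) \<in> frac_lattice n" for i
    by (auto simp: frac_lattice_def axis_def)
  have "?F \<psi> i \<in> ?R" if "\<psi> \<in> ?G" for \<psi> i
  proof -
    have "real n *\<^sub>R axis i (1 / real n) \<in> (int_lattice :: (real ^ 'd) set)"
      using n by (auto simp: int_lattice_def axis_def)
    then have "\<psi> (real n *\<^sub>R axis i (1 / real n)) = 1" using that by (auto simp: char_group_def)
    then show ?thesis
      using character_on_of_nat [OF _ add_subgroup_frac_lattice ax] that by (simp add: char_group_def)
  qed
  then have "?F ` ?G \<subseteq> (\<Pi>\<^sub>E i\<in>UNIV. ?R)" by auto
  moreover have "finite (\<Pi>\<^sub>E i\<in>(UNIV :: 'd set). ?R)"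
    using n by (intro finite_PiE) (auto intro: finite_nth_roots)
  ultimately show "finite (?F ` ?G)" by (rule finite_subset)
  show "inj_on ?F ?G"
  proof (rule inj_onI)
    fix \<psi> \<psi>' assume \<psi>: "\<psi> \<in> ?G" "\<psi>' \<in> ?G" and eq: "?F \<psi> = ?F \<psi>'"
    note c = char_groupD(1) [OF \<psi>(1)] char_groupD(1) [OF \<psi>(2)]
    \<comment> \<open>The set where the two characters agree is a subgroup; it contains the
      generators, hence the whole lattice.\<close>
    define H where "H = {w \<in> frac_lattice n. \<psi> w = \<psi>' w}"
    have "add_subgroup H"
      unfolding H_def
      using add_subgroup_diff [OF add_subgroup_frac_lattice [of n]] add_subgroup_0 [OF add_subgroup_frac_lattice [of n]]
        character_on_diff [OF c(1) add_subgroup_frac_lattice] character_on_diff [OF c(2) add_subgroup_frac_lattice]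
        character_on_0 [OF c(1) add_subgroup_frac_lattice] character_on_0 [OF c(2) add_subgroup_frac_lattice]
      by (auto simp: add_subgroup_def)
    moreover have "axis i (1 / real n) \<in> H" for i
      using ax fun_cong [OF eq, of i] by (simp add: H_def)
    ultimately have "frac_lattice n \<subseteq> H" using n by (intro frac_lattice_subset)
    then have "\<psi> x = \<psi>' x" for x
      using char_groupD(3) [OF \<psi>(1), of x] char_groupD(3) [OF \<psi>(2), of x]
      by (cases "x \<in> frac_lattice n") (auto simp: H_def)
    then show "\<psi> = \<psi>'" by blast
  qed
qed

text \<open>The trivial character of \<open>H\<close> is extended first by the value
  \<open>\<rho>\<close> at \<open>a\<close> and then to the whole fractional lattice; the value 1
  outside puts it into the normal form required by \<open>char_group\<close>.\<close>

lemma char_group_attains: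
  fixes H :: "(real ^ 'd::finite) set"
  assumes H: "add_subgroup H" "int_lattice \<subseteq> H" "H \<subseteq> frac_lattice n" and n: "n > 0"
    and a: "a \<in> frac_lattice n" and k: "order_mod H a k" and \<rho>: "\<rho> ^ k = 1"
  shows "\<exists>\<psi>\<in>char_group n H. \<psi> a = \<rho>"
proof -
  have "character_on H (\<lambda>_. 1)" by (simp add: character_on_def)
  then obtain \<psi>' where \<psi>': "character_on (adjoin H a) \<psi>'" "\<forall>h\<in>H. \<psi>' h = 1" "\<psi>' a = \<rho>"
    using character_extend_adjoin [OF H(1) _ k, of "\<lambda>_. 1" \<rho>] \<rho> by auto
  have "adjoin H a \<subseteq> frac_lattice n"
    by (rule adjoin_subset [OF add_subgroup_frac_lattice H(3) a])
  moreover have "int_lattice \<subseteq> adjoin H a" using H(2) subset_adjoin by blast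
  ultimately obtain \<psi>'' where \<psi>'': "character_on (frac_lattice n) \<psi>''" "\<forall>h\<in>adjoin H a. \<psi>'' h = \<psi>' h"
    using character_extend_frac [OF add_subgroup_adjoin [OF H(1)] _ \<psi>'(1) n] by blast
  define \<psi> where "\<psi> w = (if w \<in> frac_lattice n then \<psi>'' w else 1)" for w
  have "character_on (frac_lattice n) \<psi>"
    using \<psi>''(1) add_subgroup_add [OF add_subgroup_frac_lattice]
    by (auto simp: character_on_def \<psi>_def)
  moreover have "\<psi> h = 1" if "h \<in> H" for h
    using that \<psi>' \<psi>'' subset_adjoin [of H a] by (auto simp: \<psi>_def)
  moreover have "\<psi> a = \<rho>" using \<psi>' \<psi>'' in_adjoin [OF H(1), of a] a by (simp add: \<psi>_def)
  ultimately show ?thesis by (intro bexI [of _ \<psi>]) (auto simp: char_group_def \<psi>_def)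
qed

text \<open>The order of \<open>w\<close> modulo the integer vectors exceeds 1, so a root of unity
  other than 1 is an admissible value at \<open>w\<close>.\<close>

lemma char_group_separates:
  fixes w :: "real ^ 'd::finite"
  assumes n: "n > 0" and w: "w \<in> frac_lattice n" "w \<notin> int_lattice"
  shows "\<exists>\<psi>\<in>char_group n int_lattice. \<psi> w \<noteq> 1"
proof -
  have "real n *\<^sub>R w \<in> int_lattice" using w by (simp add: frac_lattice_def int_lattice_def)
  then obtain k where k: "order_mod int_lattice w k"
    using order_mod_exists [OF add_subgroup_int_lattice n] by blast
  have "k \<noteq> 1"
  proof
    assume "k = 1"
    then have "of_int 1 *\<^sub>R w \<in> int_lattice" using k unfolding order_mod_def by (metis of_nat_1 dvd_refl)
    with w show False by simp
  qed
  moreover have "k > 0" using k by (simp add: order_mod_def)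
  ultimately have "card {z :: complex. z ^ k = 1} > 1" by (simp add: card_roots_unity_eq)
  then have "\<not> {z :: complex. z ^ k = 1} \<subseteq> {1}"
    using card_mono [of "{1 :: complex}" "{z. z ^ k = 1}"] by auto
  then obtain \<rho> :: complex where "\<rho> ^ k = 1" "\<rho> \<noteq> 1" by blast
  then show ?thesis
    using char_group_attains [OF add_subgroup_int_lattice order_refl int_lattice_subset_frac n w(1) k]
    by metis
qed

lemma char_group_adjoin:
  assumes H: "add_subgroup H" "H \<subseteq> frac_lattice n" and a: "a \<in> frac_lattice n"
  shows "\<psi> \<in> char_group n (adjoin H a) \<longleftrightarrow> \<psi> \<in> char_group n H \<and> \<psi> a = 1"
proof
  assume "\<psi> \<in> char_group n (adjoin H a)"
  then show "\<psi> \<in> char_group n H \<and> \<psi> a = 1"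
    using char_group_mono [OF subset_adjoin [of H a]] char_groupD(2) in_adjoin [OF H(1)] by blast
next
  assume \<psi>: "\<psi> \<in> char_group n H \<and> \<psi> a = 1"
  then have c: "character_on (frac_lattice n) \<psi>" by (simp add: char_group_def)
  have "\<psi> (h + of_int c *\<^sub>R a) = 1" if "h \<in> H" for h c
    using character_on_add [OF c, of h "of_int c *\<^sub>R a"] that H(2) \<psi> char_groupD(2) [of \<psi> n H h]
      character_on_of_int [OF c add_subgroup_frac_lattice a]
      add_subgroup_of_int [OF add_subgroup_frac_lattice a] by auto
  then show "\<psi> \<in> char_group n (adjoin H a)"
    using \<psi> by (auto simp: char_group_def adjoin_def)
qed

text \<open>Evaluation at \<open>a\<close> maps the characters trivial on \<open>H\<close> onto the
  \<open>k\<close>-th roots of unity, and all fibres are translates of the kernel, the characters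
  trivial on \<open>adjoin H a\<close>.\<close>

lemma card_char_group_adjoin:
  fixes H :: "(real ^ 'd::finite) set"
  assumes H: "add_subgroup H" "int_lattice \<subseteq> H" "H \<subseteq> frac_lattice n" and n: "n > 0"
    and a: "a \<in> frac_lattice n" and k: "order_mod H a k"
  shows "card (char_group n H) = k * card (char_group n (adjoin H a))"
proof -
  let ?G = "char_group n H" and ?R = "{z :: complex. z ^ k = 1}"
  have k0: "k > 0" using k by (simp add: order_mod_def)
  have fin: "finite ?G"
    using finite_subset [OF char_group_mono [OF H(2)] finite_char_group [OF n]] .
  have ev: "\<psi> a \<in> ?R" if \<psi>: "\<psi> \<in> ?G" for \<psi>
  proof -
    have "of_int (int k) *\<^sub>R a \<in> H" using k unfolding order_mod_def by (metis dvd_refl)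
    then have "\<psi> (real k *\<^sub>R a) = 1" using char_groupD(2) [OF \<psi>] by simp
    then show ?thesis
      using character_on_of_nat [OF char_groupD(1) [OF \<psi>] add_subgroup_frac_lattice a] by simp
  qed
  have fib: "card {\<psi> \<in> ?G. \<psi> a = \<rho>} = card (char_group n (adjoin H a))" if \<rho>: "\<rho> \<in> ?R" for \<rho>
  proof -
    obtain \<psi>0 where \<psi>0: "\<psi>0 \<in> ?G" "\<psi>0 a = \<rho>"
      using char_group_attains [OF H n a k] \<rho> by blast
    have \<rho>0: "\<rho> \<noteq> 0" using \<psi>0 char_group_nz by blast
    have "bij_betw (\<lambda>\<psi> w. \<psi> w * \<psi>0 w) (char_group n (adjoin H a)) {\<psi> \<in> ?G. \<psi> a = \<rho>}"
      by (rule bij_betw_byWitness [where f' = "\<lambda>\<psi> w. \<psi> w / \<psi>0 w"])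
         (use \<psi>0 \<rho>0 in \<open>auto simp: char_group_adjoin [OF H(1,3) a] fun_eq_iff char_group_nz intro: char_group_mult char_group_divide\<close>)
    then show ?thesis by (simp add: bij_betw_same_card)
  qed
  have "card ?G = card (\<Union>\<rho>\<in>?R. {\<psi> \<in> ?G. \<psi> a = \<rho>})"
    by (rule arg_cong [where f = card]) (use ev in auto)
  also have "\<dots> = (\<Sum>\<rho>\<in>?R. card {\<psi> \<in> ?G. \<psi> a = \<rho>})"
    using fin k0 by (intro card_UN_disjoint) (auto intro: finite_nth_roots)
  also have "\<dots> = k * card (char_group n (adjoin H a))"
    using fib k0 by (simp add: card_roots_unity_eq)
  finally show ?thesis .
qed

section \<open>Roots and their conjugates\<close>

lemma inj_idom_hom_ramify:
  assumes "n > 0"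
  shows "inj_idom_hom (ramify n :: ('a::idom, 'i::finite) mfps \<Rightarrow> _)"
proof -
  interpret inj_comm_ring_hom "ramify n :: ('a, 'i) mfps \<Rightarrow> _" by (rule inj_comm_ring_hom_ramify [OF assms])
  show ?thesis by unfold_locales
qed

text \<open>
  The Sylvester matrix sends the vector of powers of \<open>\<tau>\<close> to a vector of multiples of \<open>poly q \<tau>\<close>;
  apply the adjugate and read off the entry at \<open>\<tau>\<^sup>0 = 1\<close>.
\<close>

lemma poly_dvd_resultant:
  fixes p q :: "'a::comm_ring_1 poly"
  assumes root: "poly p \<tau> = 0" and deg: "degree p + degree q > 0"
  shows "poly q \<tau> dvd resultant p q"
proof -
  define N where "N = degree p + degree q"
  define S where "S = sylvester_mat p q"
  define X where "X = adj_mat S"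
  have N: "N > 0" using deg by (simp add: N_def)
  have S: "S \<in> carrier_mat N N" by (simp add: S_def N_def sylvester_carrier_mat)
  have X: "X \<in> carrier_mat N N" "X * S = det S \<cdot>\<^sub>m 1\<^sub>m N"
    using adj_mat [OF S] by (simp_all add: X_def)
  \<comment> \<open>The entry formula for the Sylvester matrix has exponent and index one higher
    than the coefficient row of \<open>monom 1 e * r\<close>; hence \<open>Suc e\<close> and
    \<open>N - l\<close>, which \<open>monom_Suc\<close> shifts back.\<close>
  have poly_sum: "(\<Sum>l<N. coeff (monom 1 (Suc e) * r) (N - l) * \<tau> ^ (N - 1 - l)) = \<tau> ^ e * poly r \<tau>"
    if "degree (monom 1 e * r) < N" for e and r :: "'a poly"
  proof -
    have "(\<Sum>l<N. coeff (monom 1 (Suc e) * r) (N - l) * \<tau> ^ (N - 1 - l)) =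
        (\<Sum>j<N. coeff (monom 1 (Suc e) * r) (Suc j) * \<tau> ^ j)"
      by (rule sum.reindex_bij_witness [where i = "\<lambda>j. N - 1 - j" and j = "\<lambda>l. N - 1 - l"])
         (auto simp: Suc_diff_Suc)
    also have "\<dots> = (\<Sum>j<N. coeff (monom 1 e * r) j * \<tau> ^ j)"
      by (simp add: monom_Suc mult_pCons_left)
    also have "\<dots> = poly (monom 1 e * r) \<tau>"
      unfolding poly_altdef using that
      by (intro sum.mono_neutral_right) (auto simp: coeff_eq_0)
    finally show ?thesis by (simp add: poly_monom)
  qed
  have row: "poly q \<tau> dvd (\<Sum>l<N. S $$ (k, l) * \<tau> ^ (N - 1 - l))" if k: "k < N" for k
  proof (cases "k < degree q")
    case True
    have le: "degree (monom 1 (degree q - Suc k) * p) \<le> degree q - Suc k + degree p"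
      by (rule order_trans [OF degree_mult_le]) (simp add: degree_monom_le)
    have "(\<Sum>l<N. S $$ (k, l) * \<tau> ^ (N - 1 - l)) =
        (\<Sum>l<N. coeff (monom 1 (Suc (degree q - Suc k)) * p) (N - l) * \<tau> ^ (N - 1 - l))"
      using k True by (intro sum.cong) (auto simp: S_def N_def sylvester_index_mat2 Suc_diff_Suc)
    also have "\<dots> = 0"
      by (subst poly_sum) (use le True root in \<open>auto simp: N_def\<close>)
    finally show ?thesis by simp
  next
    case False
    have le: "degree (monom 1 (N - Suc k) * q) \<le> N - Suc k + degree q"
      by (rule order_trans [OF degree_mult_le]) (simp add: degree_monom_le)
    have "(\<Sum>l<N. S $$ (k, l) * \<tau> ^ (N - 1 - l)) =
        (\<Sum>l<N. coeff (monom 1 (Suc (N - Suc k)) * q) (N - l) * \<tau> ^ (N - 1 - l))"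
      using k False by (intro sum.cong) (auto simp: S_def N_def sylvester_index_mat2 Suc_diff_Suc)
    also have "\<dots> = \<tau> ^ (N - Suc k) * poly q \<tau>"
      by (subst poly_sum) (use le k False in \<open>auto simp: N_def\<close>)
    finally show ?thesis by simp
  qed
  have "det S = (\<Sum>l<N. (det S \<cdot>\<^sub>m 1\<^sub>m N) $$ (N - 1, l) * \<tau> ^ (N - 1 - l))"
  proof -
    have "(\<Sum>l<N. (det S \<cdot>\<^sub>m 1\<^sub>m N) $$ (N - 1, l) * \<tau> ^ (N - 1 - l)) =
        (\<Sum>l<N. if l = N - 1 then det S else 0)"
      using N by (intro sum.cong) auto
    then show ?thesis using N by simp
  qed
  also have "\<dots> = (\<Sum>l<N. (X * S) $$ (N - 1, l) * \<tau> ^ (N - 1 - l))" by (simp add: X)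
  also have "\<dots> = (\<Sum>l<N. \<Sum>k<N. X $$ (N - 1, k) * (S $$ (k, l) * \<tau> ^ (N - 1 - l)))"
  proof (rule sum.cong [OF refl])
    fix l assume "l \<in> {..<N}"
    then have "(X * S) $$ (N - 1, l) = (\<Sum>k<N. X $$ (N - 1, k) * S $$ (k, l))"
      using N S X(1) by (simp add: scalar_prod_def lessThan_atLeast0)
    then show "(X * S) $$ (N - 1, l) * \<tau> ^ (N - 1 - l) =
        (\<Sum>k<N. X $$ (N - 1, k) * (S $$ (k, l) * \<tau> ^ (N - 1 - l)))"
      by (simp only: sum_distrib_right mult.assoc)
  qed
  also have "\<dots> = (\<Sum>k<N. X $$ (N - 1, k) * (\<Sum>l<N. S $$ (k, l) * \<tau> ^ (N - 1 - l)))"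
    by (subst sum.swap) (simp add: sum_distrib_left)
  also have "poly q \<tau> dvd \<dots>" using row by (intro dvd_sum) (auto intro: dvd_mult)
  finally show ?thesis by (simp add: resultant_def S_def)
qed

lemma prod_linear_dvd:
  fixes p :: "'a::idom poly"
  assumes "finite S" "\<And>\<tau>. \<tau> \<in> S \<Longrightarrow> poly p \<tau> = 0"
  shows "(\<Prod>\<tau>\<in>S. [:- \<tau>, 1:]) dvd p"
  using assms
proof (induction S rule: finite_induct)
  case (insert \<sigma> S)
  then obtain q where q: "p = (\<Prod>\<tau>\<in>S. [:- \<tau>, 1:]) * q" by (auto elim: dvdE)
  have "poly (\<Prod>\<tau>\<in>S. [:- \<tau>, 1:]) \<sigma> \<noteq> 0"
    using insert.hyps by (auto simp: poly_prod)
  then have "poly q \<sigma> = 0" using insert.prems [of \<sigma>] q by auto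
  then have "[:- \<sigma>, 1:] dvd q" by (simp add: poly_eq_0_iff_dvd)
  then show ?case
    unfolding prod.insert [OF insert.hyps] q by (subst mult.commute) (intro mult_dvd_mono dvd_refl)
qed simp

lemma monic_prod_linear:
  fixes S :: "'a::idom set"
  shows "lead_coeff (\<Prod>\<tau>\<in>S. [:- \<tau>, 1:]) = 1" "degree (\<Prod>\<tau>\<in>S. [:- \<tau>, 1:]) = card S"
  by (subst lead_coeff_prod, simp) (simp add: degree_prod_eq_sum_degree)

section \<open>Conjugation of ramified series by characters\<close>

lemma xexp_add: "xexp n (a + b) = xexp n a + xexp n b"
  by (simp add: xexp_def fvec_eq add_divide_distrib)

lemma xexp_0 [simp]: "xexp n 0 = 0"
  by (simp add: xexp_def fvec_eq)

lemma xexp_in_frac: "n > 0 \<Longrightarrow> xexp n u \<in> frac_lattice n"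
  by (simp add: xexp_def frac_lattice_def)

lemma xexp_le_iff: "n > 0 \<Longrightarrow> xexp n u \<le> xexp n w \<longleftrightarrow> u \<le> w"
  by (simp add: xexp_def fvec_le divide_le_cancel)

lemma xexp_eq_iff: "n > 0 \<Longrightarrow> xexp n u = xexp n w \<longleftrightarrow> u = w"
  by (simp add: xexp_def fvec_eq)

lemma xexp_less_iff: "n > 0 \<Longrightarrow> xexp n u < xexp n w \<longleftrightarrow> u < w"
  using xexp_le_iff xexp_eq_iff by (metis order.strict_iff_order)

lemma xexp_scale: "n > 0 \<Longrightarrow> xexp n (n *s u) = (\<chi> i. real (u $ i))"
  by (simp add: xexp_def fvec_eq vector_scalar_mult_def)

lemma xexp_int_lattice:
  assumes "n > 0" "xexp n u \<in> int_lattice"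
  shows "u \<in> range ((*s) n)"
proof -
  have "n dvd u $ i" for i
  proof -
    obtain c where "real (u $ i) / real n = of_int c"
      using assms(2) by (auto simp: xexp_def int_lattice_def elim!: Ints_cases)
    then have "of_int (int (u $ i)) = (of_int (c * int n) :: real)"
      using assms(1) by (simp add: field_simps)
    then have "int (u $ i) = c * int n" by (simp only: of_int_eq_iff)
    then show ?thesis by (metis dvd_triv_right int_dvd_int_iff)
  qed
  then have "u = n *s (\<chi> i. u $ i div n)" by (simp add: fvec_eq vector_scalar_mult_def)
  then show ?thesis by blast
qed

definition conjugate :: "nat \<Rightarrow> (real ^ 'd::finite \<Rightarrow> complex) \<Rightarrow> (complex, 'd) mfps \<Rightarrow> (complex, 'd) mfps"
  where "conjugate n \<psi> = twist (\<lambda>u. \<psi> (xexp n u))"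

lemma mcoeff_conjugate [simp]: "mcoeff (conjugate n \<psi> h) u = \<psi> (xexp n u) * mcoeff h u"
  by (simp add: conjugate_def)

lemma conjugate_one [simp]: "conjugate n (\<lambda>_. 1) h = h"
  by (simp add: mfps_eq_iff)

lemma conjugate_conjugate: "conjugate n \<psi> (conjugate n \<psi>' h) = conjugate n (\<lambda>w. \<psi> w * \<psi>' w) h"
  by (simp add: mfps_eq_iff)

lemma char_group_xexp_add:
  assumes "n > 0" "\<psi> \<in> char_group n H"
  shows "\<psi> (xexp n (a + b)) = \<psi> (xexp n a) * \<psi> (xexp n b)"
  unfolding xexp_add
  by (rule character_on_add [OF char_groupD(1) [OF assms(2)]]) (simp_all add: xexp_in_frac assms(1))

lemma conjugate_hom:
  assumes "n > 0" "\<psi> \<in> char_group n H"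
  shows "idom_hom (conjugate n \<psi>)"
proof -
  interpret comm_ring_hom "conjugate n \<psi>"
    unfolding conjugate_def
    by (rule comm_ring_hom_twist)
       (simp_all add: char_group_xexp_add [OF assms] character_on_0 [OF char_groupD(1) [OF assms(2)] add_subgroup_frac_lattice])
  show ?thesis by unfold_locales
qed

lemma conjugate_ramify:
  assumes n: "n > 0" and \<psi>: "\<psi> \<in> char_group n int_lattice"
  shows "conjugate n \<psi> (ramify n h) = ramify n h"
proof (rule mfps_eqI)
  fix u
  show "mcoeff (conjugate n \<psi> (ramify n h)) u = mcoeff (ramify n h) u"
  proof (cases "u \<in> range ((*s) n)")
    case True
    then have "xexp n u \<in> int_lattice" using n by (auto simp: xexp_scale int_lattice_def)
    then show ?thesis using char_groupD(2) [OF \<psi>] by simp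
  qed (simp add: mcoeff_ramify_not_scale)
qed

text \<open>A separating character multiplies the coefficient at a non-integral exponent by a number
  other than 1, so invariance makes this coefficient vanish.\<close>

lemma conjugate_invariant_ramified:
  fixes h :: "(complex, 'd::finite) mfps"
  assumes n: "n > 0" and inv: "\<And>\<psi>. \<psi> \<in> char_group n int_lattice \<Longrightarrow> conjugate n \<psi> h = h"
  shows "h \<in> range (ramify n)"
proof -
  have "h = ramify n (Mfps (\<lambda>u. mcoeff h (n *s u)))"
  proof (rule ramify_eqI [OF n])
    fix u :: "nat ^ 'd" assume "u \<notin> range ((*s) n)"
    then have "xexp n u \<notin> int_lattice" using xexp_int_lattice [OF n] by blast
    then obtain \<psi> where \<psi>: "\<psi> \<in> char_group n int_lattice" "\<psi> (xexp n u) \<noteq> 1"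
      using char_group_separates [OF n xexp_in_frac [OF n]] by blast
    have "\<psi> (xexp n u) * mcoeff h u = mcoeff h u"
      using arg_cong [OF inv [OF \<psi>(1)], of "\<lambda>h. mcoeff h u"] by simp
    then show "mcoeff h u = 0" using \<psi>(2) by simp
  qed simp
  then show ?thesis by blast
qed

lemma lead_exp_conjugate:
  assumes "\<psi> \<in> char_group n H"
  shows "lead_exp (conjugate n \<psi> h) m \<longleftrightarrow> lead_exp h m"
  using char_group_nz [OF assms] by (simp add: lead_exp_def)

definition conjugates :: "nat \<Rightarrow> (complex, 'd::finite) mfps \<Rightarrow> (complex, 'd) mfps set" where
  "conjugates n h = (\<lambda>\<psi>. conjugate n \<psi> h) ` char_group n int_lattice"

lemma finite_conjugates: "n > 0 \<Longrightarrow> finite (conjugates n h)"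
  by (simp add: conjugates_def finite_char_group)

lemma self_in_conjugates: "h \<in> conjugates n h"
  unfolding conjugates_def by (rule image_eqI [OF _ char_group_one]) simp

lemma conjugate_image_conjugates:
  assumes \<psi>: "\<psi> \<in> char_group n int_lattice"
  shows "conjugate n \<psi> ` conjugates n h = conjugates n h" "inj (conjugate n \<psi>)"
proof -
  show inj: "inj (conjugate n \<psi>)"
    by (rule injI) (use char_group_nz [OF \<psi>] in \<open>auto simp: mfps_eq_iff\<close>)
  show "conjugate n \<psi> ` conjugates n h = conjugates n h"
  proof
    show "conjugate n \<psi> ` conjugates n h \<subseteq> conjugates n h"
      by (auto simp: conjugates_def conjugate_conjugate intro!: imageI char_group_mult \<psi>)
    show "conjugates n h \<subseteq> conjugate n \<psi> ` conjugates n h"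
    proof
      fix x assume "x \<in> conjugates n h"
      then obtain \<psi>' where \<psi>': "\<psi>' \<in> char_group n int_lattice" "x = conjugate n \<psi>' h"
        by (auto simp: conjugates_def)
      have "x = conjugate n \<psi> (conjugate n (\<lambda>w. \<psi>' w / \<psi> w) h)"
        using char_group_nz [OF \<psi>] by (simp add: \<psi>'(2) conjugate_conjugate)
      moreover have "conjugate n (\<lambda>w. \<psi>' w / \<psi> w) h \<in> conjugates n h"
        unfolding conjugates_def by (rule imageI) (rule char_group_divide [OF \<psi>'(1) \<psi>])
      ultimately show "x \<in> conjugate n \<psi> ` conjugates n h" by blast
    qed
  qed
qed

text \<open>The group permutes the conjugates, so the coefficients of the product are invariant and
  come from C[[x]]. The conjugates form a set: each occurs once, whatever its stabilizer.\<close>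

lemma conjugates_poly:
  assumes n: "n > 0"
  shows "\<exists>F. map_poly (ramify n) F = (\<Prod>\<tau>\<in>conjugates n h. [:- \<tau>, 1:]) \<and>
    lead_coeff F = 1 \<and> degree F = card (conjugates n h)"
proof -
  define P where "P = (\<Prod>\<tau>\<in>conjugates n h. [:- \<tau>, 1:])"
  interpret R: inj_idom_hom "ramify n :: (complex, 'a) mfps \<Rightarrow> _" by (rule inj_idom_hom_ramify [OF n])
  interpret RP: map_poly_inj_idom_hom "ramify n :: (complex, 'a) mfps \<Rightarrow> _" ..
  have "coeff P k \<in> range (ramify n)" for k
  proof (rule conjugate_invariant_ramified [OF n])
    fix \<psi> :: "real ^ 'a \<Rightarrow> complex" assume \<psi>: "\<psi> \<in> char_group n int_lattice"
    interpret C: idom_hom "conjugate n \<psi>" by (rule conjugate_hom [OF n \<psi>])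
    interpret CP: map_poly_idom_hom "conjugate n \<psi>" ..
    have "map_poly (conjugate n \<psi>) P = (\<Prod>\<tau>\<in>conjugates n h. [:- conjugate n \<psi> \<tau>, 1:])"
      unfolding P_def CP.hom_prod by (simp add: C.hom_uminus)
    also have "\<dots> = (\<Prod>\<tau>\<in>conjugate n \<psi> ` conjugates n h. [:- \<tau>, 1:])"
      by (subst prod.reindex) (use conjugate_image_conjugates(2) [OF \<psi>] in \<open>auto intro: inj_on_subset\<close>)
    also have "\<dots> = P" by (simp add: conjugate_image_conjugates(1) [OF \<psi>] P_def)
    finally have "coeff (map_poly (conjugate n \<psi>) P) k = coeff P k" by simp
    then show "conjugate n \<psi> (coeff P k) = coeff P k" by simp
  qed
  then have inv: "ramify n (inv_into UNIV (ramify n) (coeff P k)) = coeff P k" for k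
    by (rule f_inv_into_f)
  define F where "F = map_poly (inv_into UNIV (ramify n)) P"
  \<comment> \<open>Needed for \<open>coeff_map_poly\<close>: the coefficientwise inverse must send
    0 to 0.\<close>
  have "inv_into UNIV (ramify n) 0 = (0 :: (complex, 'a) mfps)"
    using R.injectivity inv_f_f [of "ramify n" 0] by (metis R.hom_zero injI)
  then have F: "map_poly (ramify n) F = P"
    by (intro poly_eqI) (simp add: F_def coeff_map_poly inv)
  have "ramify n (lead_coeff F) = lead_coeff P"
    by (simp add: F [symmetric])
  also have "\<dots> = ramify n 1"
    unfolding P_def monic_prod_linear(1) by simp
  finally have "lead_coeff F = 1" by (rule R.injectivity)
  moreover have "degree F = card (conjugates n h)"
    unfolding monic_prod_linear(2) [symmetric] P_def [symmetric] by (simp add: F [symmetric])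
  ultimately show ?thesis
    using F by (intro exI [of _ F]) (simp only: P_def)
qed

lemma sorted_wrt_less_chain:
  fixes E :: "'a::order set"
  assumes "finite E" "\<And>a b. a \<in> E \<Longrightarrow> b \<in> E \<Longrightarrow> a \<le> b \<or> b \<le> a"
  shows "\<exists>xs. sorted_wrt (<) xs \<and> set xs = E"
  using assms
proof (induction "card E" arbitrary: E)
  case 0
  then show ?case by (intro exI [of _ "[]"]) simp
next
  case (Suc k)
  then have "E \<noteq> {}" by auto
  then obtain m where m: "m \<in> E" "\<And>b. b \<in> E \<Longrightarrow> m \<le> b \<Longrightarrow> m = b"
    using finite_has_maximal [OF Suc.prems(1)] by blast
  have "k = card (E - {m})" using Suc.hyps(2) m(1) Suc.prems(1) by simp
  then obtain xs where xs: "sorted_wrt (<) xs" "set xs = E - {m}"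
    using Suc.hyps(1) [of "E - {m}"] Suc.prems by auto
  have "a < m" if "a \<in> E - {m}" for a
    using m(2) [of a] Suc.prems(2) [of a m] m(1) that by (auto simp: less_le)
  then have "sorted_wrt (<) (xs @ [m]) \<and> set (xs @ [m]) = E"
    using xs m(1) by (auto simp: sorted_wrt_append)
  then show ?case ..
qed

lemma sorted_wrt_less_unique:
  fixes xs ys :: "'a::order list"
  assumes "sorted_wrt (<) xs" "sorted_wrt (<) ys" "set xs = set ys"
  shows "xs = ys"
  using assms
proof (induction xs arbitrary: ys)
  case (Cons x xs)
  then obtain y ys' where ys: "ys = y # ys'" by (cases ys) auto
  have "x \<in> set ys" "y \<in> set (x # xs)" using Cons.prems(3) ys by auto
  then have "x = y" using Cons.prems ys by force
  moreover have "x \<notin> set xs" "y \<notin> set ys'" using Cons.prems ys by auto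
  ultimately have "set xs = set ys'" using Cons.prems(3) ys by auto
  then show ?case using Cons ys \<open>x = y\<close> by simp
qed simp

text \<open>If \<open>a\<close> and \<open>b\<close> were incomparable, both would survive in the
  difference, whose leading exponent \<open>c\<close> would lie below both. But \<open>c\<close> is
  an exponent of \<open>x\<close> or of \<open>y\<close>, hence above \<open>a\<close> or above
  \<open>b\<close>.\<close>

lemma lead_exp_diff_comparable:
  assumes "lead_exp x a" "lead_exp y b" "x = y \<or> (\<exists>c. lead_exp (x - y) c)"
  shows "a \<le> b \<or> b \<le> a"
proof (rule ccontr)
  assume *: "\<not> ?thesis"
  then have "mcoeff y a = 0" "mcoeff x b = 0" using assms(1,2) by (auto simp: lead_exp_def)
  then have ne: "mcoeff (x - y) a \<noteq> 0" "mcoeff (x - y) b \<noteq> 0" using assms(1,2) by (auto simp: lead_exp_def)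
  then have "x \<noteq> y" by auto
  then obtain c where c: "lead_exp (x - y) c" using assms(3) by blast
  then have "c \<le> a" "c \<le> b" using ne by (auto simp: lead_exp_def)
  moreover have "mcoeff x c \<noteq> 0 \<or> mcoeff y c \<noteq> 0" using c by (auto simp: lead_exp_def)
  then have "a \<le> c \<or> b \<le> c" using assms(1,2) by (auto simp: lead_exp_def)
  ultimately show False using * by (meson order_trans)
qed

section \<open>Roots of the polynomial and the list of characteristic exponents\<close>

locale quasi_ordinary_branch =
  fixes f :: "(complex, 'd::finite) mfps poly" and \<zeta> :: "(complex, 'd) mfps"
  assumes irr: "irreducible f" and qo: "quasi_ordinary f" and root: "\<zeta> \<in> qo_roots f"
begin

abbreviation "n \<equiv> degree f"
abbreviation "G \<equiv> char_group n (int_lattice :: (real ^ 'd) set)"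
abbreviation "cj \<equiv> conjugate n"

lemma monic: "lead_coeff f = 1"
  using qo by (simp add: quasi_ordinary_def weierstrass_poly_def)

lemma n_pos: "n > 0"
proof (rule ccontr)
  assume "\<not> ?thesis"
  then have "degree f = 0" by simp
  then obtain c where "f = [:c:]" by (rule degree_eq_zeroE)
  then have "f = 1" using monic by (simp add: one_pCons)
  then show False using irr by simp
qed

sublocale ram: inj_idom_hom "ramify n :: (complex, 'd) mfps \<Rightarrow> _"
  by (rule inj_idom_hom_ramify [OF n_pos])

sublocale ramp: map_poly_inj_idom_hom "ramify n :: (complex, 'd) mfps \<Rightarrow> _" ..

lemma root_poly: "poly (map_poly (ramify n) f) \<zeta> = 0"
  using root by (simp add: qo_roots_def eval_ramified_def)

lemma poly_conj_root:
  assumes \<psi>: "\<psi> \<in> G" and "poly (map_poly (ramify n) p) h = 0"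
  shows "poly (map_poly (ramify n) p) (cj \<psi> h) = 0"
proof -
  interpret C: idom_hom "cj \<psi>" by (rule conjugate_hom [OF n_pos \<psi>])
  have "map_poly (cj \<psi>) (map_poly (ramify n) p) = map_poly (ramify n) p"
    by (rule poly_eqI) (simp add: conjugate_ramify [OF n_pos \<psi>])
  then show ?thesis using assms(2) C.poly_map_poly [of "map_poly (ramify n) p" h] C.hom_zero by metis
qed

text \<open>The product over the conjugates descends to a monic \<open>F\<close> over C[[x]] and
  divides the image of \<open>f\<close>. The image of the remainder of \<open>f\<close> by
  \<open>F\<close> is still divisible by it but has smaller degree, so it vanishes, and
  irreducibility forces \<open>f = F\<close>.\<close>

lemma splitting:
  "map_poly (ramify n) f = (\<Prod>\<tau>\<in>conjugates n \<zeta>. [:- \<tau>, 1:])" "n = card (conjugates n \<zeta>)"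
proof -
  let ?P = "\<Prod>\<tau>\<in>conjugates n \<zeta>. [:- \<tau>, 1:]"
  obtain F where F: "map_poly (ramify n) F = ?P" "lead_coeff F = 1" "degree F = card (conjugates n \<zeta>)"
    using conjugates_poly [OF n_pos] by blast
  have dvd: "?P dvd map_poly (ramify n) f"
    by (rule prod_linear_dvd [OF finite_conjugates [OF n_pos]])
       (auto simp: conjugates_def intro: poly_conj_root root_poly)
  have F0: "F \<noteq> 0" using F(2) by auto
  \<comment> \<open>Since \<open>F\<close> is monic, pseudo-division is division: the power of the
    leading coefficient is 1.\<close>
  obtain q r where qr: "pseudo_divmod f F = (q, r)" by fastforce
  have f_eq: "f = F * q + r" and r: "r = 0 \<or> degree r < degree F"
    using pseudo_divmod [OF F0 qr] F(2) by simp_all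
  have "map_poly (ramify n) f = ?P * map_poly (ramify n) q + map_poly (ramify n) r"
    by (subst f_eq) (simp add: F(1) hom_distribs)
  with dvd have "?P dvd map_poly (ramify n) r"
    by (metis dvd_add_right_iff dvd_triv_left)
  then have "r \<noteq> 0 \<Longrightarrow> degree F \<le> degree r"
    using dvd_imp_degree_le [of ?P "map_poly (ramify n) r"] F(3) by (simp add: monic_prod_linear)
  then have "r = 0" using r by (cases "r = 0") auto
  then have f_eq: "f = F * q" using f_eq by simp
  have "card (conjugates n \<zeta>) > 0"
    using finite_conjugates [OF n_pos] self_in_conjugates by (auto simp: card_gt_0_iff)
  then have "\<not> F dvd 1"
    using F(3) dvd_imp_degree_le [of F 1] by auto
  then have "q dvd 1" using irreducibleD [OF irr f_eq] by blast
  then have "degree q = 0" using dvd_imp_degree_le [of q 1] by simp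
  then obtain c where c: "q = [:c:]" by (rule degree_eq_zeroE)
  have "lead_coeff f = lead_coeff F * lead_coeff q" unfolding f_eq by (rule lead_coeff_mult)
  then have "c = 1" using c F(2) monic by simp
  then have "f = F" using f_eq c by simp
  with F(1,3) show "map_poly (ramify n) f = ?P" "n = card (conjugates n \<zeta>)" by metis+
qed

lemma qo_roots_eq: "qo_roots f = conjugates n \<zeta>"
  by (auto simp: qo_roots_def eval_ramified_def splitting(1) poly_prod finite_conjugates [OF n_pos])

text \<open>With the image of \<open>f\<close> written as (y - \<tau>)(y - \<tau>')h, its derivative
  at \<tau> is (\<tau> - \<tau>')h(\<tau>), which divides the resultant. Divisors of a monomial
  times a unit are again of that kind.\<close>

lemma root_difference:
  assumes \<tau>: "\<tau> \<in> conjugates n \<zeta>" "\<tau>' \<in> conjugates n \<zeta>" "\<tau> \<noteq> \<tau>'"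
  shows "\<exists>m. monomial_times_unit m (\<tau> - \<tau>')"
proof -
  let ?P = "map_poly (ramify n) f"
  obtain m w where mw: "w dvd 1" "discriminant f = mmonom m * w"
    using qo by (auto simp: quasi_ordinary_def monomial_times_unit_def)
  have "poly ?P \<tau> = 0" "poly ?P \<tau>' = 0"
    using \<tau> qo_roots_eq by (auto simp: qo_roots_def eval_ramified_def)
  then have "[:- \<tau>, 1:] dvd ?P" by (simp only: poly_eq_0_iff_dvd)
  then obtain g where g: "?P = [:- \<tau>, 1:] * g" by (rule dvdE)
  have "poly g \<tau>' = 0" using \<open>poly ?P \<tau>' = 0\<close> \<tau>(3) by (simp add: g)
  then have "[:- \<tau>', 1:] dvd g" by (simp only: poly_eq_0_iff_dvd)
  then obtain h where h: "g = [:- \<tau>', 1:] * h" by (rule dvdE)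
  have "poly (pderiv ?P) \<tau> = poly g \<tau>" unfolding g pderiv_mult by (simp add: pderiv_pCons)
  also have "\<dots> = (\<tau> - \<tau>') * poly h \<tau>" by (simp add: h algebra_simps)
  finally have "\<tau> - \<tau>' dvd poly (pderiv ?P) \<tau>" by simp
  also have "\<dots> dvd resultant ?P (pderiv ?P)"
    by (rule poly_dvd_resultant [OF \<open>poly ?P \<tau> = 0\<close>]) (simp add: n_pos)
  also have "resultant ?P (pderiv ?P) = ramify n (resultant f (pderiv f))"
    by (simp add: ram.map_poly_pderiv [symmetric] ram.resultant_hom)
  also have "\<dots> dvd ramify n (discriminant f)"
    by (simp add: discriminant_def hom_distribs)
  also have "\<dots> = mmonom (n *s m) * ramify n w"
    by (simp add: mw(2) ramify_mmonom [OF n_pos] hom_distribs)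
  finally obtain h' where h': "(\<tau> - \<tau>') * h' = mmonom (n *s m) * ramify n w"
    by (metis dvdE)
  moreover have "ramify n w dvd 1" using mw(1) ram.hom_dvd_1 by blast
  ultimately show ?thesis by (rule dvd_monomial_times_unit)
qed

text \<open>Otherwise every conjugate has a nonzero constant term, and so has their product, which
  up to sign is the constant coefficient of the Weierstrass polynomial.\<close>

lemma root_constant_term: "mcoeff \<zeta> 0 = 0"
proof (rule ccontr)
  assume *: "\<not> ?thesis"
  have "lead_exp (- \<tau>) 0" if "\<tau> \<in> conjugates n \<zeta>" for \<tau>
    using that * by (auto simp: conjugates_def lead_exp_def char_group_nz)
  then have "lead_exp (\<Prod>\<tau>\<in>conjugates n \<zeta>. - \<tau>) (\<Sum>\<tau>\<in>conjugates n \<zeta>. 0)"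
    by (rule lead_exp_prod)
  moreover have "(\<Prod>\<tau>\<in>conjugates n \<zeta>. - \<tau>) = poly (map_poly (ramify n) f) 0"
    by (simp add: splitting(1) poly_prod)
  also have "\<dots> = ramify n (coeff f 0)" by (simp add: poly_0_coeff_0)
  finally have "mcoeff (ramify n (coeff f 0)) 0 \<noteq> 0" by (simp add: lead_exp_def)
  moreover have "mcoeff (ramify n (coeff f 0)) (n *s 0) = mcoeff (coeff f 0) 0"
    by (rule mcoeff_ramify_scale [OF n_pos])
  moreover have "(n *s 0 :: nat ^ 'd) = 0" by (simp add: fvec_eq vector_scalar_mult_def)
  ultimately have "mcoeff (coeff f 0) 0 \<noteq> 0" by simp
  then show False using qo n_pos by (auto simp: quasi_ordinary_def weierstrass_poly_def)
qed

text \<open>Exponents of the variables \<open>z\<close>, that is, \<open>n\<close> times the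
  characteristic exponents, read off with one of the two roots fixed as
  \<open>\<zeta>\<close>.\<close>

definition exps :: "(nat ^ 'd) set" where
  "exps = {m. \<exists>\<psi>\<in>G. lead_exp (cj \<psi> \<zeta> - \<zeta>) m}"

lemma conj_diff_lead_exp:
  assumes \<psi>: "\<psi> \<in> G" "\<psi>' \<in> G" "cj \<psi> \<zeta> \<noteq> cj \<psi>' \<zeta>"
  shows "\<exists>m. lead_exp (cj \<psi> \<zeta> - cj \<psi>' \<zeta>) m"
  using root_difference [of "cj \<psi> \<zeta>" "cj \<psi>' \<zeta>"] assms monomial_times_unit_lead_exp
  by (auto simp: conjugates_def)

text \<open>The difference of the conjugates by \<open>\<psi>\<close> and \<open>\<psi>'\<close> is
  the \<open>\<psi>'\<close>-conjugate of a difference with \<open>\<zeta>\<close>, namely for the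
  quotient character, and conjugation preserves leading exponents.\<close>

lemma char_exponent_set_eq: "char_exponent_set f = xexp n ` exps"
proof
  show "char_exponent_set f \<subseteq> xexp n ` exps"
  proof
    fix x assume "x \<in> char_exponent_set f"
    then obtain m \<psi> \<psi>' where m: "x = xexp n m" "\<psi> \<in> G" "\<psi>' \<in> G"
        "lead_exp (cj \<psi> \<zeta> - cj \<psi>' \<zeta>) m"
      unfolding char_exponent_set_def qo_roots_eq conjugates_def
      using monomial_times_unit_lead_exp by blast
    define \<phi> where "\<phi> = (\<lambda>w. \<psi> w / \<psi>' w)"
    have \<phi>: "\<phi> \<in> G" unfolding \<phi>_def by (rule char_group_divide [OF m(2,3)])
    have "cj \<psi> \<zeta> - cj \<psi>' \<zeta> = cj \<psi>' (cj \<phi> \<zeta> - \<zeta>)"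
      using char_group_nz [OF m(3)] by (simp add: mfps_eq_iff \<phi>_def algebra_simps)
    then have "lead_exp (cj \<phi> \<zeta> - \<zeta>) m" using m(4) lead_exp_conjugate [OF m(3)] by simp
    then show "x \<in> xexp n ` exps" using m(1) \<phi> by (auto simp: exps_def)
  qed
  show "xexp n ` exps \<subseteq> char_exponent_set f"
  proof
    fix x assume "x \<in> xexp n ` exps"
    then obtain m \<psi> where m: "x = xexp n m" "\<psi> \<in> G" "lead_exp (cj \<psi> \<zeta> - \<zeta>) m"
      by (auto simp: exps_def)
    then have ne: "cj \<psi> \<zeta> \<noteq> \<zeta>" unfolding lead_exp_def by (metis diff_self mcoeff_simps(1))
    have mem: "cj \<psi> \<zeta> \<in> conjugates n \<zeta>" using m by (auto simp: conjugates_def)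
    obtain m' where m': "monomial_times_unit m' (cj \<psi> \<zeta> - \<zeta>)"
      using root_difference [OF mem self_in_conjugates ne] by blast
    then have "m' = m" using monomial_times_unit_lead_exp lead_exp_unique m(3) by blast
    then show "x \<in> char_exponent_set f"
      unfolding char_exponent_set_def qo_roots_eq using m(1) m' mem self_in_conjugates ne by blast
  qed
qed

lemma finite_exps: "finite exps"
proof -
  have "exps = (\<Union>\<psi>\<in>G. {m. lead_exp (cj \<psi> \<zeta> - \<zeta>) m})" by (auto simp: exps_def)
  moreover have "finite {m. lead_exp h m}" for h :: "(complex, 'd) mfps"
    by (metis finite.emptyI finite.insertI finite_subset insertCI lead_exp_unique mem_Collect_eq subsetI)
  ultimately show ?thesis by (simp only: finite_UN_I [OF finite_char_group [OF n_pos]])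
qed

text \<open>Subtracting two differences with the same \<open>\<zeta>\<close> leaves a difference of
  two roots, which is zero or has a leading exponent.\<close>

lemma exps_chain:
  assumes "a \<in> exps" "b \<in> exps"
  shows "a \<le> b \<or> b \<le> a"
proof -
  obtain \<psi> \<psi>' where \<psi>: "\<psi> \<in> G" "\<psi>' \<in> G" "lead_exp (cj \<psi> \<zeta> - \<zeta>) a" "lead_exp (cj \<psi>' \<zeta> - \<zeta>) b"
    using assms by (auto simp: exps_def)
  have "cj \<psi> \<zeta> - \<zeta> = cj \<psi>' \<zeta> - \<zeta> \<or> (\<exists>c. lead_exp ((cj \<psi> \<zeta> - \<zeta>) - (cj \<psi>' \<zeta> - \<zeta>)) c)"
    using conj_diff_lead_exp [OF \<psi>(1,2)] by auto
  then show ?thesis by (rule lead_exp_diff_comparable [OF \<psi>(3,4)])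
qed

definition ms :: "(nat ^ 'd) list" where
  "ms = (SOME ms. sorted_wrt (<) ms \<and> set ms = exps)"

lemma ms: "sorted_wrt (<) ms" "set ms = exps"
  using someI_ex [OF sorted_wrt_less_chain [OF finite_exps exps_chain]] by (simp_all add: ms_def)

lemma char_exponents_eq: "char_exponents f = map (xexp n) ms"
  unfolding char_exponents_def
proof (rule the_equality)
  show *: "sorted_wrt (<) (map (xexp n) ms) \<and> set (map (xexp n) ms) = char_exponent_set f"
    using ms by (simp add: sorted_wrt_map xexp_less_iff [OF n_pos] char_exponent_set_eq)
  fix ls assume "sorted_wrt (<) ls \<and> set ls = char_exponent_set f"
  with * show "ls = map (xexp n) ms" by (intro sorted_wrt_less_unique) auto
qed

lemma ms_less: "i < j \<Longrightarrow> j < length ms \<Longrightarrow> ms ! i < ms ! j"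
  using ms(1) by (simp add: sorted_wrt_nth_less)

lemma ms_attained:
  assumes "i < length ms"
  obtains \<psi> where "\<psi> \<in> G" "lead_exp (cj \<psi> \<zeta> - \<zeta>) (ms ! i)"
  using assms ms(2) nth_mem [of i ms] by (auto simp: exps_def)

lemma conj_neq_lead_exp:
  assumes \<psi>: "\<psi> \<in> G" "cj \<psi> \<zeta> \<noteq> \<zeta>"
  obtains i where "i < length ms" "lead_exp (cj \<psi> \<zeta> - \<zeta>) (ms ! i)"
proof -
  obtain m where m: "lead_exp (cj \<psi> \<zeta> - \<zeta>) m"
    using conj_diff_lead_exp [OF \<psi>(1) char_group_one] \<psi>(2) by auto
  then have "m \<in> set ms" using \<psi>(1) ms(2) by (auto simp: exps_def)
  then show thesis using that m by (auto simp: in_set_conv_nth)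
qed

lemma ms_nonzero:
  assumes "i < length ms"
  shows "ms ! i \<noteq> 0"
proof
  assume "ms ! i = 0"
  obtain \<psi> where "\<psi> \<in> G" "lead_exp (cj \<psi> \<zeta> - \<zeta>) (ms ! i)" using ms_attained [OF assms] .
  then show False using root_constant_term \<open>ms ! i = 0\<close> by (simp add: lead_exp_def)
qed

end

section \<open>Semi-roots\<close>

lemma xexp_sum: "xexp n (sum h A) = (\<Sum>x\<in>A. xexp n (h x))"
  by (induction A rule: infinite_finite_induct) (simp_all add: xexp_add)

lemma char_lattice_0: "char_lattice ls 0 = int_lattice"
  by (simp add: int_lattice_def)

lemma char_lattice_Suc: "char_lattice ls (Suc j) = adjoin (char_lattice ls j) (ls ! j)"
  by (simp add: adjoin_def)

lemmas [simp del] = char_lattice.simps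

lemma add_subgroup_char_lattice: "add_subgroup (char_lattice ls j)"
  by (induction j) (simp_all add: char_lattice_0 char_lattice_Suc add_subgroup_int_lattice add_subgroup_adjoin)

lemma char_lattice_mono: "i \<le> j \<Longrightarrow> char_lattice ls i \<subseteq> char_lattice ls j"
  by (rule lift_Suc_mono_le) (auto simp: char_lattice_Suc subset_adjoin)

lemma int_lattice_subset_char_lattice: "int_lattice \<subseteq> char_lattice ls j"
  using char_lattice_mono [of 0 j ls] by (simp add: char_lattice_0)

context quasi_ordinary_branch
begin

section \<open>The lattices and the characters trivial on them\<close>

abbreviation "ls \<equiv> map (xexp n) ms"
abbreviation "g \<equiv> length ms"
abbreviation "M \<equiv> char_lattice ls"
abbreviation "idx \<equiv> lattice_index ls"
abbreviation "G' j \<equiv> char_group n (M j)"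

lemma lattice_subset_frac: "j \<le> g \<Longrightarrow> M j \<subseteq> frac_lattice n"
proof (induction j)
  case 0
  then show ?case by (simp add: char_lattice_0 int_lattice_subset_frac)
next
  case (Suc j)
  then show ?case unfolding char_lattice_Suc
    by (intro adjoin_subset add_subgroup_frac_lattice) (auto simp: xexp_in_frac n_pos)
qed

text \<open>The number of cosets becomes an order, which can be tested by divisibility. Positions in
  \<open>ls\<close> start at 0, so \<open>ls ! j\<close> is \<lambda>_(j+1) and
  \<open>idx (Suc j)\<close> is n_(j+1).\<close>

lemma idx_order_mod:
  assumes j: "j < g"
  shows "order_mod (M j) (ls ! j) (idx (Suc j))"
proof -
  have "real n *\<^sub>R ls ! j \<in> int_lattice"
    using j n_pos by (simp add: int_lattice_def xexp_def)
  then have "real n *\<^sub>R ls ! j \<in> M j" using int_lattice_subset_char_lattice by blast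
  then obtain k where k: "order_mod (M j) (ls ! j) k"
    using order_mod_exists [OF add_subgroup_char_lattice n_pos] by blast
  then have "idx (Suc j) = k"
    using order_mod_card_quotient [OF add_subgroup_char_lattice k]
    by (simp add: lattice_index_def char_lattice_Suc)
  with k show ?thesis by simp
qed

lemma idx_pos: "j < g \<Longrightarrow> idx (Suc j) > 0"
  using idx_order_mod by (simp add: order_mod_def)

lemma G'_subset: "G' j \<subseteq> G"
  by (rule char_group_mono [OF int_lattice_subset_char_lattice])

lemma G'_Suc:
  assumes "j < g"
  shows "\<psi> \<in> G' (Suc j) \<longleftrightarrow> \<psi> \<in> G' j \<and> \<psi> (xexp n (ms ! j)) = 1"
  unfolding char_lattice_Suc
  using char_group_adjoin [OF add_subgroup_char_lattice lattice_subset_frac, of j "ls ! j"] assms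
  by (simp add: xexp_in_frac n_pos)

lemma G'_iff: "j \<le> g \<Longrightarrow> \<psi> \<in> G' j \<longleftrightarrow> \<psi> \<in> G \<and> (\<forall>i<j. \<psi> (xexp n (ms ! i)) = 1)"
  by (induction j) (auto simp: char_lattice_0 G'_Suc less_Suc_eq)

lemma finite_G': "finite (G' j)"
  using finite_subset [OF G'_subset finite_char_group [OF n_pos]] .

lemma card_G'_pos: "card (G' j) > 0"
  using char_group_one finite_G' by (auto simp: card_gt_0_iff)

lemma card_G'_Suc:
  assumes "j < g"
  shows "card (G' j) = idx (Suc j) * card (G' (Suc j))"
  unfolding char_lattice_Suc
  by (rule card_char_group_adjoin [OF add_subgroup_char_lattice int_lattice_subset_char_lattice
        lattice_subset_frac n_pos _ idx_order_mod]) (use assms in \<open>auto simp: xexp_in_frac n_pos\<close>)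

section \<open>Truncations of the root and their stabilizers\<close>

lemma mcoeff_ms: "i < g \<Longrightarrow> mcoeff \<zeta> (ms ! i) \<noteq> 0"
  by (rule ms_attained) (auto simp: lead_exp_def)

text \<open>The leading exponent of the conjugate minus \<open>\<zeta>\<close> is some
  \<open>ms ! k\<close> on which \<open>\<psi>\<close> is nontrivial. Triviality on
  \<open>M j\<close> gives \<open>j \<le> k\<close>, and every exponent moved by
  \<open>\<psi>\<close> lies above the leading one.\<close>

lemma conj_diff_support:
  assumes j: "j \<le> g" and \<psi>: "\<psi> \<in> G' j" and u: "mcoeff \<zeta> u \<noteq> 0" "\<psi> (xexp n u) \<noteq> 1"
  shows "j < g \<and> ms ! j \<le> u"
proof -
  have \<psi>G: "\<psi> \<in> G" using \<psi> G'_subset by blast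
  have ne: "mcoeff (cj \<psi> \<zeta> - \<zeta>) u \<noteq> 0" using u by simp
  then have "cj \<psi> \<zeta> \<noteq> \<zeta>" by (metis diff_self mcoeff_simps(1))
  then obtain k where k: "k < g" "lead_exp (cj \<psi> \<zeta> - \<zeta>) (ms ! k)"
    by (rule conj_neq_lead_exp [OF \<psi>G])
  then have "\<psi> (xexp n (ms ! k)) \<noteq> 1" by (auto simp: lead_exp_def)
  then have "j \<le> k" using \<psi> G'_iff [OF j] by (meson not_le)
  then have "ms ! j \<le> ms ! k" using ms_less [of j k] k(1) by (cases "j = k") auto
  moreover have "ms ! k \<le> u" using k(2) ne by (simp add: lead_exp_def)
  ultimately show ?thesis using \<open>j \<le> k\<close> k(1) by (auto intro: order_trans)
qed

text \<open>The cut is made in the partial order: exponents incomparable with \<open>ms ! j\<close>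
  are kept. At \<open>j = g\<close> nothing is removed, and the guard \<open>j < g\<close> protects
  the list access.\<close>

definition trunc :: "nat \<Rightarrow> (complex, 'd) mfps" where
  "trunc j = Mfps (\<lambda>u. if j < g \<and> ms ! j \<le> u then 0 else mcoeff \<zeta> u)"

lemma trunc_g: "trunc g = \<zeta>"
  by (simp add: trunc_def mfps_eq_iff)

text \<open>Exponents of \<open>\<zeta>\<close> moved by a character trivial on \<open>M j\<close>
  are cut off. Conversely, the first \<open>j\<close> characteristic exponents survive the cut with
  nonzero coefficients, so invariance forces triviality on them.\<close>

lemma conj_trunc_iff:
  assumes j: "j \<le> g" and \<psi>: "\<psi> \<in> G"
  shows "cj \<psi> (trunc j) = trunc j \<longleftrightarrow> \<psi> \<in> G' j"
proof
  assume "\<psi> \<in> G' j"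
  then show "cj \<psi> (trunc j) = trunc j"
    using conj_diff_support [OF j] by (fastforce simp: mfps_eq_iff trunc_def)
next
  assume eq: "cj \<psi> (trunc j) = trunc j"
  have "\<psi> (xexp n (ms ! i)) = 1" if i: "i < j" for i
  proof -
    have "\<not> (j < g \<and> ms ! j \<le> ms ! i)" using ms_less [OF i] by auto
    then have "mcoeff (trunc j) (ms ! i) = mcoeff \<zeta> (ms ! i)" by (auto simp: trunc_def)
    moreover have "mcoeff \<zeta> (ms ! i) \<noteq> 0" using mcoeff_ms i j by simp
    ultimately show ?thesis
      using arg_cong [OF eq, of "\<lambda>h. mcoeff h (ms ! i)"] by simp
  qed
  then show "\<psi> \<in> G' j" using G'_iff [OF j] \<psi> by simp
qed

text \<open>Sums over conjugates become sums over the whole group, where consecutive \<open>j\<close> can be compared.\<close>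

lemma sum_conjugates_trunc:
  fixes h :: "(complex, 'd) mfps \<Rightarrow> 'b::comm_monoid_add"
  assumes j: "j \<le> g"
  shows "(\<Sum>\<psi>\<in>G. h (cj \<psi> (trunc j))) = (\<Sum>\<tau>\<in>conjugates n (trunc j). \<Sum>_\<in>G' j. h \<tau>)"
proof -
  have "(\<Sum>\<psi>\<in>G. h (cj \<psi> (trunc j))) = (\<Sum>\<tau>\<in>conjugates n (trunc j).
      \<Sum>\<psi> | \<psi> \<in> G \<and> cj \<psi> (trunc j) = \<tau>. h (cj \<psi> (trunc j)))"
    unfolding conjugates_def by (rule sum.image_gen [OF finite_char_group [OF n_pos]])
  also have "\<dots> = (\<Sum>\<tau>\<in>conjugates n (trunc j). \<Sum>_\<in>G' j. h \<tau>)"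
  proof (rule sum.cong [OF refl])
    fix \<tau> assume "\<tau> \<in> conjugates n (trunc j)"
    then obtain \<psi>0 where \<psi>0: "\<psi>0 \<in> G" "\<tau> = cj \<psi>0 (trunc j)" by (auto simp: conjugates_def)
    have nz: "\<psi>0 w \<noteq> 0" for w by (rule char_group_nz [OF \<psi>0(1)])
    \<comment> \<open>The fibre over \<open>\<tau>\<close> is the coset of \<open>\<psi>0\<close>
      modulo the stabilizer \<open>G' j\<close>.\<close>
    show "(\<Sum>\<psi> | \<psi> \<in> G \<and> cj \<psi> (trunc j) = \<tau>. h (cj \<psi> (trunc j))) = (\<Sum>_\<in>G' j. h \<tau>)"
    proof (rule sum.reindex_bij_witness [where i = "\<lambda>\<psi> w. \<psi>0 w * \<psi> w" and j = "\<lambda>\<psi> w. \<psi> w / \<psi>0 w"])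
      fix \<psi> assume \<psi>: "\<psi> \<in> {\<psi> \<in> G. cj \<psi> (trunc j) = \<tau>}"
      show "(\<lambda>w. \<psi>0 w * (\<psi> w / \<psi>0 w)) = \<psi>" using nz by simp
      have "(\<lambda>w. \<psi> w / \<psi>0 w) \<in> G" by (rule char_group_divide) (use \<psi> \<psi>0 in auto)
      moreover have "cj (\<lambda>w. \<psi> w / \<psi>0 w) (trunc j) = trunc j"
      proof (rule mfps_eqI)
        fix u
        have "mcoeff (cj \<psi> (trunc j)) u = mcoeff (cj \<psi>0 (trunc j)) u" using \<psi> \<psi>0 by simp
        then show "mcoeff (cj (\<lambda>w. \<psi> w / \<psi>0 w) (trunc j)) u = mcoeff (trunc j) u"
          using nz by (simp add: field_simps)
      qed
      ultimately show "(\<lambda>w. \<psi> w / \<psi>0 w) \<in> G' j" using conj_trunc_iff [OF j] by blast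
      show "h \<tau> = h (cj \<psi> (trunc j))" using \<psi> by simp
    next
      fix \<psi> assume \<psi>: "\<psi> \<in> G' j"
      show "(\<lambda>w. \<psi>0 w * \<psi> w / \<psi>0 w) = \<psi>" using nz by simp
      have "\<psi> \<in> G" using \<psi> G'_subset by blast
      then have "(\<lambda>w. \<psi>0 w * \<psi> w) \<in> G" by (rule char_group_mult [OF \<psi>0(1)])
      moreover have "cj (\<lambda>w. \<psi>0 w * \<psi> w) (trunc j) = \<tau>"
        using conj_trunc_iff [OF j \<open>\<psi> \<in> G\<close>] \<psi> by (simp add: conjugate_conjugate [symmetric] \<psi>0(2))
      ultimately show "(\<lambda>w. \<psi>0 w * \<psi> w) \<in> {\<psi> \<in> G. cj \<psi> (trunc j) = \<tau>}" by simp
    qed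
  qed
  finally show ?thesis .
qed

definition deg :: "nat \<Rightarrow> nat" where
  "deg j = card (conjugates n (trunc j))"

text \<open>Orbit and stabilizer, obtained by summing the constant 1.\<close>

lemma deg_mult: "j \<le> g \<Longrightarrow> card G = deg j * card (G' j)"
  using sum_conjugates_trunc [of j "\<lambda>_. 1 :: nat"] by (simp add: deg_def)

lemma deg_0: "deg 0 = 1"
  using deg_mult [of 0] card_G'_pos [of 0] by (simp add: char_lattice_0)

lemma deg_Suc:
  assumes "j < g"
  shows "deg (Suc j) = idx (Suc j) * deg j"
proof -
  have "deg (Suc j) * card (G' (Suc j)) = idx (Suc j) * deg j * card (G' (Suc j))"
    using deg_mult [of j] deg_mult [of "Suc j"] card_G'_Suc [OF assms] assms
    by (simp add: ac_simps)
  then show ?thesis using card_G'_pos [of "Suc j"] by simp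
qed

lemma deg_pos: "j \<le> g \<Longrightarrow> deg j > 0"
  by (induction j) (auto simp: deg_0 deg_Suc idx_pos)

lemma deg_g: "deg g = n"
  using splitting(2) by (simp add: deg_def trunc_g)

text \<open>The exponent of \<open>\<zeta> - \<psi>\<zeta>\<^sub>j\<close>, see \<open>lead_exp_diff\<close>.\<close>

primrec diff_exp :: "nat \<Rightarrow> (real ^ 'd \<Rightarrow> complex) \<Rightarrow> nat ^ 'd" where
  "diff_exp 0 \<psi> = ms ! 0"
| "diff_exp (Suc j) \<psi> = (if \<psi> \<in> G' (Suc j) then ms ! Suc j else diff_exp j \<psi>)"

lemma diff_exp_trivial: "\<psi> \<in> G' j \<Longrightarrow> diff_exp j \<psi> = ms ! j"
  by (cases j) auto

lemma diff_exp_nontrivial: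
  assumes "j \<le> g" "\<psi> \<in> G" "\<psi> \<notin> G' j"
  shows "\<exists>i<j. \<psi> \<in> G' i \<and> \<psi> \<notin> G' (Suc i) \<and> diff_exp j \<psi> = ms ! i"
  using assms
proof (induction j)
  case 0
  then show ?case by (simp add: char_lattice_0)
next
  case (Suc j)
  show ?case
  proof (cases "\<psi> \<in> G' j")
    case True
    then show ?thesis using Suc.prems diff_exp_trivial [OF True] by (intro exI [of _ j]) simp
  next
    case False
    then obtain i where "i < j" "\<psi> \<in> G' i" "\<psi> \<notin> G' (Suc i)" "diff_exp j \<psi> = ms ! i"
      using Suc by auto
    then show ?thesis using Suc.prems by (intro exI [of _ i]) auto
  qed
qed

text \<open>If \<open>\<psi>\<close> fixes the truncation, the removed part of
  \<open>\<zeta>\<close> remains, and it starts at \<open>ms ! j\<close>. Otherwise let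
  \<open>ms ! i\<close> be the first exponent moved: retained exponents that are moved lie above it
  by \<open>conj_diff_support\<close>, removed ones lie above \<open>ms ! j\<close>, which is
  larger.\<close>

lemma lead_exp_diff:
  assumes j: "j < g" and \<psi>: "\<psi> \<in> G"
  shows "lead_exp (\<zeta> - cj \<psi> (trunc j)) (diff_exp j \<psi>)"
proof (cases "\<psi> \<in> G' j")
  case True
  then have "cj \<psi> (trunc j) = trunc j" using conj_trunc_iff j \<psi> by simp
  then show ?thesis
    using mcoeff_ms [OF j] j by (auto simp: diff_exp_trivial [OF True] lead_exp_def trunc_def)
next
  case False
  then obtain i where i: "i < j" "\<psi> \<in> G' i" "\<psi> \<notin> G' (Suc i)" "diff_exp j \<psi> = ms ! i"
    using diff_exp_nontrivial j \<psi> by (metis less_imp_le)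
  have ig: "i < g" using i j by simp
  have nontriv: "\<psi> (xexp n (ms ! i)) \<noteq> 1" using i(2,3) G'_Suc [OF ig] by blast
  have ij: "ms ! i < ms ! j" by (rule ms_less [OF i(1) j])
  then have "\<not> ms ! j \<le> ms ! i" by auto
  then have "mcoeff (\<zeta> - cj \<psi> (trunc j)) (ms ! i) \<noteq> 0"
    using nontriv mcoeff_ms [OF ig] by (simp add: trunc_def)
  moreover have "ms ! i \<le> u" if u: "mcoeff (\<zeta> - cj \<psi> (trunc j)) u \<noteq> 0" for u
  proof (cases "ms ! j \<le> u")
    case True
    then show ?thesis using ij by simp
  next
    case False
    then have "mcoeff \<zeta> u \<noteq> 0" "\<psi> (xexp n u) \<noteq> 1" using u by (auto simp: trunc_def)
    then show ?thesis using conj_diff_support [OF _ i(2)] ig by simp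
  qed
  ultimately show ?thesis by (simp add: lead_exp_def i(4))
qed

text \<open>The product runs over conjugates, whereas \<open>diff_exp\<close> depends on a character
  producing the conjugate; this reads the exponent off the series itself.\<close>

definition the_lead :: "(complex, 'd) mfps \<Rightarrow> nat ^ 'd" where
  "the_lead h = (THE m. lead_exp h m)"

lemma the_lead: "lead_exp h m \<Longrightarrow> the_lead h = m"
  unfolding the_lead_def by (rule the_equality) (auto intro: lead_exp_unique)

definition semiroot_exp :: "nat \<Rightarrow> nat ^ 'd" where
  "semiroot_exp j = (\<Sum>\<tau>\<in>conjugates n (trunc j). the_lead (\<zeta> - \<tau>))"

lemma lead_exp_semiroot:
  assumes "j < g"
  shows "lead_exp (\<Prod>\<tau>\<in>conjugates n (trunc j). \<zeta> - \<tau>) (semiroot_exp j)"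
  unfolding semiroot_exp_def
proof (rule lead_exp_prod)
  fix \<tau> assume "\<tau> \<in> conjugates n (trunc j)"
  then obtain \<psi> where "\<psi> \<in> G" "\<tau> = cj \<psi> (trunc j)" by (auto simp: conjugates_def)
  then show "lead_exp (\<zeta> - \<tau>) (the_lead (\<zeta> - \<tau>))" using lead_exp_diff [OF assms] the_lead by metis
qed

text \<open>Each conjugate arises from as many characters as \<open>G' j\<close> has elements, which
  explains the factor.\<close>

lemma semiroot_exp_sum:
  assumes j: "j < g"
  shows "real (card (G' j)) *\<^sub>R xexp n (semiroot_exp j) = (\<Sum>\<psi>\<in>G. xexp n (diff_exp j \<psi>))"
proof -
  have "(\<Sum>\<psi>\<in>G. xexp n (diff_exp j \<psi>)) = (\<Sum>\<psi>\<in>G. xexp n (the_lead (\<zeta> - cj \<psi> (trunc j))))"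
    using the_lead [OF lead_exp_diff [OF j]] by simp
  also have "\<dots> = (\<Sum>\<tau>\<in>conjugates n (trunc j). \<Sum>_\<in>G' j. xexp n (the_lead (\<zeta> - \<tau>)))"
    using j by (intro sum_conjugates_trunc) simp
  also have "\<dots> = real (card (G' j)) *\<^sub>R xexp n (semiroot_exp j)"
    by (simp add: semiroot_exp_def xexp_sum sum_constant_scaleR scaleR_sum_right del: sum_constant)
  finally show ?thesis by simp
qed

text \<open>The exponent changes only for characters trivial on \<open>M (Suc j)\<close>, namely
  from \<open>ms ! j\<close> to \<open>ms ! Suc j\<close>.\<close>

lemma diff_exp_sum_Suc:
  assumes j: "Suc j < g"
  shows "(\<Sum>\<psi>\<in>G. xexp n (diff_exp (Suc j) \<psi>)) =
    (\<Sum>\<psi>\<in>G. xexp n (diff_exp j \<psi>)) + real (card (G' (Suc j))) *\<^sub>R (ls ! Suc j - ls ! j)"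
proof -
  have "xexp n (diff_exp (Suc j) \<psi>) = xexp n (diff_exp j \<psi>) +
      (if \<psi> \<in> G' (Suc j) then ls ! Suc j - ls ! j else 0)" for \<psi>
  proof (cases "\<psi> \<in> G' (Suc j)")
    case True
    then have "\<psi> \<in> G' j" using G'_Suc j by simp
    with True show ?thesis using j diff_exp_trivial [of \<psi> j] by simp
  qed simp
  moreover have "(\<Sum>\<psi>\<in>G. if \<psi> \<in> G' (Suc j) then ls ! Suc j - ls ! j else 0) =
      (\<Sum>\<psi>\<in>G' (Suc j). ls ! Suc j - ls ! j)"
    using G'_subset [of "Suc j"]
    by (subst sum.inter_restrict [OF finite_char_group [OF n_pos], symmetric]) (simp add: Int_absorb1)
  ultimately show ?thesis by (simp add: sum.distrib sum_constant_scaleR del: diff_exp.simps sum_constant)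
qed

text \<open>The order of \<open>G' j\<close> is \<open>idx (Suc j)\<close> times that of
  \<open>G' (Suc j)\<close>; cancelling the latter turns \<open>diff_exp_sum_Suc\<close> into the
  recursion of \<open>gam\<close>.\<close>

lemma xexp_semiroot_exp: "j < g \<Longrightarrow> xexp n (semiroot_exp j) = gam ls (Suc j)"
proof (induction j)
  case 0
  have "real (card (G' 0)) *\<^sub>R xexp n (semiroot_exp 0) = real (card (G' 0)) *\<^sub>R xexp n (ms ! 0)"
    using semiroot_exp_sum [OF 0] by (simp add: char_lattice_0 sum_constant_scaleR del: sum_constant)
  then show ?case using card_G'_pos [of 0] 0 by simp
next
  case (Suc j)
  let ?c = "real (card (G' (Suc j)))"
  have "?c *\<^sub>R xexp n (semiroot_exp (Suc j)) =
      real (card (G' j)) *\<^sub>R xexp n (semiroot_exp j) + ?c *\<^sub>R (ls ! Suc j - ls ! j)"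
    using Suc.prems by (simp only: semiroot_exp_sum diff_exp_sum_Suc Suc_lessD)
  also have "\<dots> = ?c *\<^sub>R gam ls (Suc (Suc j))"
    using Suc card_G'_Suc [of j] by (simp add: scaleR_add_right mult.commute)
  finally show ?case using card_G'_pos [of "Suc j"] by simp
qed

definition semiroot :: "nat \<Rightarrow> (complex, 'd) mfps poly" where
  "semiroot j = (SOME F. map_poly (ramify n) F = (\<Prod>\<tau>\<in>conjugates n (trunc j). [:- \<tau>, 1:]) \<and>
    lead_coeff F = 1 \<and> degree F = card (conjugates n (trunc j)))"

lemma semiroot:
  "map_poly (ramify n) (semiroot j) = (\<Prod>\<tau>\<in>conjugates n (trunc j). [:- \<tau>, 1:])"
  "lead_coeff (semiroot j) = 1" "degree (semiroot j) = deg j"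
  using someI_ex [OF conjugates_poly [OF n_pos, of "trunc j"], folded semiroot_def deg_def] by blast+

lemma lead_exp_eval_semiroot:
  "j < g \<Longrightarrow> lead_exp (eval_ramified n (semiroot j) \<zeta>) (semiroot_exp j)"
  using lead_exp_semiroot [of j] by (simp add: eval_ramified_def semiroot(1) poly_prod)

end

section \<open>The semigroup\<close>

definition nat_vec :: "nat ^ 'd::finite \<Rightarrow> real ^ 'd" where
  "nat_vec u = (\<chi> i. real (u $ i))"

lemma nat_vec_add: "nat_vec (a + b) = nat_vec a + nat_vec b"
  and nat_vec_0 [simp]: "nat_vec 0 = 0"
  by (simp_all add: nat_vec_def fvec_eq)

lemma nat_vec_in_int_lattice: "nat_vec u \<in> int_lattice"
  by (simp add: nat_vec_def int_lattice_def)

lemma int_lattice_nonneg: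
  assumes "w \<in> int_lattice" "0 \<le> w"
  obtains u where "w = nat_vec u"
proof -
  have "w = nat_vec (\<chi> i. nat \<lfloor>w $ i\<rfloor>)"
    using assms unfolding fvec_eq nat_vec_def int_lattice_def
    by (auto simp: fvec_le elim!: Ints_cases)
  then show thesis by (rule that)
qed

lemma xexp_scale_nat_vec: "n > 0 \<Longrightarrow> xexp n (n *s u) = nat_vec u"
  by (simp add: xexp_scale nat_vec_def)

lemma xexp_smult: "xexp n (k *s u) = real k *\<^sub>R xexp n u"
  by (simp add: xexp_def fvec_eq vector_scalar_mult_def)

lemma xexp_nonneg: "0 \<le> xexp n u"
  by (simp add: xexp_def fvec_le)

lemma lead_exp_power:
  fixes h :: "('a::idom, 'i::finite) mfps"
  assumes "lead_exp h m"
  shows "lead_exp (h ^ k) (k *s m)"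
proof (induction k)
  case 0
  have "0 *s m = 0" by (simp add: fvec_eq vector_scalar_mult_def)
  then show ?case by (simp add: lead_exp_one)
next
  case (Suc k)
  have "Suc k *s m = m + k *s m" by (simp add: fvec_eq vector_scalar_mult_def)
  then show ?case using lead_exp_mult [OF assms Suc] by simp
qed

context quasi_ordinary_branch
begin

text \<open>The index is shifted: \<open>gm i\<close> is \<open>\<gamma>\<^sub>i\<^sub>+\<^sub>1\<close>.\<close>

definition gm :: "nat \<Rightarrow> real ^ 'd" where
  "gm i = gam ls (Suc i)"

lemma gm_xexp: "i < g \<Longrightarrow> gm i = xexp n (semiroot_exp i)"
  by (simp add: gm_def xexp_semiroot_exp)

lemma gm_nonneg: "i < g \<Longrightarrow> 0 \<le> gm i"
  by (simp add: gm_xexp xexp_nonneg)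

lemma gm_0: "gm 0 = ls ! 0"
  and gm_Suc: "gm (Suc i) = real (idx (Suc i)) *\<^sub>R gm i + (ls ! Suc i - ls ! i)"
  by (simp_all add: gm_def)

lemma ls_in_M: "i < g \<Longrightarrow> ls ! i \<in> M (Suc i)"
  unfolding char_lattice_Suc by (rule in_adjoin [OF add_subgroup_char_lattice])

text \<open>The recursion adds to the new \<lambda> only \<open>idx (Suc i)\<close> times
  \<open>gm i\<close> minus \<open>ls ! i\<close>, a combination of elements of
  \<open>M (Suc i)\<close>. So \<gamma> can replace \<lambda> as generator of a lattice step, with
  the same order.\<close>

lemma gm_diff: "i < g \<Longrightarrow> gm i - ls ! i \<in> M i"
proof (induction i)
  case 0
  then show ?case by (simp add: gm_0 add_subgroup_0 [OF add_subgroup_char_lattice])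
next
  case (Suc i)
  then have "gm i - ls ! i \<in> M (Suc i)" using char_lattice_mono [of i "Suc i" ls] by auto
  then have "gm i - ls ! i + ls ! i \<in> M (Suc i)"
    using ls_in_M Suc.prems by (intro add_subgroup_add add_subgroup_char_lattice) auto
  then have "real (idx (Suc i)) *\<^sub>R gm i - ls ! i \<in> M (Suc i)"
    using ls_in_M Suc.prems
    by (intro add_subgroup_diff add_subgroup_of_nat add_subgroup_char_lattice) auto
  then show ?case by (simp add: gm_Suc)
qed

lemma gm_in_M: "i < j \<Longrightarrow> j \<le> g \<Longrightarrow> gm i \<in> M j"
proof -
  assume ij: "i < j" "j \<le> g"
  have "gm i - ls ! i \<in> M (Suc i)" using gm_diff [of i] ij char_lattice_mono [of i "Suc i" ls] by auto
  then have "gm i - ls ! i + ls ! i \<in> M (Suc i)"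
    using ls_in_M ij by (intro add_subgroup_add add_subgroup_char_lattice) auto
  then show ?thesis using char_lattice_mono [of "Suc i" j ls] ij by auto
qed

lemma gm_order_mod:
  assumes "j < g"
  shows "order_mod (M j) (gm j) (idx (Suc j))"
proof -
  have "of_int c *\<^sub>R gm j \<in> M j \<longleftrightarrow> of_int c *\<^sub>R ls ! j \<in> M j" for c
  proof -
    have "of_int c *\<^sub>R (gm j - ls ! j) \<in> M j"
      by (rule add_subgroup_of_int [OF add_subgroup_char_lattice gm_diff [OF assms]])
    then have "of_int c *\<^sub>R ls ! j + of_int c *\<^sub>R (gm j - ls ! j) \<in> M j \<longleftrightarrow> of_int c *\<^sub>R ls ! j \<in> M j"
      by (rule add_subgroup_add_cancel [OF add_subgroup_char_lattice])
    then show ?thesis by (simp add: scaleR_diff_right)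
  qed
  then show ?thesis using idx_order_mod [OF assms] by (simp add: order_mod_def)
qed

lemma M_Suc_gm:
  assumes j: "j < g"
  shows "M (Suc j) \<subseteq> adjoin (M j) (gm j)"
  unfolding char_lattice_Suc
proof (rule adjoin_subset [OF add_subgroup_adjoin [OF add_subgroup_char_lattice] subset_adjoin])
  have "gm j - (gm j - ls ! j) \<in> adjoin (M j) (gm j)"
    by (rule add_subgroup_diff [OF add_subgroup_adjoin in_adjoin, OF add_subgroup_char_lattice add_subgroup_char_lattice])
       (rule subsetD [OF subset_adjoin gm_diff [OF j]])
  then show "ls ! j \<in> adjoin (M j) (gm j)" by simp
qed

text \<open>The coefficient of the top generator \<open>gm j\<close> is reduced modulo its order;
  the multiple removed lies in \<open>M j\<close>, where induction finds the lower digits.\<close>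

lemma M_digits:
  assumes "j \<le> g" "w \<in> M j"
  shows "\<exists>l. (\<forall>i<j. l i < idx (Suc i)) \<and> w - (\<Sum>i<j. real (l i) *\<^sub>R gm i) \<in> int_lattice"
  using assms
proof (induction j arbitrary: w)
  case 0
  then show ?case by (simp add: char_lattice_0)
next
  case (Suc j)
  let ?k = "idx (Suc j)"
  have "w \<in> adjoin (M j) (gm j)" using M_Suc_gm [of j] Suc.prems by auto
  then obtain h c where hc: "h \<in> M j" "w = h + of_int c *\<^sub>R gm j"
    by (auto simp: adjoin_def)
  have k: "?k > 0" using idx_pos Suc.prems by simp
  define a where "a = nat (c mod int ?k)"
  have a: "a < ?k" "int a = c mod int ?k" using k by (simp_all add: a_def nat_less_iff)
  have "real_of_int c - real a = of_int (c - int a)" by simp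
  have "of_int (c - int a) *\<^sub>R gm j \<in> M j"
    using gm_order_mod [of j] Suc.prems a by (simp only: order_mod_def minus_mod_eq_mult_div dvd_triv_left Suc_le_lessD)
  then have "h + of_int (c - int a) *\<^sub>R gm j \<in> M j"
    by (rule add_subgroup_add [OF add_subgroup_char_lattice hc(1)])
  moreover have "h + of_int (c - int a) *\<^sub>R gm j = w - real a *\<^sub>R gm j"
    by (simp add: hc(2) scaleR_diff_left)
  ultimately obtain l where l: "\<forall>i<j. l i < idx (Suc i)"
      "w - real a *\<^sub>R gm j - (\<Sum>i<j. real (l i) *\<^sub>R gm i) \<in> int_lattice"
    using Suc.IH [of "w - real a *\<^sub>R gm j"] Suc.prems by auto
  have "(\<Sum>i<Suc j. real ((l(j := a)) i) *\<^sub>R gm i) = (\<Sum>i<j. real (l i) *\<^sub>R gm i) + real a *\<^sub>R gm j"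
    by simp
  then have "w - (\<Sum>i<Suc j. real ((l(j := a)) i) *\<^sub>R gm i) = w - real a *\<^sub>R gm j - (\<Sum>i<j. real (l i) *\<^sub>R gm i)"
    by simp
  then have "w - (\<Sum>i<Suc j. real ((l(j := a)) i) *\<^sub>R gm i) \<in> int_lattice" using l(2) by metis
  moreover have "\<forall>i<Suc j. (l(j := a)) i < idx (Suc i)" using l(1) a by (auto simp: less_Suc_eq)
  ultimately show ?case by blast
qed

text \<open>In the induction the last term (n - 1)\<gamma> combines with the bound \<gamma> to
  n\<gamma>, which is at most the next \<gamma> since the \<lambda> increase. The bound makes the
  remainder in \<open>idx_gm_in_Gam\<close> non-negative.\<close>

lemma gm_bound: "j < g \<Longrightarrow> (\<Sum>i<j. real (idx (Suc i) - 1) *\<^sub>R gm i) \<le> gm j"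
proof (induction j)
  case 0
  then show ?case by (simp add: gm_nonneg)
next
  case (Suc j)
  have "real (idx (Suc j) - 1) = real (idx (Suc j)) - 1" using idx_pos [of j] Suc.prems by simp
  then have "(\<Sum>i<Suc j. real (idx (Suc i) - 1) *\<^sub>R gm i) =
      (\<Sum>i<j. real (idx (Suc i) - 1) *\<^sub>R gm i) + (real (idx (Suc j)) *\<^sub>R gm j - gm j)"
    by (simp add: scaleR_diff_left)
  also have "\<dots> \<le> real (idx (Suc j)) *\<^sub>R gm j"
    using Suc by (simp add: fvec_le)
  also have "real (idx (Suc j)) *\<^sub>R gm j \<le> gm (Suc j)"
  proof -
    have "xexp n (ms ! j) \<le> xexp n (ms ! Suc j)"
      using ms_less [of j "Suc j"] Suc.prems by (simp add: xexp_le_iff n_pos)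
    then show ?thesis using Suc.prems by (simp add: gm_Suc fvec_le)
  qed
  finally show ?case .
qed

section \<open>The intermediate semigroups and their decomposition into translated orthants\<close>

definition Gam :: "nat \<Rightarrow> (real ^ 'd) set" where
  "Gam j = {nat_vec u + (\<Sum>i<j. real (l i) *\<^sub>R gm i) | u l. True}"

lemma GamI: "x = nat_vec u + (\<Sum>i<j. real (l i) *\<^sub>R gm i) \<Longrightarrow> x \<in> Gam j"
  by (auto simp: Gam_def)

lemma Gam_add:
  assumes "x \<in> Gam j" "y \<in> Gam j"
  shows "x + y \<in> Gam j"
proof -
  obtain u l u' l' where "x = nat_vec u + (\<Sum>i<j. real (l i) *\<^sub>R gm i)"
      "y = nat_vec u' + (\<Sum>i<j. real (l' i) *\<^sub>R gm i)"
    using assms by (auto simp: Gam_def)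
  then show ?thesis
    by (intro GamI [of _ "u + u'" "\<lambda>i. l i + l' i"])
       (simp add: nat_vec_add scaleR_add_left sum.distrib)
qed

lemma Gam_zero: "0 \<in> Gam j"
  by (rule GamI [of _ 0 "\<lambda>_. 0"]) simp

lemma Gam_of_nat: "x \<in> Gam j \<Longrightarrow> real k *\<^sub>R x \<in> Gam j"
  by (induction k) (auto simp: Gam_zero scaleR_add_left Gam_add)

lemma Gam_subset_M:
  assumes "j \<le> g"
  shows "Gam j \<subseteq> M j"
proof
  fix x assume "x \<in> Gam j"
  then obtain u l where x: "x = nat_vec u + (\<Sum>i<j. real (l i) *\<^sub>R gm i)" by (auto simp: Gam_def)
  have "nat_vec u \<in> M j"
    using nat_vec_in_int_lattice int_lattice_subset_char_lattice by blast
  moreover have "(\<Sum>i<j. real (l i) *\<^sub>R gm i) \<in> M j"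
    by (rule add_subgroup_sum [OF add_subgroup_char_lattice])
       (simp add: add_subgroup_of_nat add_subgroup_char_lattice gm_in_M assms)
  ultimately show "x \<in> M j" unfolding x by (rule add_subgroup_add [OF add_subgroup_char_lattice])
qed

text \<open>The multiple lies in \<open>M j\<close>, so it is a digit sum plus an integer vector.
  The digits are below the indices, hence by \<open>gm_bound\<close> the digit sum is at most
  \<open>gm j\<close>, and the integer vector is non-negative.\<close>

lemma idx_gm_in_Gam:
  assumes j: "j < g"
  shows "real (idx (Suc j)) *\<^sub>R gm j \<in> Gam j"
proof -
  let ?w = "real (idx (Suc j)) *\<^sub>R gm j"
  have "of_int (int (idx (Suc j))) *\<^sub>R gm j \<in> M j"
    using gm_order_mod [OF j] unfolding order_mod_def by (metis dvd_refl)
  then obtain l where l: "\<forall>i<j. l i < idx (Suc i)" "?w - (\<Sum>i<j. real (l i) *\<^sub>R gm i) \<in> int_lattice"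
    using M_digits [of j ?w] j by auto
  have "(\<Sum>i<j. real (l i) *\<^sub>R gm i) \<le> (\<Sum>i<j. real (idx (Suc i) - 1) *\<^sub>R gm i)"
    unfolding fvec_le sum_component
  proof (intro allI sum_mono)
    fix r i assume "i \<in> {..<j}"
    then have "real (l i) \<le> real (idx (Suc i) - 1)" "0 \<le> gm i $ r"
      using l(1) gm_nonneg [of i] j by (auto simp: fvec_le less_eq_Suc_le)
    then show "(real (l i) *\<^sub>R gm i) $ r \<le> (real (idx (Suc i) - 1) *\<^sub>R gm i) $ r"
      by (simp add: mult_right_mono)
  qed
  also have "\<dots> \<le> gm j" by (rule gm_bound [OF j])
  also have "\<dots> \<le> ?w"
    unfolding fvec_le
  proof
    fix r
    have "0 \<le> gm j $ r" using gm_nonneg [OF j] by (simp add: fvec_le)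
    moreover have "1 \<le> real (idx (Suc j))" using idx_pos [OF j] by simp
    ultimately show "gm j $ r \<le> ?w $ r" using mult_right_mono [of 1 "real (idx (Suc j))" "gm j $ r"] by simp
  qed
  finally have "0 \<le> ?w - (\<Sum>i<j. real (l i) *\<^sub>R gm i)" by (simp add: fvec_le)
  then obtain u where "?w - (\<Sum>i<j. real (l i) *\<^sub>R gm i) = nat_vec u"
    using int_lattice_nonneg l(2) by blast
  then show ?thesis by (intro GamI [of _ u l]) (simp add: algebra_simps)
qed

text \<open>Division of the coefficient of \<open>gm j\<close> by \<open>idx (Suc j)\<close>: the
  quotient part is absorbed into \<open>Gam j\<close> by \<open>idx_gm_in_Gam\<close>.\<close>

lemma Gam_Suc:
  assumes j: "j < g"
  shows "Gam (Suc j) = (\<Union>a<idx (Suc j). (\<lambda>x. real a *\<^sub>R gm j + x) ` Gam j)"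
proof
  let ?k = "idx (Suc j)"
  show "Gam (Suc j) \<subseteq> (\<Union>a<?k. (\<lambda>x. real a *\<^sub>R gm j + x) ` Gam j)"
  proof
    fix x assume "x \<in> Gam (Suc j)"
    then obtain u l where x: "x = nat_vec u + (\<Sum>i<Suc j. real (l i) *\<^sub>R gm i)"
      by (auto simp: Gam_def)
    define y where "y = nat_vec u + (\<Sum>i<j. real (l i) *\<^sub>R gm i) + real (l j div ?k) *\<^sub>R (real ?k *\<^sub>R gm j)"
    have "y \<in> Gam j"
      unfolding y_def by (intro Gam_add Gam_of_nat idx_gm_in_Gam j GamI [OF refl])
    moreover have "real (l j) = real (l j div ?k) * real ?k + real (l j mod ?k)"
      by (metis div_mult_mod_eq of_nat_add of_nat_mult)
    then have "real (l j) *\<^sub>R gm j = real (l j div ?k) *\<^sub>R (real ?k *\<^sub>R gm j) + real (l j mod ?k) *\<^sub>R gm j"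
      by (metis scaleR_add_left scaleR_scaleR)
    then have "x = real (l j mod ?k) *\<^sub>R gm j + y"
      unfolding x y_def sum.lessThan_Suc by (simp only: add_ac)
    moreover have "l j mod ?k < ?k" using idx_pos [OF j] by simp
    ultimately show "x \<in> (\<Union>a<?k. (\<lambda>x. real a *\<^sub>R gm j + x) ` Gam j)" by blast
  qed
  show "(\<Union>a<?k. (\<lambda>x. real a *\<^sub>R gm j + x) ` Gam j) \<subseteq> Gam (Suc j)"
  proof clarify
    fix a x assume "x \<in> Gam j"
    then obtain u l where x: "x = nat_vec u + (\<Sum>i<j. real (l i) *\<^sub>R gm i)"
      by (auto simp: Gam_def)
    show "real a *\<^sub>R gm j + x \<in> Gam (Suc j)"
      by (rule GamI [of _ u "l(j := a)"]) (simp add: x)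
  qed
qed

text \<open>Modulo \<open>M j\<close> only the multiples of \<open>gm j\<close> remain, and
  \<open>gm j\<close> has order \<open>idx (Suc j)\<close>. The congruence in place of an equality
  serves both the disjointness of translates and the digits of vectors congruent modulo the
  integers.\<close>

lemma Gam_digit_unique:
  assumes j: "j < g" and a: "a < idx (Suc j)" "a' < idx (Suc j)"
    and eq: "real a *\<^sub>R gm j + x - (real a' *\<^sub>R gm j + x') \<in> M j" and x: "x \<in> M j" "x' \<in> M j"
  shows "a = a'"
proof -
  have "(real a *\<^sub>R gm j + x - (real a' *\<^sub>R gm j + x')) - (x - x') \<in> M j"
    by (rule add_subgroup_diff [OF add_subgroup_char_lattice eq add_subgroup_diff [OF add_subgroup_char_lattice x]])
  also have "(real a *\<^sub>R gm j + x - (real a' *\<^sub>R gm j + x')) - (x - x') = of_int (int a - int a') *\<^sub>R gm j"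
    by (simp add: scaleR_diff_left)
  finally have "int (idx (Suc j)) dvd int a - int a'"
    using gm_order_mod [OF j] unfolding order_mod_def by blast
  then have "int a mod int (idx (Suc j)) = int a' mod int (idx (Suc j))" by (simp only: mod_eq_dvd_iff)
  then show ?thesis using a by simp
qed

text \<open>Digits in the mixed radix system with place values \<open>deg i = n\<^sub>1 \<dots> n\<^sub>i\<close>.\<close>

definition digit :: "nat \<Rightarrow> nat \<Rightarrow> nat" where
  "digit i k = (k mod deg (Suc i)) div deg i"

lemma digit_less:
  assumes "i < g"
  shows "digit i k < idx (Suc i)"
  using assms deg_pos [of "Suc i"] deg_pos [of i]
  by (simp add: digit_def deg_Suc less_mult_imp_div_less)

lemma deg_dvd: "i \<le> j \<Longrightarrow> j \<le> g \<Longrightarrow> deg i dvd deg j"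
proof (induction j)
  case (Suc j)
  then show ?case by (cases "i = Suc j") (auto simp: deg_Suc)
qed simp

lemma digit_sum: "j \<le> g \<Longrightarrow> (\<Sum>i<j. digit i k * deg i) = k mod deg j"
proof (induction j)
  case (Suc j)
  have "k mod deg (Suc j) mod deg j = k mod deg j"
    using deg_dvd [of j "Suc j"] Suc.prems by (simp add: mod_mod_cancel)
  then have "k mod deg (Suc j) = digit j k * deg j + k mod deg j"
    using div_mult_mod_eq [of "k mod deg (Suc j)" "deg j"] by (simp add: digit_def)
  with Suc show ?case by simp
qed (simp add: deg_0)

definition beta :: "nat \<Rightarrow> nat \<Rightarrow> real ^ 'd" where
  "beta j k = (\<Sum>i<j. real (digit i k) *\<^sub>R gm i)"

lemma beta_extend:
  assumes j: "j < g" and k: "k < deg j" and a: "a < idx (Suc j)"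
  shows "beta (Suc j) (k + a * deg j) = real a *\<^sub>R gm j + beta j k"
proof -
  have "digit i (k + a * deg j) = digit i k" if "i < j" for i
  proof -
    have "deg (Suc i) dvd deg j" using deg_dvd [of "Suc i" j] that j by simp
    then obtain q where "deg j = deg (Suc i) * q" by (rule dvdE)
    then have "a * deg j = deg (Suc i) * (a * q)" by simp
    then have "(k + a * deg j) mod deg (Suc i) = k mod deg (Suc i)"
      by (metis mod_mult_self2)
    then show ?thesis by (simp add: digit_def)
  qed
  moreover have "k + a * deg j < deg (Suc j)"
  proof -
    have "k + a * deg j < Suc a * deg j" using k by simp
    also have "\<dots> \<le> idx (Suc j) * deg j" using a by (intro mult_right_mono) auto
    finally show ?thesis using deg_Suc [OF j] by simp
  qed
  then have "digit j (k + a * deg j) = a" using k by (simp add: digit_def)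
  ultimately show ?thesis by (simp add: beta_def)
qed

lemma Gam_eq_beta: "j \<le> g \<Longrightarrow> Gam j = {nat_vec u + beta j k | u k. k < deg j}"
proof (induction j)
  case 0
  then show ?case by (auto simp: Gam_def beta_def deg_0)
next
  case (Suc j)
  then have j: "j < g" by simp
  show ?case
  proof
    show "{nat_vec u + beta (Suc j) k | u k. k < deg (Suc j)} \<subseteq> Gam (Suc j)"
      by (auto simp: Gam_def beta_def)
    show "Gam (Suc j) \<subseteq> {nat_vec u + beta (Suc j) k | u k. k < deg (Suc j)}"
    proof
      fix x assume "x \<in> Gam (Suc j)"
      then obtain a y where a: "a < idx (Suc j)" "y \<in> Gam j" "x = real a *\<^sub>R gm j + y"
        unfolding Gam_Suc [OF j] by blast
      then obtain u k where k: "y = nat_vec u + beta j k" "k < deg j" using Suc by auto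
      have "k + a * deg j < Suc a * deg j" using k by simp
      also have "\<dots> \<le> idx (Suc j) * deg j" using a(1) by (intro mult_right_mono) auto
      finally have "k + a * deg j < deg (Suc j)" using deg_Suc [OF j] by simp
      moreover have "x = nat_vec u + beta (Suc j) (k + a * deg j)"
        using a k beta_extend [OF j k(2) a(1)] by simp
      ultimately show "x \<in> {nat_vec u + beta (Suc j) k | u k. k < deg (Suc j)}" by blast
    qed
  qed
qed

lemma beta_in_M:
  assumes "j \<le> g"
  shows "beta j k \<in> M j"
  unfolding beta_def
  by (rule add_subgroup_sum [OF add_subgroup_char_lattice])
     (simp add: add_subgroup_of_nat add_subgroup_char_lattice gm_in_M assms)

text \<open>The top digit is determined modulo \<open>M j\<close>; once it is cancelled, the
  congruence modulo integer vectors passes to the lower digits.\<close>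

lemma beta_digits_unique:
  "j \<le> g \<Longrightarrow> beta j k - beta j k' \<in> int_lattice \<Longrightarrow> i < j \<Longrightarrow> digit i k = digit i k'"
proof (induction j)
  case (Suc j)
  then have j: "j < g" by simp
  have split: "beta (Suc j) k = real (digit j k) *\<^sub>R gm j + beta j k" for k
    by (simp add: beta_def)
  have "real (digit j k) *\<^sub>R gm j + beta j k - (real (digit j k') *\<^sub>R gm j + beta j k') \<in> M j"
    using Suc.prems(2) int_lattice_subset_char_lattice [of ls j] unfolding split by blast
  then have eq: "digit j k = digit j k'"
    using Gam_digit_unique [OF j digit_less [OF j] digit_less [OF j]] beta_in_M j by simp
  then have "beta j k - beta j k' \<in> int_lattice" using Suc.prems(2) by (simp add: split)
  then show ?case using Suc eq by (cases "i = j") auto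
qed simp

lemma beta_unique:
  assumes "k < n" "k' < n" "beta g k - beta g k' \<in> int_lattice"
  shows "k = k'"
proof -
  have "k mod deg g = k' mod deg g"
    unfolding digit_sum [OF order_refl, symmetric]
    using beta_digits_unique [OF order_refl assms(3)] by simp
  then show ?thesis using assms by (simp add: deg_g)
qed

lemma nat_vec_beta_unique:
  assumes "k < n" "k' < n" "nat_vec u + beta g k = nat_vec u' + beta g k'"
  shows "u = u' \<and> k = k'"
proof -
  have "beta g k - beta g k' = nat_vec u' - nat_vec u" using assms(3) by (simp add: algebra_simps)
  also have "\<dots> \<in> int_lattice" by (intro add_subgroup_diff add_subgroup_int_lattice nat_vec_in_int_lattice)
  finally have "k = k'" by (rule beta_unique [OF assms(1,2)])
  then show ?thesis using assms(3) by (simp add: nat_vec_def fvec_eq)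
qed

abbreviation "\<Gamma> \<equiv> semigroup_\<Gamma> ls"

lemma semigroup_eq: "\<Gamma> = Gam g"
proof -
  have ax: "(\<Sum>i\<in>UNIV. real (k i) *\<^sub>R axis i 1) = nat_vec (\<chi> i. k i)" for k :: "'d \<Rightarrow> nat"
    by (simp add: fvec_eq nat_vec_def sum_component axis_def if_distrib sum.delta cong: if_cong)
  have sm: "(\<Sum>j = 1..g. real (l j) *\<^sub>R gam ls j) = (\<Sum>i<g. real (l (Suc i)) *\<^sub>R gm i)" for l
    unfolding gm_def by (rule sum.reindex_bij_witness [where i = Suc and j = "\<lambda>j. j - 1"]) auto
  show ?thesis
  proof
    show "\<Gamma> \<subseteq> Gam g"
      by (auto simp: semigroup_\<Gamma>_def ax sm [unfolded One_nat_def] intro: GamI)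
    show "Gam g \<subseteq> \<Gamma>"
    proof
      fix x assume "x \<in> Gam g"
      then obtain u l where x: "x = nat_vec u + (\<Sum>i<g. real (l i) *\<^sub>R gm i)" by (auto simp: Gam_def)
      have "x = (\<Sum>i\<in>UNIV. real (u $ i) *\<^sub>R axis i 1) + (\<Sum>j = 1..g. real (l (j - 1)) *\<^sub>R gam ls j)"
        by (simp only: ax sm x vec_lambda_eta diff_Suc_1)
      then show "x \<in> \<Gamma>"
        unfolding semigroup_\<Gamma>_def length_map mem_Collect_eq
        by (intro exI [of _ "\<lambda>i. u $ i"] exI [of _ "\<lambda>j. l (j - 1)"] conjI TrueI)
    qed
  qed
qed

lemma semigroup_eq_beta: "\<Gamma> = {nat_vec u + beta g k | u k. k < n}"
  by (simp add: semigroup_eq Gam_eq_beta deg_g)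

end

section \<open>Coordinates on the local ring\<close>

lemma monic_triangular_expansion:
  fixes B :: "nat \<Rightarrow> 'a::comm_ring_1 poly"
  assumes B: "\<And>k. degree (B k) = k" "\<And>k. coeff (B k) k = 1"
    and p: "\<And>k. d \<le> k \<Longrightarrow> coeff p k = 0"
  shows "\<exists>c. p = (\<Sum>k<d. Polynomial.smult (c k) (B k))"
  using p
proof (induction d arbitrary: p)
  case 0
  then have "p = 0" by (simp add: poly_eq_iff)
  then show ?case by simp
next
  case (Suc d)
  let ?q = "p - Polynomial.smult (coeff p d) (B d)"
  have "coeff ?q k = 0" if "d \<le> k" for k
    using that Suc.prems [of k] B coeff_eq_0 [of "B d" k] by (cases "k = d") auto
  then obtain c where c: "?q = (\<Sum>k<d. Polynomial.smult (c k) (B k))" using Suc.IH by blast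
  have "p = ?q + Polynomial.smult (coeff p d) (B d)" by simp
  also have "\<dots> = (\<Sum>k<Suc d. Polynomial.smult ((c(d := coeff p d)) k) (B k))"
    unfolding c by simp
  finally show ?case by blast
qed

context quasi_ordinary_branch
begin

definition ev :: "(complex, 'd) mfps poly \<Rightarrow> (complex, 'd) mfps" where
  "ev p = eval_ramified n p \<zeta>"

lemma ev_hom:
  "ev (p * q) = ev p * ev q" "ev (p + q) = ev p + ev q" "ev 1 = 1"
  "ev (Polynomial.smult c p) = ramify n c * ev p"
  by (simp_all add: ev_def eval_ramified_def ramp.hom_mult ramp.hom_add ram.map_poly_hom_smult)

lemma ev_0: "ev 0 = 0" by (simp add: ev_def eval_ramified_def)

lemma ev_sum: "ev (sum h A) = (\<Sum>x\<in>A. ev (h x))"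
  by (induction A rule: infinite_finite_induct) (simp_all add: ev_hom ev_0)

lemma ev_prod: "ev (prod h A) = (\<Prod>x\<in>A. ev (h x))"
  by (induction A rule: infinite_finite_induct) (simp_all add: ev_hom)

lemma ev_power: "ev (p ^ k) = ev p ^ k"
  by (induction k) (simp_all add: ev_hom)

lemma ev_f: "ev f = 0"
  using root_poly by (simp add: ev_def eval_ramified_def)

definition basis :: "nat \<Rightarrow> (complex, 'd) mfps poly" where
  "basis k = (\<Prod>i<g. semiroot i ^ digit i k)"

definition basis_exp :: "nat \<Rightarrow> nat ^ 'd" where
  "basis_exp k = (\<Sum>i<g. digit i k *s semiroot_exp i)"

lemma xexp_basis_exp: "xexp n (basis_exp k) = beta g k"
  by (simp add: basis_exp_def beta_def xexp_sum xexp_smult gm_xexp)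

lemma lead_exp_basis: "lead_exp (ev (basis k)) (basis_exp k)"
  unfolding basis_def basis_exp_def ev_prod ev_power
  by (intro lead_exp_prod lead_exp_power) (simp add: ev_def lead_exp_eval_semiroot)

lemma basis_monic: "lead_coeff (basis k) = 1"
  unfolding basis_def by (subst lead_coeff_prod) (simp add: lead_coeff_power semiroot(2))

lemma semiroot_nonzero: "semiroot j \<noteq> 0"
  using semiroot(2) [of j] by auto

lemma degree_basis:
  assumes "k < n"
  shows "degree (basis k) = k"
proof -
  have "degree (basis k) = (\<Sum>i<g. degree (semiroot i ^ digit i k))"
    unfolding basis_def by (rule degree_prod_eq_sum_degree) (simp add: semiroot_nonzero)
  also have "\<dots> = (\<Sum>i<g. digit i k * deg i)"
    by (simp add: degree_power_eq semiroot_nonzero semiroot(3) mult.commute)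
  also have "\<dots> = k" using digit_sum [of g k] assms by (simp add: deg_g)
  finally show ?thesis .
qed

lemma ev_expansion: "\<exists>c. ev p = (\<Sum>k<n. ramify n (c k) * ev (basis k))"
proof -
  \<comment> \<open>Degrees from \<open>n\<close> on are filled with multiples of \<open>f\<close>,
    which evaluate to zero; the triangular expansion thus replaces a division by
    \<open>f\<close>.\<close>
  define B where "B k = (if k < n then basis k else f * monom 1 (k - n))" for k
  have f0: "f \<noteq> 0" using n_pos by auto
  have B: "degree (B k) = k" for k
    using f0 by (simp add: B_def degree_basis degree_mult_eq degree_monom_eq)
  have "lead_coeff (B k) = 1" for k
    unfolding B_def if_distrib [of lead_coeff] lead_coeff_mult lead_coeff_monom basis_monic monic by simp
  then have "coeff (B k) k = 1" for k using B by metis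
  then obtain c where c: "p = (\<Sum>k<Suc (degree p). Polynomial.smult (c k) (B k))"
    using monic_triangular_expansion [of B "Suc (degree p)" p] B by (auto simp: coeff_eq_0)
  have evB: "ev (B k) = (if k < n then ev (basis k) else 0)" for k
    by (simp add: B_def ev_hom ev_f)
  have "ev p = (\<Sum>k<Suc (degree p). ramify n (c k) * ev (B k))"
    by (subst c) (simp only: ev_sum ev_hom)
  also have "\<dots> = (\<Sum>k\<in>{..<Suc (degree p)} \<inter> {..<n}. ramify n (c k) * ev (basis k))"
    by (rule sum.mono_neutral_cong_right) (auto simp: evB)
  also have "\<dots> = (\<Sum>k<n. ramify n (if k < Suc (degree p) then c k else 0) * ev (basis k))"
    by (rule sum.mono_neutral_cong_left) auto
  finally show ?thesis by (rule exI [of _ "\<lambda>k. if k < Suc (degree p) then c k else 0"])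
qed

text \<open>A point of \<Gamma> is \<open>nat_vec u + beta g k\<close> for exactly one
  \<open>u\<close> and one \<open>k < n\<close>, so the value of \<open>F\<close> there serves as
  the coefficient at \<open>u\<close> of the \<open>k\<close>-th coordinate. Values off \<Gamma> are
  never read.\<close>

definition elem :: "(real ^ 'd \<Rightarrow> complex) \<Rightarrow> (complex, 'd) mfps" where
  "elem F = (\<Sum>k<n. ramify n (Mfps (\<lambda>u. F (nat_vec u + beta g k))) * ev (basis k))"

lemma elem_in_local_ring: "elem F \<in> local_ring f \<zeta>"
proof -
  have "elem F = ev (\<Sum>k<n. Polynomial.smult (Mfps (\<lambda>u. F (nat_vec u + beta g k))) (basis k))"
    by (simp add: ev_sum ev_hom elem_def)
  then show ?thesis by (auto simp: local_ring_def ev_def)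
qed

lemma local_ring_elem:
  assumes "h \<in> local_ring f \<zeta>"
  shows "\<exists>F. (\<forall>\<gamma>. \<gamma> \<notin> \<Gamma> \<longrightarrow> F \<gamma> = 0) \<and> h = elem F"
proof -
  obtain p where "h = ev p" using assms by (auto simp: local_ring_def ev_def)
  then obtain c where c: "h = (\<Sum>k<n. ramify n (c k) * ev (basis k))" using ev_expansion [of p] by blast
  define F where "F \<gamma> = (if \<gamma> \<in> \<Gamma> then
      (let (u, k) = (THE (u, k). k < n \<and> \<gamma> = nat_vec u + beta g k) in mcoeff (c k) u) else 0)" for \<gamma>
  have F: "F (nat_vec u + beta g k) = mcoeff (c k) u" if k: "k < n" for u k
  proof -
    have "(THE (u', k'). k' < n \<and> nat_vec u + beta g k = nat_vec u' + beta g k') = (u, k)"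
      using nat_vec_beta_unique k by (intro the_equality) auto
    moreover have "nat_vec u + beta g k \<in> \<Gamma>" using k by (auto simp: semigroup_eq_beta)
    ultimately show ?thesis by (simp add: F_def)
  qed
  have "Mfps (\<lambda>u. F (nat_vec u + beta g k)) = c k" if "k < n" for k
    using F [OF that] by (simp add: mfps_eq_iff)
  then have "h = elem F" unfolding c elem_def by simp
  moreover have "\<forall>\<gamma>. \<gamma> \<notin> \<Gamma> \<longrightarrow> F \<gamma> = 0" by (simp add: F_def)
  ultimately show ?thesis by blast
qed

lemma elem_add: "elem (\<lambda>\<gamma>. F \<gamma> + F' \<gamma>) = elem F + elem F'"
proof -
  have "ramify n (Mfps (\<lambda>u. F (nat_vec u + beta g k) + F' (nat_vec u + beta g k))) =
      ramify n (Mfps (\<lambda>u. F (nat_vec u + beta g k))) + ramify n (Mfps (\<lambda>u. F' (nat_vec u + beta g k)))" for k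
    unfolding ram.hom_add [symmetric] by (rule arg_cong [where f = "ramify n"]) (simp add: mfps_eq_iff)
  then show ?thesis by (simp add: elem_def sum.distrib distrib_right)
qed

lemma elem_scale: "elem (\<lambda>\<gamma>. c * F \<gamma>) = mconst c * elem F"
proof -
  have "ramify n (Mfps (\<lambda>u. c * F (nat_vec u + beta g k))) =
      mconst c * ramify n (Mfps (\<lambda>u. F (nat_vec u + beta g k)))" for k
    by (auto simp: mfps_eq_iff mcoeff_mconst_mult ramify_def)
  then show ?thesis by (simp add: elem_def sum_distrib_left mult.assoc)
qed

lemma ramify_mult_support:
  assumes "mcoeff (ramify n h * ev (basis k)) w \<noteq> 0"
  obtains u b where "mcoeff h u \<noteq> 0" "basis_exp k \<le> b" "w = n *s u + b"
proof -
  obtain a b where ab: "a + b = w" "mcoeff (ramify n h) a \<noteq> 0" "mcoeff (ev (basis k)) b \<noteq> 0"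
    using assms by (rule mcoeff_mult_neq_0)
  have "a \<in> range ((*s) n)" using ab(2) mcoeff_ramify_not_scale [of a n h] by blast
  then obtain u where "a = n *s u" by blast
  then show thesis
    using that [of u b] ab lead_exp_basis [of k] by (auto simp: lead_exp_def mcoeff_ramify_scale n_pos)
qed

lemma elem_support:
  assumes "mcoeff (elem F) w \<noteq> 0"
  obtains u k where "k < n" "F (nat_vec u + beta g k) \<noteq> 0" "n *s u + basis_exp k \<le> w"
proof -
  obtain k where k: "k < n" "mcoeff (ramify n (Mfps (\<lambda>u. F (nat_vec u + beta g k))) * ev (basis k)) w \<noteq> 0"
    using assms unfolding elem_def mcoeff_sum by (meson lessThan_iff sum.neutral)
  from k(2) obtain u b where "F (nat_vec u + beta g k) \<noteq> 0" "basis_exp k \<le> b" "w = n *s u + b"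
    by (rule ramify_mult_support) auto
  then show thesis using that k(1) vec_add_mono [of "n *s u" "n *s u" "basis_exp k" b] by blast
qed

lemma xexp_basis_point: "xexp n (n *s u + basis_exp k) = nat_vec u + beta g k"
  by (simp add: xexp_add xexp_scale_nat_vec n_pos xexp_basis_exp)

text \<open>At a minimal point of the support of \<open>F\<close> only one product of coefficients contributes.\<close>

lemma elem_minimal_support:
  assumes "k0 < n" "F (nat_vec u0 + beta g k0) \<noteq> 0"
  obtains w where "mcoeff (elem F) w \<noteq> 0" "xexp n w \<le> nat_vec u0 + beta g k0"
proof -
  \<comment> \<open>The support of \<open>F\<close> on \<Gamma>, written in exponents of the
    variables \<open>z\<close>. A point below \<open>w0\<close> with least coordinate sum is minimal
    in \<open>W\<close>.\<close>
  define W where "W = {w. \<exists>u k. k < n \<and> w = n *s u + basis_exp k \<and> F (nat_vec u + beta g k) \<noteq> 0}"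
  let ?s = "\<lambda>w :: nat ^ 'd. \<Sum>i\<in>UNIV. w $ i"
  define w0 where "w0 = n *s u0 + basis_exp k0"
  have "w0 \<in> W \<and> w0 \<le> w0" using assms by (auto simp: W_def w0_def)
  then obtain w where w: "w \<in> W" "w \<le> w0" and least: "\<And>w'. w' \<in> W \<and> w' \<le> w0 \<Longrightarrow> ?s w \<le> ?s w'"
    using ex_has_least_nat [of "\<lambda>w. w \<in> W \<and> w \<le> w0" w0 ?s] by blast
  have min: "w' = w" if w': "w' \<in> W" "w' \<le> w" for w'
  proof (rule ccontr)
    assume "w' \<noteq> w"
    then have "?s w' < ?s w"
      using w'(2) by (intro sum_strict_mono_ex1) (auto simp: fvec_le fvec_eq nat_less_le)
    moreover have "?s w \<le> ?s w'" using least w' w(2) by auto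
    ultimately show False by simp
  qed
  obtain u k where uk: "k < n" "w = n *s u + basis_exp k" "F (nat_vec u + beta g k) \<noteq> 0"
    using w(1) by (auto simp: W_def)
  \<comment> \<open>Whatever contributes to the coefficient at \<open>w\<close> comes from a point
    of \<open>W\<close> below \<open>w\<close>, hence from \<open>w\<close> itself, and the
    coordinates of that point are unique.\<close>
  have below: "u' = u \<and> k' = k \<and> b = basis_exp k'"
    if k': "k' < n" "F (nat_vec u' + beta g k') \<noteq> 0" "basis_exp k' \<le> b" "w = n *s u' + b" for u' k' b
  proof -
    have "n *s u' + basis_exp k' \<in> W" using k' by (auto simp: W_def)
    moreover have "n *s u' + basis_exp k' \<le> w" using k'(3,4) by (simp add: vec_add_mono)
    ultimately have eq: "n *s u' + basis_exp k' = w" by (rule min)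
    then have "nat_vec u' + beta g k' = nat_vec u + beta g k"
      using uk(2) xexp_basis_point by metis
    then have "u' = u \<and> k' = k" using nat_vec_beta_unique k'(1) uk(1) by blast
    moreover have "b = basis_exp k'" using eq k'(4) by simp
    ultimately show ?thesis by simp
  qed
  let ?R = "\<lambda>k. ramify n (Mfps (\<lambda>u. F (nat_vec u + beta g k)))"
  have "mcoeff (elem F) w = (\<Sum>k'<n. mcoeff (?R k' * ev (basis k')) w)"
    by (simp add: elem_def mcoeff_sum)
  also have "\<dots> = (\<Sum>k'\<in>{k}. mcoeff (?R k' * ev (basis k')) w)"
  proof (rule sum.mono_neutral_right)
    show "\<forall>k'\<in>{..<n} - {k}. mcoeff (?R k' * ev (basis k')) w = 0"
    proof
      fix k' assume k': "k' \<in> {..<n} - {k}"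
      show "mcoeff (?R k' * ev (basis k')) w = 0"
      proof (rule ccontr)
        assume "\<not> ?thesis"
        then obtain u' b where "F (nat_vec u' + beta g k') \<noteq> 0" "basis_exp k' \<le> b" "w = n *s u' + b"
          by (rule ramify_mult_support) auto
        then show False using below k' by blast
      qed
    qed
  qed (use uk(1) in auto)
  also have "\<dots> = mcoeff (?R k) (n *s u) * mcoeff (ev (basis k)) (basis_exp k)"
    unfolding sum.insert_remove [OF finite.emptyI] 
  proof simp
    show "mcoeff (?R k * ev (basis k)) w = mcoeff (?R k) (n *s u) * mcoeff (ev (basis k)) (basis_exp k)"
    proof (rule mcoeff_mult_single)
      show "n *s u + basis_exp k = w" using uk(2) by simp
      fix c d assume cd: "c + d = w" "(c, d) \<noteq> (n *s u, basis_exp k)"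
      show "mcoeff (?R k) c * mcoeff (ev (basis k)) d = 0"
      proof (rule ccontr)
        assume "\<not> ?thesis"
        then have nz: "mcoeff (?R k) c \<noteq> 0" "mcoeff (ev (basis k)) d \<noteq> 0" by auto
        then have "c \<in> range ((*s) n)" using mcoeff_ramify_not_scale by blast
        then obtain u' where c: "c = n *s u'" by blast
        have "F (nat_vec u' + beta g k) \<noteq> 0" using nz(1) by (simp add: c mcoeff_ramify_scale n_pos)
        moreover have "basis_exp k \<le> d" using nz(2) lead_exp_basis [of k] by (simp add: lead_exp_def)
        ultimately show False using below [OF uk(1)] cd c by blast
      qed
    qed
  qed
  also have "\<dots> \<noteq> 0"
    using uk(3) lead_exp_basis [of k] by (simp add: mcoeff_ramify_scale n_pos lead_exp_def)
  finally have "mcoeff (elem F) w \<noteq> 0" .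
  moreover have "xexp n w \<le> nat_vec u0 + beta g k0"
    using w(2) xexp_le_iff [OF n_pos, of w w0] by (simp add: w0_def xexp_basis_point)
  ultimately show thesis by (rule that)
qed

lemma elem_eq_0:
  assumes "elem F = 0" "\<gamma> \<in> \<Gamma>"
  shows "F \<gamma> = 0"
proof (rule ccontr)
  assume nz: "F \<gamma> \<noteq> 0"
  obtain u k where "k < n" "\<gamma> = nat_vec u + beta g k" using assms(2) by (auto simp: semigroup_eq_beta)
  with nz show False using elem_minimal_support [of k F u] assms(1) by auto
qed

text \<open>Below each point of the support of \<open>F\<close> lies an exponent of
  \<open>elem F\<close>, and below each exponent a point of the support; pairing with a non-negative
  \<open>v\<close> is monotone, so the infima agree.\<close>

lemma monomial_val_elem:
  fixes v :: "real ^ 'd"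
  assumes v: "\<And>i. 0 \<le> v $ i"
  shows "monomial_val n v (elem F) = (INF \<gamma>\<in>{\<gamma>\<in>\<Gamma>. F \<gamma> \<noteq> 0}. ereal (v \<bullet> \<gamma>))"
proof -
  have mono: "v \<bullet> a \<le> v \<bullet> b" if "a \<le> b" for a b
    using that v by (auto simp: inner_vec_def fvec_le intro!: sum_mono mult_left_mono)
  show ?thesis
    unfolding monomial_val_def
  proof (rule antisym)
    show "(INF u\<in>{u. mcoeff (elem F) u \<noteq> 0}. ereal (v \<bullet> xexp n u)) \<le> (INF \<gamma>\<in>{\<gamma>\<in>\<Gamma>. F \<gamma> \<noteq> 0}. ereal (v \<bullet> \<gamma>))"
    proof (rule INF_greatest)
      fix \<gamma> assume \<gamma>: "\<gamma> \<in> {\<gamma>\<in>\<Gamma>. F \<gamma> \<noteq> 0}"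
      then obtain u k where "k < n" "\<gamma> = nat_vec u + beta g k" by (auto simp: semigroup_eq_beta)
      then obtain w where "mcoeff (elem F) w \<noteq> 0" "xexp n w \<le> \<gamma>"
        using elem_minimal_support [of k F u] \<gamma> by auto
      then show "(INF u\<in>{u. mcoeff (elem F) u \<noteq> 0}. ereal (v \<bullet> xexp n u)) \<le> ereal (v \<bullet> \<gamma>)"
        using mono by (intro INF_lower2 [of w]) auto
    qed
    show "(INF \<gamma>\<in>{\<gamma>\<in>\<Gamma>. F \<gamma> \<noteq> 0}. ereal (v \<bullet> \<gamma>)) \<le> (INF u\<in>{u. mcoeff (elem F) u \<noteq> 0}. ereal (v \<bullet> xexp n u))"
    proof (rule INF_greatest)
      fix w assume "w \<in> {u. mcoeff (elem F) u \<noteq> 0}"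
      then have "mcoeff (elem F) w \<noteq> 0" by simp
      then obtain u k where uk: "k < n" "F (nat_vec u + beta g k) \<noteq> 0" "n *s u + basis_exp k \<le> w"
        by (rule elem_support)
      then have "nat_vec u + beta g k \<le> xexp n w"
        using xexp_le_iff [OF n_pos, of "n *s u + basis_exp k" w] by (simp add: xexp_basis_point)
      moreover have "nat_vec u + beta g k \<in> \<Gamma>" using uk(1) by (auto simp: semigroup_eq_beta)
      ultimately show "(INF \<gamma>\<in>{\<gamma>\<in>\<Gamma>. F \<gamma> \<noteq> 0}. ereal (v \<bullet> \<gamma>)) \<le> ereal (v \<bullet> xexp n w)"
        using mono uk(2) by (intro INF_lower2 [of "nat_vec u + beta g k"]) auto
    qed
  qed
qed

end

section \<open>The iterated associated graded ring\<close>

context vector_space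
begin

lemma quotient_basis_iff:
  "quotient_basis scale A B X \<longleftrightarrow> X \<subseteq> A \<and> independent X \<and> span X \<inter> B = {0} \<and>
     A = {x + b | x b. x \<in> span X \<and> b \<in> B}"
  by (simp add: quotient_basis_def)

text \<open>\<open>quotient_dim\<close> takes an arbitrary basis, so bases must have the same size.
  Each element of \<open>X\<close> is replaced by a representative in the span of \<open>Y\<close>
  modulo \<open>B\<close>; as the span of \<open>X\<close> meets \<open>B\<close> only in 0, these
  stay distinct and independent.\<close>

lemma quotient_basis_card_le:
  assumes X: "quotient_basis scale A B X" and Y: "quotient_basis scale A B Y" and B: "subspace B"
    and fin: "finite Y"
  shows "finite X \<and> card X \<le> card Y"
proof -
  have X': "X \<subseteq> A" "independent X" "span X \<inter> B = {0}" using X unfolding quotient_basis_iff by auto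
  have "\<exists>y. y \<in> span Y \<and> x - y \<in> B" if "x \<in> X" for x
  proof -
    have "A = {x + b | x b. x \<in> span Y \<and> b \<in> B}" using Y unfolding quotient_basis_iff by (elim conjE)
    then have "x \<in> {x + b | x b. x \<in> span Y \<and> b \<in> B}" using that X'(1) by blast
    then show ?thesis by auto
  qed
  then obtain p where p: "\<And>x. x \<in> X \<Longrightarrow> p x \<in> span Y" "\<And>x. x \<in> X \<Longrightarrow> x - p x \<in> B" by metis
  have inj: "inj_on p X"
  proof (rule inj_onI)
    fix x x' assume x: "x \<in> X" "x' \<in> X" "p x = p x'"
    have "(x - p x) - (x' - p x') \<in> B" by (rule subspace_diff [OF B p(2) p(2)]) (fact x)+
    then have "x - x' \<in> B" using x(3) by simp
    moreover have "x - x' \<in> span X" using x by (simp add: span_base span_diff)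
    ultimately have "x - x' \<in> {0}" unfolding X'(3) [symmetric] by (rule IntI [rotated])
    then show "x = x'" by simp
  qed
  have "independent (p ` X)"
  proof
    assume "dependent (p ` X)"
    then obtain S u y where S: "finite S" "S \<subseteq> p ` X" "y \<in> S" and sum0: "(\<Sum>v\<in>S. scale (u v) v) = 0" and nz: "u y \<noteq> 0"
      unfolding dependent_explicit by blast
    obtain T where T: "T \<subseteq> X" "S = p ` T" using S(2) by (auto simp: subset_image_iff)
    have injT: "inj_on p T" using inj T(1) by (rule inj_on_subset)
    have finT: "finite T" using S(1) injT by (simp add: T(2) finite_image_iff)
    have s0: "(\<Sum>x\<in>T. scale (u (p x)) (p x)) = 0" using sum0 by (simp add: T(2) sum.reindex [OF injT])
    have "(\<Sum>x\<in>T. scale (u (p x)) x) = (\<Sum>x\<in>T. scale (u (p x)) (x - p x)) + (\<Sum>x\<in>T. scale (u (p x)) (p x))"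
      by (simp add: sum.distrib [symmetric] scale_right_diff_distrib)
    also have "\<dots> \<in> B"
      unfolding s0 add_0_right
      by (intro subspace_sum [OF B] subspace_scale [OF B] p(2)) (use T(1) in blast)
    finally have "(\<Sum>x\<in>T. scale (u (p x)) x) \<in> B" .
    moreover have "(\<Sum>x\<in>T. scale (u (p x)) x) \<in> span X"
      by (intro span_sum span_scale span_base) (use T(1) in blast)
    ultimately have "(\<Sum>x\<in>T. scale (u (p x)) x) \<in> {0}" unfolding X'(3) [symmetric] by (rule IntI [rotated])
    then have "(\<Sum>x\<in>T. scale (u (p x)) x) = 0" by simp
    then have "u (p x) = 0" if "x \<in> T" for x
      using X'(2) finT T(1) that independentD [of X T "\<lambda>x. u (p x)"] by blast
    then show False using S(3) nz T(2) by auto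
  qed
  then have "finite (p ` X) \<and> card (p ` X) \<le> card Y"
    by (intro independent_span_bound fin) (use p in auto)
  then show ?thesis using inj by (simp add: finite_image_iff card_image)
qed

text \<open>The basis picked by \<open>SOME\<close> could a priori be infinite; the comparison with
  the finite \<open>Y\<close> rules this out.\<close>

lemma quotient_dim_eq_card:
  assumes Y: "quotient_basis scale A B Y" and B: "subspace B" and fin: "finite Y"
  shows "quotient_dim scale A B = card Y"
proof -
  define X where "X = (SOME X. quotient_basis scale A B X)"
  have X: "quotient_basis scale A B X" unfolding X_def by (rule someI [where P = "quotient_basis scale A B", OF Y])
  have "finite X" "card X \<le> card Y" using quotient_basis_card_le [OF X Y B fin] by auto
  moreover from this have "card Y \<le> card X" using quotient_basis_card_le [OF Y X B] by blast
  ultimately show ?thesis by (simp add: quotient_dim_def X_def)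
qed

end

text \<open>The ring is identified through \<open>S\<close> with the space of all functions on \<open>D\<^sub>0\<close>. Every
  component of the iterated graded ring is then \<open>vanishing X / vanishing (X \<union> D)\<close>, which is the
  space of functions on \<open>D\<close>.\<close>

locale coordinates = vector_space scale
  for scale :: "'k::field \<Rightarrow> 'b::ab_group_add \<Rightarrow> 'b" +
  fixes D0 :: "'g set" and S :: "('g \<Rightarrow> 'k) \<Rightarrow> 'b"
  assumes S_add: "S (\<lambda>\<gamma>. F \<gamma> + F' \<gamma>) = S F + S F'"
    and S_scale: "S (\<lambda>\<gamma>. c * F \<gamma>) = scale c (S F)"
    and S_eq_0: "S F = 0 \<Longrightarrow> \<gamma> \<in> D0 \<Longrightarrow> F \<gamma> = 0"
begin

definition vanishing :: "'g set \<Rightarrow> 'b set" where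
  "vanishing X = {S F | F. (\<forall>\<gamma>. \<gamma> \<notin> D0 \<longrightarrow> F \<gamma> = 0) \<and> (\<forall>\<gamma>\<in>X. F \<gamma> = 0)}"

lemma S_zero: "S (\<lambda>_. 0) = 0"
proof -
  have "S (\<lambda>_. 0 * 0) = scale 0 (S (\<lambda>_. 0))" by (rule S_scale)
  then show ?thesis by (simp only: mult_zero_left scale_zero_left)
qed

lemma S_diff: "S (\<lambda>\<gamma>. F \<gamma> - F' \<gamma>) = S F - S F'"
  using S_add [of "\<lambda>\<gamma>. F \<gamma> - F' \<gamma>" F'] by simp

lemma S_mem_vanishing:
  assumes F: "\<And>\<gamma>. \<gamma> \<notin> D0 \<Longrightarrow> F \<gamma> = 0" and X: "X \<subseteq> D0"
  shows "S F \<in> vanishing X \<longleftrightarrow> (\<forall>\<gamma>\<in>X. F \<gamma> = 0)"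
proof
  assume "S F \<in> vanishing X"
  then obtain F' where F': "S F = S F'" "\<And>\<gamma>. \<gamma> \<in> X \<Longrightarrow> F' \<gamma> = 0"
    by (auto simp: vanishing_def)
  then have "S (\<lambda>\<gamma>. F \<gamma> - F' \<gamma>) = 0" by (simp add: S_diff)
  then show "\<forall>\<gamma>\<in>X. F \<gamma> = 0" using S_eq_0 [of "\<lambda>\<gamma>. F \<gamma> - F' \<gamma>"] F'(2) X by auto
qed (use F in \<open>auto simp: vanishing_def\<close>)

lemma vanishingE:
  assumes "h \<in> vanishing X"
  obtains F where "h = S F" "\<And>\<gamma>. \<gamma> \<notin> D0 \<Longrightarrow> F \<gamma> = 0" "\<And>\<gamma>. \<gamma> \<in> X \<Longrightarrow> F \<gamma> = 0"
  using assms by (auto simp: vanishing_def)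

lemma subspace_vanishing: "subspace (vanishing X)"
proof (rule subspaceI)
  show "0 \<in> vanishing X" unfolding vanishing_def by (rule CollectI, rule exI [of _ "\<lambda>_. 0"]) (simp add: S_zero)
next
  fix x y assume "x \<in> vanishing X" "y \<in> vanishing X"
  then obtain F F' where "x = S F" "y = S F'"
    "\<And>\<gamma>. \<gamma> \<notin> D0 \<Longrightarrow> F \<gamma> = 0" "\<And>\<gamma>. \<gamma> \<in> X \<Longrightarrow> F \<gamma> = 0"
    "\<And>\<gamma>. \<gamma> \<notin> D0 \<Longrightarrow> F' \<gamma> = 0" "\<And>\<gamma>. \<gamma> \<in> X \<Longrightarrow> F' \<gamma> = 0"
    by (metis vanishingE)
  then show "x + y \<in> vanishing X"
    unfolding vanishing_def by (intro CollectI exI [of _ "\<lambda>\<gamma>. F \<gamma> + F' \<gamma>"]) (simp add: S_add)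
next
  fix c x assume "x \<in> vanishing X"
  then obtain F where "x = S F" "\<And>\<gamma>. \<gamma> \<notin> D0 \<Longrightarrow> F \<gamma> = 0" "\<And>\<gamma>. \<gamma> \<in> X \<Longrightarrow> F \<gamma> = 0"
    by (rule vanishingE) blast
  then show "scale c x \<in> vanishing X"
    unfolding vanishing_def by (intro CollectI exI [of _ "\<lambda>\<gamma>. c * F \<gamma>"]) (simp add: S_scale)
qed

text \<open>A minimum is at least \<open>a\<close> exactly if the support avoids the weights below
  \<open>a\<close>. The formula for \<open>w\<close> is demanded on \<open>vanishing X\<close> only,
  because an induced valuation is known only on the current component.\<close>

lemma vanishing_ge:
  fixes w :: "'b \<Rightarrow> ereal" and q :: "'g \<Rightarrow> nat"
  assumes X: "X \<subseteq> D0" "D \<subseteq> D0"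
    and w: "\<And>F. (\<And>\<gamma>. \<gamma> \<notin> D0 \<Longrightarrow> F \<gamma> = 0) \<Longrightarrow> (\<And>\<gamma>. \<gamma> \<in> X \<Longrightarrow> F \<gamma> = 0) \<Longrightarrow>
      w (S F) = (INF \<gamma>\<in>{\<gamma>\<in>D. F \<gamma> \<noteq> 0}. ereal (real (q \<gamma>)))"
  shows "{h \<in> vanishing X. w h \<ge> ereal (real a)} = vanishing (X \<union> {\<gamma>\<in>D. q \<gamma> < a})"
proof -
  have iff: "w (S F) \<ge> ereal (real a) \<longleftrightarrow> (\<forall>\<gamma>\<in>{\<gamma>\<in>D. q \<gamma> < a}. F \<gamma> = 0)"
    if "\<And>\<gamma>. \<gamma> \<notin> D0 \<Longrightarrow> F \<gamma> = 0" "\<And>\<gamma>. \<gamma> \<in> X \<Longrightarrow> F \<gamma> = 0" for F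
  proof -
    have "w (S F) = (INF \<gamma>\<in>{\<gamma>\<in>D. F \<gamma> \<noteq> 0}. ereal (real (q \<gamma>)))" by (rule w) (fact that)+
    then have "w (S F) \<ge> ereal (real a) \<longleftrightarrow> (\<forall>\<gamma>\<in>{\<gamma>\<in>D. F \<gamma> \<noteq> 0}. a \<le> q \<gamma>)"
      by (simp only: le_INF_iff ereal_less_eq of_nat_le_iff)
    then show ?thesis using not_le [of a] by blast
  qed
  show ?thesis
  proof (intro equalityI subsetI)
    fix h assume "h \<in> {h \<in> vanishing X. w h \<ge> ereal (real a)}"
    then obtain F where F: "h = S F" "\<And>\<gamma>. \<gamma> \<notin> D0 \<Longrightarrow> F \<gamma> = 0" "\<And>\<gamma>. \<gamma> \<in> X \<Longrightarrow> F \<gamma> = 0" "w (S F) \<ge> ereal (real a)"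
      by (auto elim: vanishingE)
    then show "h \<in> vanishing (X \<union> {\<gamma>\<in>D. q \<gamma> < a})"
      using iff [OF F(2,3)] by (auto simp: vanishing_def)
  next
    fix h assume "h \<in> vanishing (X \<union> {\<gamma>\<in>D. q \<gamma> < a})"
    then obtain F where F: "h = S F" "\<And>\<gamma>. \<gamma> \<notin> D0 \<Longrightarrow> F \<gamma> = 0" "\<And>\<gamma>. \<gamma> \<in> X \<union> {\<gamma>\<in>D. q \<gamma> < a} \<Longrightarrow> F \<gamma> = 0"
      by (rule vanishingE) blast
    have "w (S F) \<ge> ereal (real a)" using iff [of F] F(2,3) by auto
    moreover have "S F \<in> vanishing X" using F by (auto simp: vanishing_def)
    ultimately show "h \<in> {h \<in> vanishing X. w h \<ge> ereal (real a)}" using F(1) by simp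
  qed
qed

text \<open>One step moves the points of too small weight into \<open>X\<close> and keeps in
  \<open>D\<close> those of weight \<open>a i\<close>. The induced valuations are again minima over
  the support, now within the smaller \<open>D\<close>, so the induction varies \<open>X\<close>,
  \<open>D\<close> and \<open>w\<close>.\<close>

lemma gr_component_vanishing:
  fixes w :: "'i \<Rightarrow> 'b \<Rightarrow> ereal" and q :: "'i \<Rightarrow> 'g \<Rightarrow> nat" and a :: "'i \<Rightarrow> nat"
  assumes "X \<inter> D = {}" "X \<union> D \<subseteq> D0"
    and "\<And>i F. i \<in> set is \<Longrightarrow> (\<And>\<gamma>. \<gamma> \<notin> D0 \<Longrightarrow> F \<gamma> = 0) \<Longrightarrow> (\<And>\<gamma>. \<gamma> \<in> X \<Longrightarrow> F \<gamma> = 0) \<Longrightarrow>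
      w i (S F) = (INF \<gamma>\<in>{\<gamma>\<in>D. F \<gamma> \<noteq> 0}. ereal (real (q i \<gamma>)))"
  defines "D' \<equiv> {\<gamma>\<in>D. \<forall>i\<in>set is. q i \<gamma> = a i}"
  shows "\<exists>X'. X' \<inter> D' = {} \<and> X' \<union> D' \<subseteq> D0 \<and>
    gr_component (vanishing X) (vanishing (X \<union> D)) (map w is) (map a is) = (vanishing X', vanishing (X' \<union> D'))"
  using assms(1-3) unfolding D'_def
proof (induction "is" arbitrary: X D w)
  case Nil
  then show ?case by auto
next
  case (Cons i "is")
  define X1 where "X1 = X \<union> {\<gamma>\<in>D. q i \<gamma> < a i}"
  define D1 where "D1 = {\<gamma>\<in>D. q i \<gamma> = a i}"
  have sub: "X \<subseteq> D0" "D \<subseteq> D0" using Cons.prems by auto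
  have sub1: "X1 \<subseteq> D0" "X1 \<union> D1 \<subseteq> D0" "X1 \<inter> D1 = {}"
    using Cons.prems(1,2) by (auto simp: X1_def D1_def)
  have wi: "w i (S F) = (INF \<gamma>\<in>{\<gamma>\<in>D. F \<gamma> \<noteq> 0}. ereal (real (q i \<gamma>)))"
    if "\<And>\<gamma>. \<gamma> \<notin> D0 \<Longrightarrow> F \<gamma> = 0" "\<And>\<gamma>. \<gamma> \<in> X \<Longrightarrow> F \<gamma> = 0" for F
    by (rule Cons.prems(3)) (simp, fact that, fact that)
  have A': "{h \<in> vanishing X. w i h \<ge> ereal (real (a i))} = vanishing X1"
    unfolding X1_def by (rule vanishing_ge [OF sub wi])
  \<comment> \<open>Weights are natural numbers, so the bound \<open>a i + 1\<close> excludes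
    exactly the weights up to \<open>a i\<close>.\<close>
  have "X \<union> {\<gamma>\<in>D. q i \<gamma> < Suc (a i)} = X1 \<union> D1" by (auto simp: X1_def D1_def)
  moreover have "{h \<in> vanishing X. w i h \<ge> ereal (real (Suc (a i)))} = vanishing (X \<union> {\<gamma>\<in>D. q i \<gamma> < Suc (a i)})"
    by (rule vanishing_ge [OF sub wi])
  ultimately have B': "{h \<in> vanishing X. w i h \<ge> ereal (real (a i) + 1)} = vanishing (X1 \<union> D1)"
    by (simp only: of_nat_Suc add.commute)
  define w1 where "w1 j h = (SUP h'\<in>{h' \<in> vanishing X1. h' - h \<in> vanishing (X1 \<union> D1)}. w j h')" for j h
  have w1: "w1 j (S F) = (INF \<gamma>\<in>{\<gamma>\<in>D1. F \<gamma> \<noteq> 0}. ereal (real (q j \<gamma>)))"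
    if j: "j \<in> set is" and F: "\<And>\<gamma>. \<gamma> \<notin> D0 \<Longrightarrow> F \<gamma> = 0" "\<And>\<gamma>. \<gamma> \<in> X1 \<Longrightarrow> F \<gamma> = 0" for j F
  proof (rule antisym)
    show "w1 j (S F) \<le> (INF \<gamma>\<in>{\<gamma>\<in>D1. F \<gamma> \<noteq> 0}. ereal (real (q j \<gamma>)))"
      unfolding w1_def
    proof (rule SUP_least)
      fix h' assume h': "h' \<in> {h' \<in> vanishing X1. h' - S F \<in> vanishing (X1 \<union> D1)}"
      then obtain F' where F': "h' = S F'" "\<And>\<gamma>. \<gamma> \<notin> D0 \<Longrightarrow> F' \<gamma> = 0" "\<And>\<gamma>. \<gamma> \<in> X1 \<Longrightarrow> F' \<gamma> = 0"
        by (auto elim: vanishingE)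
      have "S (\<lambda>\<gamma>. F' \<gamma> - F \<gamma>) \<in> vanishing (X1 \<union> D1)" using h' F'(1) by (simp add: S_diff)
      moreover have "F' \<gamma> - F \<gamma> = 0" if "\<gamma> \<notin> D0" for \<gamma>
        using F(1) [OF that] F'(2) [OF that] by simp
      ultimately have "\<forall>\<gamma>\<in>X1 \<union> D1. F' \<gamma> - F \<gamma> = 0"
        using S_mem_vanishing [OF _ sub1(2), of "\<lambda>\<gamma>. F' \<gamma> - F \<gamma>"] by blast
      \<comment> \<open>A representative is free only outside \<open>X1 \<union> D1\<close>: its
        support in \<open>D\<close> contains that of \<open>F\<close> in \<open>D1\<close>, so its
        value cannot be larger.\<close>
      then have eq: "F' \<gamma> = F \<gamma>" if "\<gamma> \<in> D1" for \<gamma> using that by simp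
      have "w j h' = (INF \<gamma>\<in>{\<gamma>\<in>D. F' \<gamma> \<noteq> 0}. ereal (real (q j \<gamma>)))"
        unfolding F'(1)
        by (rule Cons.prems(3)) (use j in simp, rule F'(2), assumption, rule F'(3), simp add: X1_def)
      also have "\<dots> \<le> (INF \<gamma>\<in>{\<gamma>\<in>D1. F \<gamma> \<noteq> 0}. ereal (real (q j \<gamma>)))"
      proof (rule INF_superset_mono)
        show "{\<gamma>\<in>D1. F \<gamma> \<noteq> 0} \<subseteq> {\<gamma>\<in>D. F' \<gamma> \<noteq> 0}" using eq by (simp add: D1_def subset_iff)
      qed simp
      finally show "w j h' \<le> (INF \<gamma>\<in>{\<gamma>\<in>D1. F \<gamma> \<noteq> 0}. ereal (real (q j \<gamma>)))" .
    qed
    \<comment> \<open>The best representative: the support outside \<open>D1\<close> is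
      deleted.\<close>
    define F1 where "F1 \<gamma> = (if \<gamma> \<in> D1 then F \<gamma> else 0)" for \<gamma>
    have F1: "\<gamma> \<notin> D0 \<Longrightarrow> F1 \<gamma> = 0" "\<gamma> \<in> X1 \<Longrightarrow> F1 \<gamma> = 0" for \<gamma>
      using F by (auto simp: F1_def)
    have "S F1 \<in> vanishing X1" using F1 by (auto simp: vanishing_def)
    moreover have "S (\<lambda>\<gamma>. F1 \<gamma> - F \<gamma>) \<in> vanishing (X1 \<union> D1)"
    proof (subst S_mem_vanishing)
      show "F1 \<gamma> - F \<gamma> = 0" if "\<gamma> \<notin> D0" for \<gamma> using F(1) [OF that] F1(1) [OF that] by simp
      show "\<forall>\<gamma>\<in>X1 \<union> D1. F1 \<gamma> - F \<gamma> = 0" using F(2) F1(2) by (auto simp: F1_def)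
    qed (fact sub1)
    ultimately have "w j (S F1) \<le> w1 j (S F)"
      unfolding w1_def by (intro SUP_upper) (simp add: S_diff)
    moreover have "w j (S F1) = (INF \<gamma>\<in>{\<gamma>\<in>D. F1 \<gamma> \<noteq> 0}. ereal (real (q j \<gamma>)))"
      by (rule Cons.prems(3)) (use j in simp, rule F1(1), assumption, rule F1(2), simp add: X1_def)
    moreover have "{\<gamma>\<in>D. F1 \<gamma> \<noteq> 0} = {\<gamma>\<in>D1. F \<gamma> \<noteq> 0}" by (auto simp: F1_def D1_def)
    ultimately show "(INF \<gamma>\<in>{\<gamma>\<in>D1. F \<gamma> \<noteq> 0}. ereal (real (q j \<gamma>))) \<le> w1 j (S F)" by simp
  qed
  have "gr_component (vanishing X) (vanishing (X \<union> D)) (map w (i # is)) (map a (i # is)) =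
      gr_component (vanishing X1) (vanishing (X1 \<union> D1)) (map w1 is) (map a is)"
    by (simp add: Let_def A' B' w1_def [abs_def] comp_def)
  moreover have "{\<gamma>\<in>D. \<forall>i\<in>set (i # is). q i \<gamma> = a i} = {\<gamma>\<in>D1. \<forall>i\<in>set is. q i \<gamma> = a i}"
    by (auto simp: D1_def)
  moreover have "\<exists>X'. X' \<inter> {\<gamma>\<in>D1. \<forall>i\<in>set is. q i \<gamma> = a i} = {} \<and> X' \<union> {\<gamma>\<in>D1. \<forall>i\<in>set is. q i \<gamma> = a i} \<subseteq> D0 \<and>
      gr_component (vanishing X1) (vanishing (X1 \<union> D1)) (map w1 is) (map a is) =
        (vanishing X', vanishing (X' \<union> {\<gamma>\<in>D1. \<forall>i\<in>set is. q i \<gamma> = a i}))"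
    by (rule Cons.IH [OF sub1(3,2) w1])
  ultimately show ?case by simp
qed

text \<open>The indicator functions of the points of \<open>D\<close> give the basis. Finiteness of
  \<open>D\<close> matters, as spans allow only finite combinations.\<close>

lemma quotient_dim_vanishing:
  assumes X: "X \<inter> D = {}" "X \<union> D \<subseteq> D0" and fin: "finite D"
  shows "quotient_dim scale (vanishing X) (vanishing (X \<union> D)) = card D"
proof -
  define b where "b \<gamma> = S (\<lambda>\<gamma>'. if \<gamma>' = \<gamma> then 1 else 0)" for \<gamma>
  have comb: "(\<Sum>\<gamma>\<in>T. scale (c \<gamma>) (b \<gamma>)) = S (\<lambda>\<gamma>. if \<gamma> \<in> T then c \<gamma> else 0)" if "finite T" for T c
    using that
  proof (induction T rule: finite_induct)
    case (insert \<gamma>0 T)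
    have "scale (c \<gamma>0) (b \<gamma>0) + S (\<lambda>\<gamma>. if \<gamma> \<in> T then c \<gamma> else 0) =
        S (\<lambda>\<gamma>. c \<gamma>0 * (if \<gamma> = \<gamma>0 then 1 else 0) + (if \<gamma> \<in> T then c \<gamma> else 0))"
      by (simp only: b_def S_scale [symmetric] S_add)
    also have "(\<lambda>\<gamma>. c \<gamma>0 * (if \<gamma> = \<gamma>0 then 1 else 0) + (if \<gamma> \<in> T then c \<gamma> else 0)) =
        (\<lambda>\<gamma>. if \<gamma> \<in> insert \<gamma>0 T then c \<gamma> else 0)"
      using insert.hyps by auto
    finally show ?case using insert by simp
  qed (simp add: S_zero)
  have inj: "inj_on b D"
  proof (rule inj_onI)
    fix x y assume xy: "x \<in> D" "y \<in> D" "b x = b y"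
    then have "S (\<lambda>\<gamma>. (if \<gamma> = x then 1 else 0) - (if \<gamma> = y then 1 else 0)) = 0"
      by (simp add: b_def S_diff)
    then have "(if x = x then 1 else 0) - (if x = y then 1 else 0) = (0 :: 'k)"
      using xy(1) X(2) by (intro S_eq_0) auto
    then show "x = y" by (simp split: if_splits)
  qed
  have span: "span (b ` D) = {S (\<lambda>\<gamma>. if \<gamma> \<in> D then c \<gamma> else 0) | c. True}"
  proof -
    have "span (b ` D) = (\<lambda>u. \<Sum>v\<in>b ` D. scale (u v) v) ` UNIV"
      using fin by (simp add: span_finite)
    also have "\<dots> = (\<lambda>c. \<Sum>\<gamma>\<in>D. scale (c \<gamma>) (b \<gamma>)) ` UNIV"
    proof (intro equalityI image_subsetI)
      fix u show "(\<Sum>v\<in>b ` D. scale (u v) v) \<in> (\<lambda>c. \<Sum>\<gamma>\<in>D. scale (c \<gamma>) (b \<gamma>)) ` UNIV"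
        by (rule image_eqI [of _ _ "\<lambda>\<gamma>. u (b \<gamma>)"]) (simp_all add: sum.reindex [OF inj])
      fix c show "(\<Sum>\<gamma>\<in>D. scale (c \<gamma>) (b \<gamma>)) \<in> (\<lambda>u. \<Sum>v\<in>b ` D. scale (u v) v) ` UNIV"
        by (rule image_eqI [of _ _ "\<lambda>v. c (inv_into D b v)"])
           (simp_all add: sum.reindex [OF inj] inv_into_f_f [OF inj])
    qed
    finally show ?thesis by (auto simp: comb [OF fin])
  qed
  have "quotient_basis scale (vanishing X) (vanishing (X \<union> D)) (b ` D)"
    unfolding quotient_basis_iff
  proof (intro conjI)
    show sub: "b ` D \<subseteq> vanishing X"
      using X by (auto simp: b_def vanishing_def intro!: exI)
    show "independent (b ` D)"
    proof (rule independent_if_scalars_zero)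
      show "finite (b ` D)" using fin by simp
      fix u x assume "(\<Sum>x\<in>b ` D. scale (u x) x) = 0" and x: "x \<in> b ` D"
      then have "S (\<lambda>\<gamma>. if \<gamma> \<in> D then u (b \<gamma>) else 0) = 0"
        by (simp add: sum.reindex [OF inj] comb [OF fin])
      moreover obtain \<gamma> where "\<gamma> \<in> D" "x = b \<gamma>" using x by blast
      ultimately show "u x = 0"
        using S_eq_0 [of "\<lambda>\<gamma>. if \<gamma> \<in> D then u (b \<gamma>) else 0" \<gamma>] X(2) by auto
    qed
    show "span (b ` D) \<inter> vanishing (X \<union> D) = {0}"
    proof
      show "span (b ` D) \<inter> vanishing (X \<union> D) \<subseteq> {0}"
      proof
        fix h assume h: "h \<in> span (b ` D) \<inter> vanishing (X \<union> D)"
        then obtain c where c: "h = S (\<lambda>\<gamma>. if \<gamma> \<in> D then c \<gamma> else 0)" by (auto simp: span)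
        then have "\<forall>\<gamma>\<in>X \<union> D. (if \<gamma> \<in> D then c \<gamma> else 0) = 0"
          using h X(2) by (subst S_mem_vanishing [symmetric]) auto
        then have "(\<lambda>\<gamma>. if \<gamma> \<in> D then c \<gamma> else 0) = (\<lambda>_. 0)" by (intro ext) (metis UnI2)
        then show "h \<in> {0}" by (simp add: c S_zero)
      qed
      show "{0} \<subseteq> span (b ` D) \<inter> vanishing (X \<union> D)"
        using subspace_0 [OF subspace_vanishing] by (simp add: span_zero)
    qed
    show "vanishing X = {x + y |x y. x \<in> span (b ` D) \<and> y \<in> vanishing (X \<union> D)}"
    proof
      show "vanishing X \<subseteq> {x + y |x y. x \<in> span (b ` D) \<and> y \<in> vanishing (X \<union> D)}"
      proof
        fix h assume "h \<in> vanishing X"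
        then obtain F where F: "h = S F" "\<And>\<gamma>. \<gamma> \<notin> D0 \<Longrightarrow> F \<gamma> = 0" "\<And>\<gamma>. \<gamma> \<in> X \<Longrightarrow> F \<gamma> = 0"
          by (rule vanishingE) blast
        let ?F1 = "\<lambda>\<gamma>. if \<gamma> \<in> D then F \<gamma> else 0" and ?F2 = "\<lambda>\<gamma>. if \<gamma> \<in> D then 0 else F \<gamma>"
        have "(\<lambda>\<gamma>. ?F1 \<gamma> + ?F2 \<gamma>) = F" by auto
        then have "h = S ?F1 + S ?F2" using F(1) S_add [of ?F1 ?F2] by simp
        moreover have "S ?F1 \<in> span (b ` D)" by (auto simp: span)
        moreover have "S ?F2 \<in> vanishing (X \<union> D)" using F by (auto simp: vanishing_def intro!: exI)
        ultimately show "h \<in> {x + y |x y. x \<in> span (b ` D) \<and> y \<in> vanishing (X \<union> D)}" by blast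
      qed
      have "span (b ` D) \<subseteq> vanishing X" by (rule span_minimal [OF sub subspace_vanishing])
      moreover have "vanishing (X \<union> D) \<subseteq> vanishing X" by (auto simp: vanishing_def)
      ultimately show "{x + y |x y. x \<in> span (b ` D) \<and> y \<in> vanishing (X \<union> D)} \<subseteq> vanishing X"
        using subspace_add [OF subspace_vanishing] by blast
    qed
  qed
  then have "quotient_dim scale (vanishing X) (vanishing (X \<union> D)) = card (b ` D)"
    using subspace_vanishing fin by (intro quotient_dim_eq_card) auto
  then show ?thesis by (simp add: card_image [OF inj])
qed

end

section \<open>The Poincare series\<close>

lemma cone_\<sigma>_nonneg:
  assumes "v \<in> cone_\<sigma>"
  shows "0 \<le> v $ k"
proof -
  have "cone_\<sigma> \<subseteq> {x. axis k 1 \<bullet> x \<ge> 0}"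
    unfolding cone_\<sigma>_def
    by (rule hull_minimal [where S = convex_cone, OF _ convex_cone_halfspace_ge]) (auto simp: inner_axis_axis)
  then show ?thesis using assms by (auto simp: inner_axis')
qed

lemma interior_cone_\<sigma>_pos:
  assumes "v \<in> interior cone_\<sigma>"
  shows "0 < v $ k"
proof -
  have "cone_\<sigma> \<subseteq> {x :: real ^ 'a. axis k 1 \<bullet> x \<ge> 0}"
    using cone_\<sigma>_nonneg by (auto simp: inner_axis')
  then have "interior cone_\<sigma> \<subseteq> interior {x :: real ^ 'a. axis k 1 \<bullet> x \<ge> 0}" by (rule interior_mono)
  also have "\<dots> = {x. axis k 1 \<bullet> x > 0}"
    by (rule interior_halfspace_ge) (simp add: axis_eq_0_iff)
  finally show ?thesis using assms by (auto simp: inner_axis')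
qed

lemma mconst_add: "mconst (a + b) = mconst a + (mconst b :: ('a::comm_ring_1, 'i::finite) mfps)"
  by (simp add: mfps_eq_iff mconst_def)

lemma mconst_1: "mconst 1 = (1 :: ('a::comm_ring_1, 'i::finite) mfps)"
  by (simp add: mfps_eq_iff mconst_def mcoeff_one)

lemma mconst_mult: "mconst (a * b) = mconst a * (mconst b :: ('a::comm_ring_1, 'i::finite) mfps)"
  by (rule mfps_eqI) (simp add: mcoeff_mconst_mult, simp add: mconst_def)

lemma vector_space_mconst: "vector_space (\<lambda>c (h :: ('a::field, 'i::finite) mfps). mconst c * h)"
  by unfold_locales (simp_all add: mconst_add mconst_1 mconst_mult algebra_simps)

lemma to_fract_prod: "to_fract (prod h A) = (\<Prod>x\<in>A. to_fract (h x))"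
  by (induction A rule: infinite_finite_induct) simp_all

lemma finite_vec_atMost: "finite {u :: nat ^ 'i::finite. u \<le> c}"
proof -
  have "{u :: nat ^ 'i. u \<le> c} \<subseteq> fst ` splits c"
    by (force simp: splits_def image_iff dest: vec_nat_le_diff)
  then show ?thesis by (rule finite_subset) simp
qed

text \<open>The index \<open>r0\<close> marks a weight vector with positive coordinates; it provides
  finite fibres and nonzero denominators.\<close>

locale weighted_branch = quasi_ordinary_branch f \<zeta>
  for f :: "(complex, 'd::finite) mfps poly" and \<zeta> +
  fixes v :: "'r::finite \<Rightarrow> real ^ 'd" and r0 :: 'r
  assumes v_nonneg: "0 \<le> v r $ k" and v_pos: "0 < v r0 $ k"
    and v_dual: "v r \<in> dual_lattice (M g)"
begin

text \<open>On \<Gamma> the pairing is a natural number by duality and non-negativity, so the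
  rounding changes nothing there (\<open>wt_real\<close>).\<close>

definition wt :: "real ^ 'd \<Rightarrow> nat ^ 'r" where
  "wt \<gamma> = (\<chi> r. nat \<lfloor>v r \<bullet> \<gamma>\<rfloor>)"

lemma Gam_nonneg:
  assumes "\<gamma> \<in> Gam j" "j \<le> g"
  shows "0 \<le> \<gamma> $ k"
proof -
  obtain u l where \<gamma>: "\<gamma> = nat_vec u + (\<Sum>i<j. real (l i) *\<^sub>R gm i)"
    using assms(1) by (auto simp: Gam_def)
  have "0 \<le> (\<Sum>i<j. real (l i) * gm i $ k)"
    using gm_nonneg assms(2) by (intro sum_nonneg mult_nonneg_nonneg) (auto simp: fvec_le)
  then show ?thesis by (simp add: \<gamma> nat_vec_def sum_component)
qed

lemma Gam_mono: "i \<le> j \<Longrightarrow> Gam i \<subseteq> Gam j"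
proof
  fix x assume ij: "i \<le> j" and "x \<in> Gam i"
  then obtain u l where x: "x = nat_vec u + (\<Sum>m<i. real (l m) *\<^sub>R gm m)" by (auto simp: Gam_def)
  have "(\<Sum>m<i. real (l m) *\<^sub>R gm m) = (\<Sum>m<j. real (if m < i then l m else 0) *\<^sub>R gm m)"
    using ij by (intro sum.mono_neutral_cong_left) auto
  then show "x \<in> Gam j" unfolding x by (intro GamI) simp
qed

lemma Gam_subset: "j \<le> g \<Longrightarrow> Gam j \<subseteq> \<Gamma>"
  using Gam_mono [of j g] by (simp add: semigroup_eq)

lemma gm_in_Gam:
  assumes "i < j"
  shows "gm i \<in> Gam j"
proof (rule GamI [of _ 0 "\<lambda>m. if m = i then 1 else 0" j])
  have "(\<Sum>m<j. real (if m = i then 1 else 0) *\<^sub>R gm m) = (\<Sum>m<j. if m = i then gm m else 0)"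
    by (rule sum.cong) auto
  then show "gm i = nat_vec 0 + (\<Sum>m<j. real (if m = i then 1 else 0) *\<^sub>R gm m)"
    using assms by simp
qed

lemma gm_in_semigroup: "i < g \<Longrightarrow> gm i \<in> \<Gamma>"
  by (simp add: semigroup_eq gm_in_Gam)

lemma nat_vec_in_Gam: "nat_vec u \<in> Gam j"
  by (rule GamI [of _ u "\<lambda>_. 0"]) simp

lemma wt_real:
  assumes "\<gamma> \<in> \<Gamma>"
  shows "real (wt \<gamma> $ r) = v r \<bullet> \<gamma>"
proof -
  have "\<gamma> \<in> M g" using assms Gam_subset_M [of g] by (auto simp: semigroup_eq)
  then have "v r \<bullet> \<gamma> \<in> \<int>" using v_dual by (simp add: dual_lattice_def)
  moreover have "0 \<le> v r \<bullet> \<gamma>"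
    unfolding inner_vec_def using v_nonneg Gam_nonneg [of \<gamma> g] assms
    by (intro sum_nonneg) (simp add: semigroup_eq)
  ultimately show ?thesis by (auto simp: wt_def elim!: Ints_cases)
qed

lemma semigroup_add: "x \<in> \<Gamma> \<Longrightarrow> y \<in> \<Gamma> \<Longrightarrow> x + y \<in> \<Gamma>"
  unfolding semigroup_eq by (rule Gam_add)

lemma wt_add:
  assumes "x \<in> \<Gamma>" "y \<in> \<Gamma>"
  shows "wt (x + y) = wt x + wt y"
proof -
  have "real (wt (x + y) $ r) = real ((wt x + wt y) $ r)" for r
    using wt_real [OF semigroup_add [OF assms]] wt_real [OF assms(1)] wt_real [OF assms(2)]
    by (simp add: inner_add_right)
  then have "wt (x + y) $ r = (wt x + wt y) $ r" for r by (simp only: of_nat_eq_iff)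
  then show ?thesis unfolding fvec_eq by blast
qed

lemma wt_0: "wt 0 = 0"
  by (simp add: wt_def fvec_eq)

lemma wt_eq_iff_pairing: "\<gamma> \<in> \<Gamma> \<Longrightarrow> pairing v \<gamma> = (\<chi> r. real (a $ r)) \<longleftrightarrow> wt \<gamma> = a"
  by (simp add: pairing_def fvec_eq wt_real [symmetric])

lemma tpow_pairing: "tpow (pairing v \<gamma>) = to_fract (mmonom (wt \<gamma>))"
  by (simp add: tpow_def pairing_def wt_def)

text \<open>All coordinates of \<open>v r0\<close>, \<open>nat_vec u\<close> and
  \<open>beta g k\<close> are non-negative, so each single product of a coordinate of
  \<open>v r0\<close> with that of \<open>u\<close> is at most \<open>a $ r0\<close>. Positivity of
  \<open>v r0\<close> then bounds \<open>u\<close>.\<close>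

lemma finite_fiber: "finite {\<gamma>\<in>\<Gamma>. wt \<gamma> = a}"
proof -
  define c :: "nat ^ 'd" where "c = (\<chi> k. nat \<lfloor>real (a $ r0) / v r0 $ k\<rfloor>)"
  have "{\<gamma>\<in>\<Gamma>. wt \<gamma> = a} \<subseteq> (\<lambda>(u, k). nat_vec u + beta g k) ` ({u. u \<le> c} \<times> {..<n})"
  proof
    fix \<gamma> assume \<gamma>: "\<gamma> \<in> {\<gamma>\<in>\<Gamma>. wt \<gamma> = a}"
    then obtain u k where uk: "\<gamma> = nat_vec u + beta g k" "k < n" by (auto simp: semigroup_eq_beta)
    have "u $ i \<le> c $ i" for i
    proof -
      have "beta g k \<in> Gam g" by (auto simp: Gam_def beta_def intro!: exI [of _ 0])
      then have "v r0 $ j * (nat_vec u) $ j \<le> v r0 $ j * \<gamma> $ j" for j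
        using Gam_nonneg [of "beta g k" g j] v_nonneg [of r0 j] by (simp add: uk(1) mult_left_mono)
      moreover have "0 \<le> v r0 $ j * \<gamma> $ j" for j
        using Gam_nonneg [of \<gamma> g j] \<gamma> v_nonneg [of r0 j] by (simp add: semigroup_eq)
      then have "v r0 $ i * \<gamma> $ i \<le> (\<Sum>j\<in>UNIV. v r0 $ j * \<gamma> $ j)"
        by (intro member_le_sum) simp_all
      ultimately have "v r0 $ i * (nat_vec u) $ i \<le> (\<Sum>j\<in>UNIV. v r0 $ j * \<gamma> $ j)"
        by (rule order_trans)
      also have "\<dots> = real (a $ r0)"
        using wt_real [of \<gamma> r0] \<gamma> by (simp add: inner_vec_def)
      finally have "real (u $ i) \<le> real (a $ r0) / v r0 $ i"
        using v_pos [of i] by (simp add: nat_vec_def field_simps)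
      then show ?thesis by (simp add: c_def le_nat_floor)
    qed
    then have "u \<in> {u. u \<le> c}" by (simp add: fvec_le)
    with uk show "\<gamma> \<in> (\<lambda>(u, k). nat_vec u + beta g k) ` ({u. u \<le> c} \<times> {..<n})"
      by (intro image_eqI [of _ _ "(u, k)"]) auto
  qed
  then show ?thesis by (rule finite_subset) (simp add: finite_vec_atMost)
qed

section \<open>Generating series of subsets of the semigroup\<close>

definition series :: "(real ^ 'd) set \<Rightarrow> (complex, 'r) mfps" where
  "series X = Mfps (\<lambda>a. of_nat (card {\<gamma>\<in>X. wt \<gamma> = a}))"

lemma series_union:
  assumes X: "X \<subseteq> \<Gamma>" "Y \<subseteq> \<Gamma>" "X \<inter> Y = {}"
  shows "series (X \<union> Y) = series X + series Y"
proof (rule mfps_eqI)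
  fix a
  have fin: "finite {\<gamma>\<in>X. wt \<gamma> = a}" "finite {\<gamma>\<in>Y. wt \<gamma> = a}"
    using X(1,2) by (auto intro: finite_subset [OF _ finite_fiber [of a]])
  have "{\<gamma>\<in>X \<union> Y. wt \<gamma> = a} = {\<gamma>\<in>X. wt \<gamma> = a} \<union> {\<gamma>\<in>Y. wt \<gamma> = a}" by blast
  moreover have "{\<gamma>\<in>X. wt \<gamma> = a} \<inter> {\<gamma>\<in>Y. wt \<gamma> = a} = {}" using X(3) by blast
  ultimately have "card {\<gamma>\<in>X \<union> Y. wt \<gamma> = a} = card {\<gamma>\<in>X. wt \<gamma> = a} + card {\<gamma>\<in>Y. wt \<gamma> = a}"
    using card_Un_disjoint [OF fin] by simp
  then show "mcoeff (series (X \<union> Y)) a = mcoeff (series X + series Y) a" by (simp add: series_def)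
qed

lemma series_UN:
  assumes "finite I" "\<And>i. i \<in> I \<Longrightarrow> X i \<subseteq> \<Gamma>"
    and "\<And>i j. i \<in> I \<Longrightarrow> j \<in> I \<Longrightarrow> i \<noteq> j \<Longrightarrow> X i \<inter> X j = {}"
  shows "series (\<Union>i\<in>I. X i) = (\<Sum>i\<in>I. series (X i))"
  using assms
proof (induction I rule: finite_induct)
  case (insert i I)
  have "X i \<inter> X j = {}" if "j \<in> I" for j
    using insert.prems(2) [of i j] insert.hyps that by auto
  then have "series (X i \<union> (\<Union>i\<in>I. X i)) = series (X i) + series (\<Union>i\<in>I. X i)"
    using insert.prems(1) by (intro series_union) blast+
  then show ?case using insert by simp
qed (simp add: series_def mfps_eq_iff)

lemma series_shift:
  assumes X: "X \<subseteq> \<Gamma>" and b: "b \<in> \<Gamma>"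
  shows "series ((+) b ` X) = mmonom (wt b) * series X"
proof (rule mfps_eqI)
  fix a
  have wt: "wt (b + \<gamma>) = wt b + wt \<gamma>" if "\<gamma> \<in> X" for \<gamma> using wt_add b X that by auto
  show "mcoeff (series ((+) b ` X)) a = mcoeff (mmonom (wt b) * series X) a"
  proof (cases "wt b \<le> a")
    case True
    have "bij_betw ((+) b) {\<gamma>\<in>X. wt \<gamma> = a - wt b} {\<gamma>\<in>(+) b ` X. wt \<gamma> = a}"
      unfolding bij_betw_def
    proof
      show "(+) b ` {\<gamma>\<in>X. wt \<gamma> = a - wt b} = {\<gamma>\<in>(+) b ` X. wt \<gamma> = a}"
        using wt vec_nat_le_diff [OF True] by (auto simp: image_iff)
    qed (auto simp: inj_on_def)
    from bij_betw_same_card [OF this] show ?thesis using True by (simp add: mcoeff_mmonom_mult series_def)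
  next
    case False
    then have "{\<gamma>\<in>(+) b ` X. wt \<gamma> = a} = {}" using wt by auto
    with False show ?thesis
      unfolding series_def mcoeff_Mfps mcoeff_mmonom_mult by (simp only: if_False card.empty of_nat_0)
  qed
qed

lemma wt_nonzero:
  assumes "\<gamma> \<in> \<Gamma>" "\<gamma> \<noteq> 0"
  shows "wt \<gamma> \<noteq> 0"
proof
  assume "wt \<gamma> = 0"
  then have "(\<Sum>j\<in>UNIV. v r0 $ j * \<gamma> $ j) = 0"
    using wt_real [OF assms(1), of r0] by (simp add: inner_vec_def)
  moreover have nn: "0 \<le> \<gamma> $ j" for j using Gam_nonneg [of \<gamma> g j] assms(1) by (simp add: semigroup_eq)
  ultimately have "v r0 $ j * \<gamma> $ j = 0" for j
    using v_nonneg [of r0] by (subst (asm) sum_nonneg_eq_0_iff) auto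
  then have "\<gamma> $ j = 0" for j using v_pos [of j] by (metis less_irrefl mult_eq_0_iff)
  then show False using assms(2) by (simp add: fvec_eq)
qed

lemma one_minus_mmonom_nonzero:
  assumes "\<gamma> \<in> \<Gamma>" "\<gamma> \<noteq> 0"
  shows "1 - mmonom (wt \<gamma>) \<noteq> (0 :: (complex, 'r) mfps)"
  using wt_nonzero [OF assms] mmonom_eq_iff [of "wt \<gamma>" 0] by auto

lemma axis_nat_vec: "axis k 1 = nat_vec (axis k 1)"
  by (simp add: nat_vec_def fvec_eq axis_def)

lemma axis_in_semigroup: "axis k 1 \<in> \<Gamma>"
  unfolding axis_nat_vec semigroup_eq by (rule nat_vec_in_Gam)

definition orthant :: "'d set \<Rightarrow> (real ^ 'd) set" where
  "orthant J = {nat_vec u | u. \<forall>k. k \<notin> J \<longrightarrow> u $ k = 0}"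

lemma orthant_subset: "orthant J \<subseteq> \<Gamma>"
  by (auto simp: orthant_def semigroup_eq nat_vec_in_Gam)

text \<open>The two pieces are told apart by whether the coordinate \<open>k\<close> is
  zero.\<close>

lemma orthant_insert:
  assumes "k \<notin> J"
  shows "orthant (insert k J) = orthant J \<union> (+) (axis k 1) ` orthant (insert k J)"
    and "orthant J \<inter> (+) (axis k 1) ` orthant (insert k J) = {}"
proof -
  show "orthant (insert k J) = orthant J \<union> (+) (axis k 1) ` orthant (insert k J)"
  proof
    show "orthant (insert k J) \<subseteq> orthant J \<union> (+) (axis k 1) ` orthant (insert k J)"
    proof
      fix x assume "x \<in> orthant (insert k J)"
      then obtain u where u: "x = nat_vec u" "\<forall>i. i \<notin> insert k J \<longrightarrow> u $ i = 0" by (auto simp: orthant_def)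
      show "x \<in> orthant J \<union> (+) (axis k 1) ` orthant (insert k J)"
      proof (cases "u $ k = 0")
        case True
        then have "\<forall>i. i \<notin> J \<longrightarrow> u $ i = 0" using u(2) by (metis insertE)
        then show ?thesis using u(1) by (auto simp: orthant_def)
      next
        case False
        then have "(axis k 1 :: nat ^ 'd) \<le> u" by (auto simp: fvec_le axis_def)
        then have "axis k 1 + (u - axis k 1) = u" by (rule vec_nat_le_diff)
        then have "x = axis k 1 + nat_vec (u - axis k 1)"
          unfolding axis_nat_vec nat_vec_add [symmetric] u(1) by simp
        moreover have "nat_vec (u - axis k 1) \<in> orthant (insert k J)"
          using u(2) by (auto simp: orthant_def)
        ultimately show ?thesis by blast
      qed
    qed
    show "orthant J \<union> (+) (axis k 1) ` orthant (insert k J) \<subseteq> orthant (insert k J)"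
    proof
      fix x assume "x \<in> orthant J \<union> (+) (axis k 1) ` orthant (insert k J)"
      then consider "x \<in> orthant J" | u where "x = axis k 1 + nat_vec u" "\<forall>i. i \<notin> insert k J \<longrightarrow> u $ i = 0"
        by (auto simp: orthant_def)
      then show "x \<in> orthant (insert k J)"
      proof cases
        case 1
        then show ?thesis by (auto simp: orthant_def)
      next
        case 2
        have "x = nat_vec (axis k 1 + u)" by (simp add: 2(1) nat_vec_add axis_nat_vec)
        moreover have "\<forall>i. i \<notin> insert k J \<longrightarrow> (axis k 1 + u) $ i = 0" using 2(2) by (auto simp: axis_def)
        ultimately show ?thesis by (auto simp: orthant_def)
      qed
    qed
  qed
  have "x $ k = 0" if "x \<in> orthant J" for x using that assms by (auto simp: orthant_def nat_vec_def)
  moreover have "x $ k \<noteq> 0" if "x \<in> (+) (axis k 1) ` orthant (insert k J)" for x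
    using that by (auto simp: orthant_def nat_vec_def axis_def)
  ultimately show "orthant J \<inter> (+) (axis k 1) ` orthant (insert k J) = {}" by blast
qed

text \<open>A geometric series in one variable at a time: by \<open>orthant_insert\<close> the new
  series is the old one plus its own shift by \<open>axis k 1\<close>.\<close>

lemma series_orthant: "finite J \<Longrightarrow> (\<Prod>k\<in>J. 1 - mmonom (wt (axis k 1))) * series (orthant J) = 1"
proof (induction J rule: finite_induct)
  case empty
  have "orthant {} = {0}"
    by (auto simp: orthant_def nat_vec_def fvec_eq intro!: exI [of _ 0])
  moreover have "{\<gamma>. \<gamma> = 0 \<and> wt \<gamma> = a} = (if a = 0 then {0} else {})" for a by (auto simp: wt_0)
  ultimately show ?case by (simp add: series_def mfps_eq_iff mcoeff_one)
next
  case (insert k J)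
  let ?t = "mmonom (wt (axis k 1)) :: (complex, 'r) mfps"
  have "series (orthant (insert k J)) = series (orthant J) + series ((+) (axis k 1) ` orthant (insert k J))"
    by (subst orthant_insert(1) [OF insert.hyps(2)])
       (intro series_union orthant_insert(2) insert.hyps orthant_subset,
        use orthant_subset axis_in_semigroup semigroup_add in blast)
  then have "(1 - ?t) * series (orthant (insert k J)) = series (orthant J)"
    using series_shift [of "orthant (insert k J)" "axis k 1", OF orthant_subset axis_in_semigroup] by (simp add: algebra_simps)
  moreover have "(\<Prod>i\<in>insert k J. 1 - mmonom (wt (axis i 1))) * series (orthant (insert k J)) =
      (\<Prod>i\<in>J. 1 - mmonom (wt (axis i 1))) * ((1 - ?t) * series (orthant (insert k J)))"
    using insert.hyps by (simp add: ac_simps)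
  ultimately show ?case using insert.IH by metis
qed

lemma Gam_0: "Gam 0 = orthant UNIV"
  by (auto simp: Gam_def orthant_def)

lemma mmonom_wt_power:
  assumes "\<gamma> \<in> \<Gamma>"
  shows "mmonom (wt (real a *\<^sub>R \<gamma>)) = (mmonom (wt \<gamma>) :: (complex, 'r) mfps) ^ a"
proof (induction a)
  case (Suc a)
  have "real a *\<^sub>R \<gamma> \<in> \<Gamma>" using assms by (simp add: semigroup_eq Gam_of_nat)
  then have "wt (real (Suc a) *\<^sub>R \<gamma>) = wt \<gamma> + wt (real a *\<^sub>R \<gamma>)"
    using wt_add [OF assms] by (simp add: scaleR_add_left)
  then show ?case using Suc by (simp add: mmonom_mult [symmetric])
qed (simp add: wt_0)

text \<open>\<open>Gam_Suc\<close> is a disjoint union of translates by multiples of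
  \<open>gm j\<close>, so the series is multiplied by a finite geometric sum in
  \<open>mmonom (wt (gm j))\<close>.\<close>

lemma series_Gam_Suc:
  assumes j: "j < g"
  shows "(1 - mmonom (wt (gm j))) * series (Gam (Suc j)) =
    (1 - mmonom (wt (real (idx (Suc j)) *\<^sub>R gm j))) * series (Gam j)"
proof -
  let ?t = "mmonom (wt (gm j)) :: (complex, 'r) mfps"
  have mem: "real a *\<^sub>R gm j \<in> \<Gamma>" for a using j by (simp add: semigroup_eq Gam_of_nat gm_in_Gam)
  have Gj: "Gam j \<subseteq> \<Gamma>" using Gam_subset j by simp
  have "series (Gam (Suc j)) = (\<Sum>a<idx (Suc j). series ((+) (real a *\<^sub>R gm j) ` Gam j))"
    unfolding Gam_Suc [OF j]
  proof (rule series_UN)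
    fix a show "(+) (real a *\<^sub>R gm j) ` Gam j \<subseteq> \<Gamma>"
      by (rule image_subsetI) (rule semigroup_add [OF mem subsetD [OF Gj]])
  next
    fix a a' assume a: "a \<in> {..<idx (Suc j)}" "a' \<in> {..<idx (Suc j)}" "a \<noteq> a'"
    show "(+) (real a *\<^sub>R gm j) ` Gam j \<inter> (+) (real a' *\<^sub>R gm j) ` Gam j = {}"
    proof (rule ccontr)
      assume "\<not> ?thesis"
      then obtain x x' where x: "x \<in> Gam j" "x' \<in> Gam j" "real a *\<^sub>R gm j + x = real a' *\<^sub>R gm j + x'"
        by blast
      then have "real a *\<^sub>R gm j + x - (real a' *\<^sub>R gm j + x') \<in> M j"
        using add_subgroup_0 [OF add_subgroup_char_lattice] by simp
      moreover have "x \<in> M j" "x' \<in> M j" using x(1,2) Gam_subset_M [of j] j by auto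
      moreover have "a < idx (Suc j)" "a' < idx (Suc j)" using a(1,2) by simp_all
      ultimately have "a = a'" using Gam_digit_unique [OF j] by blast
      with a(3) show False by simp
    qed
  qed simp
  also have "\<dots> = (\<Sum>a<idx (Suc j). ?t ^ a) * series (Gam j)"
    by (simp add: series_shift [OF Gj mem] mmonom_wt_power [OF gm_in_semigroup [OF j]] sum_distrib_right)
  finally have "(1 - ?t) * series (Gam (Suc j)) = (1 - ?t) * (\<Sum>a<idx (Suc j). ?t ^ a) * series (Gam j)"
    by (simp only: mult.assoc)
  then show ?thesis
    by (simp only: mmonom_wt_power [OF gm_in_semigroup [OF j]] one_diff_power_eq)
qed

text \<open>The \<gamma> increase coordinatewise from \<gamma>_1 = \<lambda>_1, which is nonzero
  because \<open>\<zeta>\<close> has no constant term. This keeps the denominators away from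
  zero.\<close>

lemma gm_nonzero:
  assumes "i < g"
  shows "gm i \<noteq> 0"
proof
  assume eq: "gm i = 0"
  have le: "gm j \<le> gm (Suc j)" if "Suc j < g" for j
  proof -
    have "xexp n (ms ! j) \<le> xexp n (ms ! Suc j)"
      using ms_less [of j "Suc j"] that by (simp add: xexp_le_iff n_pos)
    moreover have "gm j $ k \<le> real (idx (Suc j)) * gm j $ k" for k
    proof -
      have "1 \<le> real (idx (Suc j))" using idx_pos [of j] that by simp
      then show ?thesis using gm_nonneg [of j] that mult_right_mono [of 1 "real (idx (Suc j))" "gm j $ k"]
        by (simp add: fvec_le)
    qed
    ultimately show ?thesis using that by (auto simp: gm_Suc fvec_le add_increasing2 intro: add_increasing2)
  qed
  have "gm 0 \<le> gm i"
    using assms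
  proof (induction i)
    case (Suc i)
    then show ?case using le [of i] by (auto intro: order_trans)
  qed simp
  moreover have "0 < g" using assms by linarith
  then have "0 \<le> gm 0" by (rule gm_nonneg)
  ultimately have "gm 0 = 0" using eq by simp
  then have "xexp n (ms ! 0) = xexp n 0" using nth_map [OF \<open>0 < g\<close>, of "xexp n"] by (simp add: gm_0)
  then have "ms ! 0 = 0" using xexp_eq_iff [OF n_pos] by blast
  then show False using ms_nonzero [OF \<open>0 < g\<close>] by blast
qed

lemma to_fract_series_Gam:
  "j \<le> g \<Longrightarrow> to_fract (series (Gam j)) = (\<Prod>k\<in>UNIV. 1 / (1 - tpow (pairing v (axis k 1)))) *
    (\<Prod>i<j. (1 - tpow (pairing v (real (idx (Suc i)) *\<^sub>R gm i))) / (1 - tpow (pairing v (gm i))))"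
proof (induction j)
  case 0
  have "to_fract ((\<Prod>k\<in>UNIV. 1 - mmonom (wt (axis k 1))) * series (Gam 0)) = 1"
    by (simp add: series_orthant Gam_0)
  then have "(\<Prod>k\<in>UNIV. 1 - tpow (pairing v (axis k 1))) * to_fract (series (Gam 0)) = 1"
    by (simp add: tpow_pairing to_fract_prod)
  \<comment> \<open>The denominators here need no separate argument: a product equal to 1 has
    nonzero factors.\<close>
  then have "to_fract (series (Gam 0)) = 1 / (\<Prod>k\<in>UNIV. 1 - tpow (pairing v (axis k 1)))"
    by (metis mult_zero_left nonzero_mult_div_cancel_left zero_neq_one)
  then show ?case by (simp add: prod_dividef)
next
  case (Suc j)
  let ?d = "1 - tpow (pairing v (gm j))" and ?c = "1 - tpow (pairing v (real (idx (Suc j)) *\<^sub>R gm j))"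
  have "to_fract ((1 - mmonom (wt (gm j))) * series (Gam (Suc j))) =
    to_fract ((1 - mmonom (wt (real (idx (Suc j)) *\<^sub>R gm j))) * series (Gam j))"
    using series_Gam_Suc [of j] Suc.prems by simp
  then have "?d * to_fract (series (Gam (Suc j))) = ?c * to_fract (series (Gam j))"
    by (simp add: tpow_pairing)
  moreover have "?d \<noteq> 0"
  proof -
    have "to_fract (1 - mmonom (wt (gm j)) :: (complex, 'r) mfps) \<noteq> 0"
      using one_minus_mmonom_nonzero gm_in_semigroup gm_nonzero Suc.prems by (simp only: to_fract_eq_0_iff Suc_le_lessD not_False_eq_True)
    then show ?thesis by (simp add: tpow_pairing)
  qed
  ultimately have "to_fract (series (Gam (Suc j))) = to_fract (series (Gam j)) * (?c / ?d)"
    by (simp add: field_simps)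
  then show ?case using Suc by (simp add: mult.assoc)
qed

lemma Phi_semigroup: "Phi v (generating_series \<Gamma>) = series \<Gamma>"
proof (rule mfps_eqI)
  fix a :: "nat ^ 'r"
  have "{\<gamma>. generating_series \<Gamma> \<gamma> \<noteq> 0 \<and> pairing v \<gamma> = (\<chi> i. real (a $ i))} = {\<gamma>\<in>\<Gamma>. wt \<gamma> = a}"
    using wt_eq_iff_pairing by (auto simp: generating_series_def)
  moreover have "(\<Sum>\<gamma> | \<gamma> \<in> \<Gamma> \<and> wt \<gamma> = a. generating_series \<Gamma> \<gamma>) = (\<Sum>\<gamma> | \<gamma> \<in> \<Gamma> \<and> wt \<gamma> = a. 1)"
    by (rule sum.cong) (auto simp: generating_series_def)
  ultimately show "mcoeff (Phi v (generating_series \<Gamma>)) a = mcoeff (series \<Gamma>) a"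
    by (simp add: Phi_def series_def)
qed

lemma product_formula:
  "to_fract (Phi v (generating_series \<Gamma>)) = (\<Prod>k\<in>UNIV. 1 / (1 - tpow (pairing v (axis k 1)))) *
    (\<Prod>i = 1..length ls. (1 - tpow (pairing v (real (idx i) *\<^sub>R gam ls i))) / (1 - tpow (pairing v (gam ls i))))"
proof -
  have "(\<Prod>i<g. (1 - tpow (pairing v (real (idx (Suc i)) *\<^sub>R gm i))) / (1 - tpow (pairing v (gm i)))) =
    (\<Prod>i = 1..length ls. (1 - tpow (pairing v (real (idx i) *\<^sub>R gam ls i))) / (1 - tpow (pairing v (gam ls i))))"
    unfolding gm_def by (rule prod.reindex_bij_witness [where i = "\<lambda>i. i - 1" and j = Suc]) auto
  then have "to_fract (series \<Gamma>) = (\<Prod>k\<in>UNIV. 1 / (1 - tpow (pairing v (axis k 1)))) *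
    (\<Prod>i = 1..length ls. (1 - tpow (pairing v (real (idx i) *\<^sub>R gam ls i))) / (1 - tpow (pairing v (gam ls i))))"
    using to_fract_series_Gam [OF order_refl] by (simp only: semigroup_eq)
  then show ?thesis by (simp only: Phi_semigroup)
qed

section \<open>The graded components of the local ring\<close>

sublocale coordinates "\<lambda>c h. mconst c * h" \<Gamma> elem
proof -
  interpret vector_space "\<lambda>c (h :: (complex, 'd) mfps). mconst c * h" by (rule vector_space_mconst)
  show "coordinates (\<lambda>c h. mconst c * h) \<Gamma> elem"
    by unfold_locales (simp_all add: elem_add elem_scale elem_eq_0)
qed

lemma vanishing_empty: "vanishing {} = local_ring f \<zeta>"
  using local_ring_elem elem_in_local_ring by (fastforce simp: vanishing_def)

lemma vanishing_all: "vanishing \<Gamma> = {0}"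
proof -
  have "F = (\<lambda>_. 0)" if "\<forall>\<gamma>. \<gamma> \<notin> \<Gamma> \<longrightarrow> F \<gamma> = 0" "\<forall>\<gamma>\<in>\<Gamma>. F \<gamma> = 0" for F :: "real ^ 'd \<Rightarrow> complex"
    using that by (intro ext) blast
  then show ?thesis
    using subspace_0 [OF subspace_vanishing [of \<Gamma>]] S_zero unfolding vanishing_def by blast
qed

text \<open>The iteration starts with \<open>X = {}\<close> and \<open>D = \<Gamma>\<close>, that
  is, with the local ring modulo zero; after all valuations exactly one fibre of \<open>wt\<close>
  is left.\<close>

lemma graded_component_dim:
  assumes "set is = (UNIV :: 'r set)"
  shows "(let (A, B) = gr_component (local_ring f \<zeta>) {0} (map (\<lambda>i. monomial_val n (v i)) is) (map (\<lambda>i. a $ i) is)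
    in quotient_dim (\<lambda>c h. mconst c * h) A B) = card {\<gamma>\<in>\<Gamma>. wt \<gamma> = a}"
proof -
  have D: "{\<gamma>\<in>\<Gamma>. \<forall>i\<in>set is. wt \<gamma> $ i = a $ i} = {\<gamma>\<in>\<Gamma>. wt \<gamma> = a}"
    using assms by (auto simp: fvec_eq)
  have "\<exists>X. X \<inter> {\<gamma>\<in>\<Gamma>. wt \<gamma> = a} = {} \<and> X \<union> {\<gamma>\<in>\<Gamma>. wt \<gamma> = a} \<subseteq> \<Gamma> \<and>
      gr_component (vanishing {}) (vanishing ({} \<union> \<Gamma>)) (map (\<lambda>i. monomial_val n (v i)) is) (map (\<lambda>i. a $ i) is) =
      (vanishing X, vanishing (X \<union> {\<gamma>\<in>\<Gamma>. wt \<gamma> = a}))"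
    unfolding D [symmetric]
  proof (rule gr_component_vanishing)
    fix i and F :: "real ^ 'd \<Rightarrow> complex"
    show "monomial_val n (v i) (elem F) = (INF \<gamma>\<in>{\<gamma>\<in>\<Gamma>. F \<gamma> \<noteq> 0}. ereal (real (wt \<gamma> $ i)))"
      unfolding monomial_val_elem [OF v_nonneg] by (rule INF_cong) (simp_all add: wt_real)
  qed auto
  then obtain X where X: "X \<inter> {\<gamma>\<in>\<Gamma>. wt \<gamma> = a} = {}" "X \<union> {\<gamma>\<in>\<Gamma>. wt \<gamma> = a} \<subseteq> \<Gamma>"
    "gr_component (local_ring f \<zeta>) {0} (map (\<lambda>i. monomial_val n (v i)) is) (map (\<lambda>i. a $ i) is) =
      (vanishing X, vanishing (X \<union> {\<gamma>\<in>\<Gamma>. wt \<gamma> = a}))"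
    unfolding Un_empty_left vanishing_empty vanishing_all by blast
  show ?thesis unfolding X(3) by (simp add: quotient_dim_vanishing [OF X(1,2) finite_fiber])
qed

end

theorem corollary5p9:
  fixes f :: "(complex, 'd::{finite,linorder}) mfps poly"
    and \<zeta> :: "(complex, 'd::{finite,linorder}) mfps"
    and v :: "'r::{finite,linorder} \<Rightarrow> (real ^ 'd::{finite,linorder})"
    and ls :: "(real ^ 'd::{finite,linorder}) list"
  assumes "irreducible f"
    and "quasi_ordinary f"
    and "ls = char_exponents f"
    and "normalized_exponents ls"
    and "\<zeta> \<in> qo_roots f"
    and "\<And>i. v i \<noteq> 0"
    and "\<And>i. v i \<in> cone_\<sigma> \<inter> dual_lattice (char_lattice ls (length ls))"
    and "v (Min UNIV) \<in> interior cone_\<sigma>"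
  shows "map_mfps of_int (poincare_series f \<zeta> v) = Phi v (generating_series (semigroup_\<Gamma> ls)) \<and>
    to_fract (Phi v (generating_series (semigroup_\<Gamma> ls))) =
      (\<Prod>j\<in>UNIV. 1 / (1 - tpow (pairing v (axis j 1)))) *
      (\<Prod>i = 1..length ls.
         (1 - tpow (pairing v (real (lattice_index ls i) *\<^sub>R gam ls i))) /
         (1 - tpow (pairing v (gam ls i))))"
proof -
  interpret B: quasi_ordinary_branch f \<zeta>
    by unfold_locales (fact assms)+
  have ls: "ls = B.ls" unfolding assms(3) by (rule B.char_exponents_eq)
  \<comment> \<open>\<open>Min UNIV\<close> is the index of the first valuation, whose vector is
    interior to the cone; it takes the role of \<open>r0\<close>.\<close>
  interpret W: weighted_branch f \<zeta> v "Min UNIV"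
  proof unfold_locales
    show "0 \<le> v r $ k" for r k using assms(7) cone_\<sigma>_nonneg by blast
    show "0 < v (Min UNIV) $ k" for k using assms(8) by (rule interior_cone_\<sigma>_pos)
    show "v r \<in> dual_lattice (B.M B.g)" for r using assms(7) [of r] by (simp add: ls)
  qed
  have "map_mfps of_int (poincare_series f \<zeta> v) = W.series (semigroup_\<Gamma> B.ls)"
  proof (rule mfps_eqI)
    fix a
    have "set (sorted_list_of_set (UNIV :: 'r set)) = UNIV" by simp
    note W.graded_component_dim [OF this, of a]
    then show "mcoeff (map_mfps of_int (poincare_series f \<zeta> v)) a = mcoeff (W.series (semigroup_\<Gamma> B.ls)) a"
      by (simp add: map_mfps_def poincare_series_def W.series_def Let_def case_prod_unfold)
  qed
  then show ?thesis unfolding ls by (simp only: W.Phi_semigroup W.product_formula [unfolded W.Phi_semigroup])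
qed

end
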